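(* Let $V$ be a $d$-dimensional vector space over $\mathbb Q$. The space $\mathcal T_d^{\otimes n}(k)$ of multilinear $GL(V)$-equivariant maps of $k$ endomorphisms $(x_1,\dots,x_k)$ of $V$ to $End(V)^{\otimes n}$ is identified with $End_{GL(V)}(V^{\otimes n+k})$. It is linearly spanned by the elements $T^{(n)}_{k,\tau}$, $\tau\in S_{n+k}$, where $$T^{(n)}_{k,\tau}(x_1,\dots,x_k)=\tau_3^{-1}\circ\prod_\ell tr(N_\ell)\;M_1\otimes M_2\otimes\cdots\otimes M_n .$$
   Context: $GL(V)$ acts by (simultaneous, resp. diagonal) conjugation. Permutations act on tensor powers by $\sigma(v_1\otimes\cdots\otimes v_m)=v_{\sigma^{-1}(1)}\otimes\cdots\otimes v_{\sigma^{-1}(m)}$. The identification with $End_{GL(V)}(V^{\otimes n+k})$ is via the nondegenerate trace pairing: $H$ corresponds to $E$ when $tr(H(x_1,\dots,x_k)\,y_1\otimes\cdots\otimes y_n)=tr(E\circ y_1\otimes\cdots\otimes y_n\otimes x_1\otimes\cdots\otimes x_k)$ for all $x_i,y_j\in End(V)$; $T^{(n)}_{k,\tau}$ is the map $H$ corresponding to $E=\tau^{-1}$. Notation in the explicit formula: put $A=\{1,\dots,n\}$, $B=\{n+1,\dots,n+k\}$. Each $\tau\in S_{n+k}$ decomposes uniquely as $\tau=\tau_1\tau_2\tau_3$ (composition right to left) where each nontrivial cycle of $\tau_1$ contains exactly one element of $A$, $\tau_2\in S_B$ is the product of the cycles of $\tau$ permuting only indices of $B$, and $\tau_3\in S_A$.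 For each cycle $(n+j_1,\dots,n+j_p)$ of $\tau$ contained in $B$ (including fixed points of $\tau$ in $B$) there is a factor $tr(N_\ell)$ with $N_\ell=x_{j_1}\cdots x_{j_p}$; and for $i\in A$, $M_i=x_{f_1}\cdots x_{f_p}$ if $(i,n+f_1,\dots,n+f_p)$ is the cycle of $\tau_1$ containing $i$ ($M_i=1$ if $\tau_1$ fixes $i$). *)

theory Defs
  imports Complex_Main "HOL-Library.FuncSet" "HOL-Library.Function_Algebras"
    "HOL-Combinatorics.Combinatorics"
begin

section \<open>Endomorphisms, general linear group, trace\<close>

text \<open>
  A vector space over the rationals is a whole type with a scalar multiplication \<open>s\<close>
  satisfying \<open>vector_space s\<close>.  Addition of maps is pointwise (Function_Algebras);
  \<open>fun_scale s\<close> is the corresponding pointwise scalar multiplication.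
\<close>

definition fun_scale :: "(rat \<Rightarrow> 'b \<Rightarrow> 'b) \<Rightarrow> rat \<Rightarrow> ('a \<Rightarrow> 'b) \<Rightarrow> 'a \<Rightarrow> 'b" where
  "fun_scale s c f = (\<lambda>x. s c (f x))"

definition lin_End :: "(rat \<Rightarrow> 'v \<Rightarrow> 'v::ab_group_add) \<Rightarrow> ('v \<Rightarrow> 'v) set" where
  "lin_End s = {f. Vector_Spaces.linear s s f}"

definition lin_GL :: "(rat \<Rightarrow> 'v \<Rightarrow> 'v::ab_group_add) \<Rightarrow> ('v \<Rightarrow> 'v) set" where
  "lin_GL s = {g \<in> lin_End s. bij g}"

text \<open>
  \<open>extend_basis s {}\<close> is some basis of the whole space.
\<close>

definition lin_trace :: "(rat \<Rightarrow> 'v \<Rightarrow> 'v::ab_group_add) \<Rightarrow> ('v \<Rightarrow> 'v) \<Rightarrow> rat" where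
  "lin_trace s f =
    (let B = vector_space.extend_basis s {}
     in \<Sum>b\<in>B. module.representation s B (f b) b)"

section \<open>Multilinear maps and tensor powers\<close>

text \<open>
  An \<open>m\<close>-tuple with entries in \<open>U\<close> is an element of \<open>{1..m} \<rightarrow>\<^sub>E U\<close>.  Here \<open>U\<close> is a subspace;
  only the values of \<open>f\<close> on such tuples matter.
\<close>

definition multilinear_on ::
  "nat \<Rightarrow> 'a set \<Rightarrow> (rat \<Rightarrow> 'a \<Rightarrow> 'a::ab_group_add) \<Rightarrow> (rat \<Rightarrow> 'b \<Rightarrow> 'b::ab_group_add) \<Rightarrow>
   ((nat \<Rightarrow> 'a) \<Rightarrow> 'b) \<Rightarrow> bool" where
  "multilinear_on m U sa sb f \<longleftrightarrow>
    (\<forall>x \<in> {1..m} \<rightarrow>\<^sub>E U. \<forall>i\<in>{1..m}.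
       (\<forall>a\<in>U. \<forall>b\<in>U. f (x(i := a + b)) = f (x(i := a)) + f (x(i := b))) \<and>
       (\<forall>c. \<forall>a\<in>U. f (x(i := sa c a)) = sb c (f (x(i := a)))))"

text \<open>
  \<open>T\<close> with \<open>tens v = v\<^sub>1 \<otimes> \<dots> \<otimes> v\<^sub>m\<close> is the \<open>m\<close>-th tensor power of \<open>V\<close>: the universal property,
  stated for scalar-valued multilinear forms because a formula cannot quantify over the type of
  the target space.  The lemma below derives it for every target space.
\<close>

definition is_tensor_power ::
  "(rat \<Rightarrow> 'v \<Rightarrow> 'v::ab_group_add) \<Rightarrow> nat \<Rightarrow> (rat \<Rightarrow> 't \<Rightarrow> 't::ab_group_add) \<Rightarrow>
   ((nat \<Rightarrow> 'v) \<Rightarrow> 't) \<Rightarrow> bool" where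
  "is_tensor_power sV m sT tens \<longleftrightarrow>
    vector_space sT \<and>
    multilinear_on m UNIV sV sT tens \<and>
    (\<forall>f. multilinear_on m UNIV sV (*) f \<longrightarrow>
      (\<exists>!F. Vector_Spaces.linear sT (*) F \<and>
            (\<forall>v \<in> {1..m} \<rightarrow>\<^sub>E UNIV. F (tens v) = f v)))"

lemma tensor_power_universal:
  fixes sV :: "rat \<Rightarrow> 'v \<Rightarrow> 'v::ab_group_add"
    and sT :: "rat \<Rightarrow> 't \<Rightarrow> 't::ab_group_add"
    and sW :: "rat \<Rightarrow> 'w \<Rightarrow> 'w::ab_group_add"
  assumes tp: "is_tensor_power sV m sT tens"
    and W: "vector_space sW"
    and f: "multilinear_on m UNIV sV sW f"
  shows "\<exists>!F. Vector_Spaces.linear sT sW F \<and> (\<forall>v \<in> {1..m} \<rightarrow>\<^sub>E UNIV. F (tens v) = f v)"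
proof -
  interpret T: vector_space sT using tp by (simp add: is_tensor_power_def)
  interpret W: vector_space sW by (rule W)
  interpret TW: vector_space_pair sT sW ..
  interpret K: vector_space "(*) :: rat \<Rightarrow> rat \<Rightarrow> rat"
    by unfold_locales (auto simp: algebra_simps)
  interpret TK: vector_space_pair sT "(*) :: rat \<Rightarrow> rat \<Rightarrow> rat" ..
  interpret WK: vector_space_pair sW "(*) :: rat \<Rightarrow> rat \<Rightarrow> rat" ..
  let ?D = "{1..m} \<rightarrow>\<^sub>E (UNIV :: 'v set)"
  let ?P = "tens ` ?D"
  have univ: "\<exists>!F. Vector_Spaces.linear sT (*) F \<and> (\<forall>v \<in> ?D. F (tens v) = h v)"
    if "multilinear_on m UNIV sV (*) h" for h
    using tp that by (simp add: is_tensor_power_def)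
  have spanP: "T.span ?P = UNIV"
  proof (rule ccontr)
    assume "T.span ?P \<noteq> UNIV"
    then obtain t where t: "t \<notin> T.span ?P" by auto
    obtain C where C0: "C \<subseteq> ?P" "T.independent C" "?P \<subseteq> T.span C"
      using T.maximal_independent_subset[of ?P] by blast
    have "T.span C = T.span ?P"
      by (rule equalityI[OF T.span_mono[OF C0(1)] T.span_minimal[OF C0(3) T.subspace_span]])
    with C0 have C: "C \<subseteq> ?P" "T.independent C" "T.span C = T.span ?P" by simp_all
    have tC: "t \<notin> T.span C" using t C by simp
    have ind: "T.independent (insert t C)"
      using tC C(2) by (simp add: T.independent_insert)
    define F where "F = TK.construct (insert t C) (\<lambda>b. if b = t then 1 else 0)"
    have linF: "Vector_Spaces.linear sT (*) F" unfolding F_def by (rule TK.linear_construct[OF ind])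
    have Ft: "F t = 1" unfolding F_def using TK.construct_basis[OF ind] by simp
    have FC: "F b = 0" if "b \<in> C" for b
      unfolding F_def using TK.construct_basis[OF ind, of b] that tC T.span_base by auto
    have "F b = 0" if "b \<in> T.span C" for b
      using TK.linear_eq_0_on_span[OF linF FC that] .
    then have FP: "F (tens v) = 0" if "v \<in> ?D" for v
      using that C(3) T.span_base by blast
    have "multilinear_on m (UNIV :: 'v set) sV (*) (\<lambda>_. 0)"
      by (simp add: multilinear_on_def)
    note U = ex1E[OF univ[OF this]]
    have "Vector_Spaces.linear sT (*) (\<lambda>_. 0 :: rat)" by (rule TK.linear_zero)
    then have "F = (\<lambda>_. 0)" using U linF FP by (metis (no_types, lifting))
    with Ft show False by simp
  qed
  obtain B where B: "B \<subseteq> ?P" "T.independent B" "?P \<subseteq> T.span B"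
    using T.maximal_independent_subset[of ?P] by blast
  have spanB: "T.span B = UNIV"
    using T.span_minimal[OF B(3) T.subspace_span] spanP by blast
  define w where "w b = (SOME v. v \<in> ?D \<and> tens v = b)" for b
  have w: "w b \<in> ?D \<and> tens (w b) = b" if "b \<in> B" for b
  proof -
    have "\<exists>v. v \<in> ?D \<and> tens v = b" using B(1) that by (auto simp: image_iff)
    then show ?thesis unfolding w_def by (rule someI_ex)
  qed
  define F where "F = TW.construct B (\<lambda>b. f (w b))"
  have linF: "Vector_Spaces.linear sT sW F" unfolding F_def by (rule TW.linear_construct[OF B(2)])
  have FB: "F b = f (w b)" if "b \<in> B" for b
    unfolding F_def using TW.construct_basis[OF B(2) that] .
  have Ff: "F (tens v) = f v" if v: "v \<in> ?D" for v
  proof (rule ccontr)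
    assume neq: "F (tens v) \<noteq> f v"
    define u where "u = F (tens v) - f v"
    have u: "W.independent {u}" using neq by (simp add: u_def)
    define \<psi> where "\<psi> = WK.construct {u} (\<lambda>_. 1 :: rat)"
    have lin\<psi>: "Vector_Spaces.linear sW (*) \<psi>" unfolding \<psi>_def by (rule WK.linear_construct[OF u])
    interpret \<psi>: Vector_Spaces.linear sW "(*)" \<psi> by (rule lin\<psi>)
    have \<psi>u: "\<psi> u = 1" unfolding \<psi>_def using WK.construct_basis[OF u] by simp
    have "multilinear_on m UNIV sV (*) (\<lambda>v. \<psi> (f v))"
      using f by (auto simp: multilinear_on_def \<psi>.add \<psi>.scale)
    from univ[OF this] obtain G where linG: "Vector_Spaces.linear sT (*) G"
      and G: "\<And>v. v \<in> ?D \<Longrightarrow> G (tens v) = \<psi> (f v)" by blast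
    have lin\<psi>F: "Vector_Spaces.linear sT (*) (\<psi> \<circ> F)"
      using linF lin\<psi> by (rule Vector_Spaces.linear_compose)
    have "G b = (\<psi> \<circ> F) b" if "b \<in> B" for b
      using G[of "w b"] w[OF that] FB[OF that] by simp
    then have "G t = (\<psi> \<circ> F) t" for t
      using TK.linear_eq_on[OF linG lin\<psi>F] spanB by blast
    then have "\<psi> (F (tens v)) = \<psi> (f v)" using G[OF v] by (metis comp_apply)
    then have "\<psi> u = 0" by (simp add: u_def \<psi>.diff)
    with \<psi>u show False by simp
  qed
  show ?thesis
  proof (rule ex1I[of _ F])
    show "Vector_Spaces.linear sT sW F \<and> (\<forall>v \<in> ?D. F (tens v) = f v)"
      using linF Ff by blast
  next
    fix G assume G: "Vector_Spaces.linear sT sW G \<and> (\<forall>v \<in> ?D. G (tens v) = f v)"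
    have "G t = F t" for t
    proof (rule TW.linear_eq_on[where B = "?P"])
      show "t \<in> T.span ?P" using spanP by blast
      show "G b = F b" if "b \<in> ?P" for b using that G Ff by auto
    qed (use G linF in auto)
    then show "G = F" by blast
  qed
qed

section \<open>Operators on tensor powers\<close>

text \<open>The operator \<open>y\<^sub>1 \<otimes> \<dots> \<otimes> y\<^sub>m\<close>.\<close>

definition tensor_map ::
  "nat \<Rightarrow> (rat \<Rightarrow> 't \<Rightarrow> 't::ab_group_add) \<Rightarrow> ((nat \<Rightarrow> 'v) \<Rightarrow> 't) \<Rightarrow> (nat \<Rightarrow> 'v \<Rightarrow> 'v) \<Rightarrow> 't \<Rightarrow> 't"
  where
  "tensor_map m sT tens y =
    (THE F. Vector_Spaces.linear sT sT F \<and>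
       (\<forall>v \<in> {1..m} \<rightarrow>\<^sub>E UNIV. F (tens v) = tens (\<lambda>i\<in>{1..m}. y i (v i))))"

definition perm_op ::
  "nat \<Rightarrow> (rat \<Rightarrow> 't \<Rightarrow> 't::ab_group_add) \<Rightarrow> ((nat \<Rightarrow> 'v) \<Rightarrow> 't) \<Rightarrow> (nat \<Rightarrow> nat) \<Rightarrow> 't \<Rightarrow> 't"
  where
  "perm_op m sT tens \<sigma> =
    (THE F. Vector_Spaces.linear sT sT F \<and>
       (\<forall>v \<in> {1..m} \<rightarrow>\<^sub>E UNIV. F (tens v) = tens (\<lambda>i\<in>{1..m}. v (inv \<sigma> i))))"

definition End_GL ::
  "(rat \<Rightarrow> 'v \<Rightarrow> 'v::ab_group_add) \<Rightarrow> nat \<Rightarrow> (rat \<Rightarrow> 't \<Rightarrow> 't::ab_group_add) \<Rightarrow>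
   ((nat \<Rightarrow> 'v) \<Rightarrow> 't) \<Rightarrow> ('t \<Rightarrow> 't) set" where
  "End_GL sV m sT tens =
    {E \<in> lin_End sT. \<forall>g \<in> lin_GL sV.
       E \<circ> tensor_map m sT tens (\<lambda>_. g) = tensor_map m sT tens (\<lambda>_. g) \<circ> E}"

section \<open>Equivariant multilinear maps\<close>

text \<open>
  The algebra \<open>End(V)\<^sup>\<otimes>\<^sup>n\<close> is taken to be the endomorphism algebra of the \<open>n\<close>-th tensor power, the usual
  identification in finite dimension.  Maps are extended by zero outside of the \<open>k\<close>-tuples of
  endomorphisms, so that the equivariant maps form a linear subspace of a function space.
\<close>

definition equivariant_maps ::
  "(rat \<Rightarrow> 'v \<Rightarrow> 'v::ab_group_add) \<Rightarrow> nat \<Rightarrow> nat \<Rightarrow> (rat \<Rightarrow> 's \<Rightarrow> 's::ab_group_add) \<Rightarrow>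
   ((nat \<Rightarrow> 'v) \<Rightarrow> 's) \<Rightarrow> ((nat \<Rightarrow> 'v \<Rightarrow> 'v) \<Rightarrow> 's \<Rightarrow> 's) set" where
  "equivariant_maps sV n k sS tens =
    {H. H \<in> ({1..k} \<rightarrow>\<^sub>E lin_End sV) \<rightarrow> lin_End sS \<and>
        (\<forall>x. x \<notin> {1..k} \<rightarrow>\<^sub>E lin_End sV \<longrightarrow> H x = 0) \<and>
        multilinear_on k (lin_End sV) (fun_scale sV) (fun_scale sS) H \<and>
        (\<forall>g \<in> lin_GL sV. \<forall>x \<in> {1..k} \<rightarrow>\<^sub>E lin_End sV.
           H (\<lambda>i\<in>{1..k}. g \<circ> x i \<circ> inv g) =
           tensor_map n sS tens (\<lambda>_. g) \<circ> H x \<circ> tensor_map n sS tens (\<lambda>_. inv g))}"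

text \<open>
  The trace pairing; the family on the right is \<open>y\<^sub>1, \<dots>, y\<^sub>n, x\<^sub>1, \<dots>, x\<^sub>k\<close>.
\<close>

definition corresponds ::
  "(rat \<Rightarrow> 'v \<Rightarrow> 'v::ab_group_add) \<Rightarrow> nat \<Rightarrow> nat \<Rightarrow>
   (rat \<Rightarrow> 's \<Rightarrow> 's::ab_group_add) \<Rightarrow> ((nat \<Rightarrow> 'v) \<Rightarrow> 's) \<Rightarrow>
   (rat \<Rightarrow> 't \<Rightarrow> 't::ab_group_add) \<Rightarrow> ((nat \<Rightarrow> 'v) \<Rightarrow> 't) \<Rightarrow>
   ((nat \<Rightarrow> 'v \<Rightarrow> 'v) \<Rightarrow> 's \<Rightarrow> 's) \<Rightarrow> ('t \<Rightarrow> 't) \<Rightarrow> bool" where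
  "corresponds sV n k sS tensS sT tensT H E \<longleftrightarrow>
    (\<forall>x \<in> {1..k} \<rightarrow>\<^sub>E lin_End sV. \<forall>y \<in> {1..n} \<rightarrow>\<^sub>E lin_End sV.
       lin_trace sS (H x \<circ> tensor_map n sS tensS y) =
       lin_trace sT (E \<circ> tensor_map (n + k) sT tensT (\<lambda>i. if i \<le> n then y i else x (i - n))))"

definition T_map ::
  "(rat \<Rightarrow> 'v \<Rightarrow> 'v::ab_group_add) \<Rightarrow> nat \<Rightarrow> nat \<Rightarrow>
   (rat \<Rightarrow> 's \<Rightarrow> 's::ab_group_add) \<Rightarrow> ((nat \<Rightarrow> 'v) \<Rightarrow> 's) \<Rightarrow>
   (rat \<Rightarrow> 't \<Rightarrow> 't::ab_group_add) \<Rightarrow> ((nat \<Rightarrow> 'v) \<Rightarrow> 't) \<Rightarrow>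
   (nat \<Rightarrow> nat) \<Rightarrow> (nat \<Rightarrow> 'v \<Rightarrow> 'v) \<Rightarrow> 's \<Rightarrow> 's" where
  "T_map sV n k sS tensS sT tensT \<tau> =
    (THE H. H \<in> equivariant_maps sV n k sS tensS \<and>
       corresponds sV n k sS tensS sT tensT H (perm_op (n + k) sT tensT (inv \<tau>)))"

section \<open>The explicit formula\<close>

text \<open>
  With \<open>A = {1..n}\<close> and \<open>B = {n+1..n+k}\<close>.  For a permutation of a finite set, \<open>orbit p i\<close> is the
  cycle through \<open>i\<close> (a singleton for a fixed point) and \<open>support p i\<close> lists it as
  \<open>[i, p i, p (p i), \<dots>]\<close>.
\<close>

definition cycle_splitting ::
  "nat \<Rightarrow> nat \<Rightarrow> (nat \<Rightarrow> nat) \<Rightarrow> (nat \<Rightarrow> nat) \<Rightarrow> (nat \<Rightarrow> nat) \<Rightarrow> (nat \<Rightarrow> nat) \<Rightarrow> bool" where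
  "cycle_splitting n k \<tau> \<tau>1 \<tau>2 \<tau>3 \<longleftrightarrow>
    \<tau>1 permutes {1..n + k} \<and> \<tau>2 permutes {n + 1..n + k} \<and> \<tau>3 permutes {1..n} \<and>
    \<tau> = \<tau>1 \<circ> \<tau>2 \<circ> \<tau>3 \<and>
    (\<forall>i. \<tau>1 i \<noteq> i \<longrightarrow> (\<exists>!a. a \<in> orbit \<tau>1 i \<and> a \<in> {1..n})) \<and>
    \<tau>2 = (\<lambda>i. if orbit \<tau> i \<subseteq> {n + 1..n + k} then \<tau> i else i)"

definition B_cycles :: "nat \<Rightarrow> nat \<Rightarrow> (nat \<Rightarrow> nat) \<Rightarrow> nat set set" where
  "B_cycles n k \<tau> = {C. C \<subseteq> {n + 1..n + k} \<and> (\<exists>b \<in> {n + 1..n + k}. C = orbit \<tau> b)}"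

text \<open>
  \<open>word n x [n + j\<^sub>1, \<dots>, n + j\<^sub>p] = x\<^sub>j\<^sub>1 \<circ> \<dots> \<circ> x\<^sub>j\<^sub>p\<close>
\<close>

definition word :: "nat \<Rightarrow> (nat \<Rightarrow> 'v \<Rightarrow> 'v) \<Rightarrow> nat list \<Rightarrow> 'v \<Rightarrow> 'v" where
  "word n x js = foldr (\<lambda>j f. x (j - n) \<circ> f) js id"

text \<open>
  The factor \<open>tr(N\<^sub>l)\<close> does not depend on where the cycle starts; it is read from its minimum.
\<close>

definition T_formula ::
  "(rat \<Rightarrow> 'v \<Rightarrow> 'v::ab_group_add) \<Rightarrow> nat \<Rightarrow> nat \<Rightarrow>
   (rat \<Rightarrow> 's \<Rightarrow> 's::ab_group_add) \<Rightarrow> ((nat \<Rightarrow> 'v) \<Rightarrow> 's) \<Rightarrow>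
   (nat \<Rightarrow> nat) \<Rightarrow> (nat \<Rightarrow> nat) \<Rightarrow> (nat \<Rightarrow> nat) \<Rightarrow> (nat \<Rightarrow> 'v \<Rightarrow> 'v) \<Rightarrow> 's \<Rightarrow> 's" where
  "T_formula sV n k sS tens \<tau> \<tau>1 \<tau>3 x =
    perm_op n sS tens (inv \<tau>3) \<circ>
    fun_scale sS (\<Prod>C \<in> B_cycles n k \<tau>. lin_trace sV (word n x (support \<tau> (Min C))))
      (tensor_map n sS tens (\<lambda>i. word n x (tl (support \<tau>1 i))))"

end

theory Submission
  imports Defs "HOL-Computational_Algebra.Polynomial"
begin

text \<open>
  In coordinates the trace pairing reads off matrix entries: pairing an operator with a tensor
  product of matrix units gives one of its coefficients.  This makes the correspondence between
  \<open>H\<close> and \<open>E\<close> explicit, and equivariance transfers because the pairing is conjugation invariant.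

  That \<open>End_GL\<close> is spanned by permutations is the double commutant argument in a concrete form.
  An operator \<open>M\<close> commuting with \<open>g \<otimes> \<dots> \<otimes> g\<close> for invertible \<open>g\<close> does so for every \<open>g\<close>,
  as \<open>g + t\<close> is invertible for large \<open>t\<close> and the condition is polynomial in \<open>t\<close>.  By polarization \<open>M\<close>
  commutes with the symmetrized matrix units, and these are exactly the coefficients of the frame operator
  \<open>\<Sum>\<^sub>\<sigma> \<langle>\<sigma>, -\<rangle> \<sigma>\<close>.  Writing the identity as its value at some \<open>u\<close> and multiplying by \<open>M\<close>
  exhibits \<open>M\<close> as a combination of permutations.

  For the explicit formula, \<open>tr(\<tau>\<^sup>-\<^sup>1 \<circ> z\<^sub>1 \<otimes> \<dots> \<otimes> z\<^sub>m)\<close> is a sum over words \<open>w\<close> of the products of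
  the entries of \<open>z\<^bsub>\<tau> j\<^esub>\<close> at \<open>(w\<^sub>j, w\<^bsub>\<tau> j\<^esub>)\<close>.  Summing out the letters at positions in \<open>B\<close> contracts
  every segment of \<open>\<tau>\<close> between consecutive visits to \<open>A\<close> to a single matrix product, and what remains
  is the trace of the first return map \<open>\<tau>3\<close>.
\<close>

section \<open>The double commutant theorem for the symmetric group\<close>

text \<open>Once \<open>n + k\<close> exceeds \<open>d\<close> the permutation operators are
  linearly dependent, so their Gram matrix is singular and the coefficients of an invariant operator
  cannot be found by inverting it. Only the image of the frame operator matters, and this is where
  the ordered field enters: a sum of squares vanishes only termwise, so a residual orthogonal to
  that image is orthogonal to every permutation. For \<open>M\<close> in the commutant the frame
  operator sends \<open>MU\<close> to \<open>M\<close> times its value at \<open>U\<close>; hence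
  the coefficient of \<sigma> in \<open>M\<close> is the pairing of \<sigma> with \<open>MU\<close>,
  where \<open>U\<close> is a preimage of the identity. Coordinates on a tensor power come from the
  universal property, as functionals dual to words in the basis of \<open>V\<close>. The trace is
  defined through an unrelated basis, so it is first shown to be computable from any finite family
  with linear coefficient functionals. The inverse in \<open>perm_op (inv \<tau>)\<close> keeps
  coordinates clean: this operator replaces a tuple \<open>v\<close> by
  \<open>v \<circ> \<tau>\<close>, so \<tau> itself appears in every formula.\<close>

lemma orthogonal_decomposition:
  fixes f :: "'i \<Rightarrow> 'x \<Rightarrow> 'a::linordered_field"
  assumes "finite S" and X: "finite X"
  shows "\<exists>a. \<forall>j\<in>S. (\<Sum>x\<in>X. (v x - (\<Sum>i\<in>S. a i * f i x)) * f j x) = 0"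
  using assms(1)
proof (induction S arbitrary: v)
  case empty
  then show ?case by simp
next
  case (insert s S)
  obtain a where a: "\<And>j. j \<in> S \<Longrightarrow> (\<Sum>x\<in>X. (v x - (\<Sum>i\<in>S. a i * f i x)) * f j x) = 0"
    using insert.IH by blast
  obtain b where b: "\<And>j. j \<in> S \<Longrightarrow> (\<Sum>x\<in>X. (f s x - (\<Sum>i\<in>S. b i * f i x)) * f j x) = 0"
    using insert.IH by blast
  define g where "g x = v x - (\<Sum>i\<in>S. a i * f i x)" for x
  define h where "h x = f s x - (\<Sum>i\<in>S. b i * f i x)" for x
  have g: "(\<Sum>x\<in>X. g x * f j x) = 0" and h: "(\<Sum>x\<in>X. h x * f j x) = 0" if "j \<in> S" for j
    using a b that by (simp_all add: g_def h_def)
  have span0: "(\<Sum>x\<in>X. r x * (\<Sum>i\<in>S. c i * f i x)) = 0"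
    if "\<And>j. j \<in> S \<Longrightarrow> (\<Sum>x\<in>X. r x * f j x) = 0" for r c
  proof -
    have "(\<Sum>x\<in>X. r x * (\<Sum>i\<in>S. c i * f i x)) = (\<Sum>i\<in>S. c i * (\<Sum>x\<in>X. r x * f i x))"
      unfolding sum_distrib_left by (subst sum.swap) (simp add: algebra_simps)
    then show ?thesis using that by simp
  qed
  have fs: "f s x = h x + (\<Sum>i\<in>S. b i * f i x)" for x by (simp add: h_def)
  \<comment> \<open>A vector orthogonal to the old \<open>f i\<close> cannot tell \<open>f s\<close>
    from its residual \<open>h\<close>.\<close>
  have rs: "(\<Sum>x\<in>X. r x * f s x) = (\<Sum>x\<in>X. r x * h x)"
    if "\<And>j. j \<in> S \<Longrightarrow> (\<Sum>x\<in>X. r x * f j x) = 0" for r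
    using span0[OF that, of b] by (simp add: fs distrib_left sum.distrib)
  \<comment> \<open>The Gram-Schmidt coefficient. If \<open>h\<close> has norm zero it vanishes on
    \<open>X\<close> by positivity, and any value of \<open>q\<close> works.\<close>
  define q where "q = (\<Sum>x\<in>X. g x * h x) / (\<Sum>x\<in>X. h x * h x)"
  have hh: "(\<Sum>x\<in>X. (g x - q * h x) * h x) = 0"
  proof (cases "(\<Sum>x\<in>X. h x * h x) = 0")
    case True
    then have "h x = 0" if "x \<in> X" for x
      using X that by (simp add: sum_nonneg_eq_0_iff)
    then show ?thesis by simp
  next
    case False
    have "(\<Sum>x\<in>X. (g x - q * h x) * h x) = (\<Sum>x\<in>X. g x * h x) - q * (\<Sum>x\<in>X. h x * h x)"
      by (simp add: algebra_simps sum_subtractf sum_distrib_left)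
    then show ?thesis using False by (simp add: q_def)
  qed
  \<comment> \<open>Expands \<open>g - q h\<close> in the original family: \<open>h\<close> is
    \<open>f s\<close> minus its \<open>b\<close>-combination.\<close>
  define c where "c i = (if i = s then q else a i - q * b i)" for i
  have "v x - (\<Sum>i\<in>insert s S. c i * f i x) = g x - q * h x" for x
  proof -
    have "(\<Sum>i\<in>S. c i * f i x) = (\<Sum>i\<in>S. a i * f i x) - q * (\<Sum>i\<in>S. b i * f i x)"
      unfolding sum_distrib_left sum_subtractf[symmetric] using insert.hyps
      by (intro sum.cong refl) (auto simp: c_def algebra_simps)
    then show ?thesis using insert.hyps by (simp add: c_def g_def h_def algebra_simps)
  qed
  moreover have S: "(\<Sum>x\<in>X. (g x - q * h x) * f j x) = 0" if "j \<in> S" for j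
  proof -
    have "(\<Sum>x\<in>X. (g x - q * h x) * f j x) = (\<Sum>x\<in>X. g x * f j x) - q * (\<Sum>x\<in>X. h x * f j x)"
      by (simp add: algebra_simps sum_subtractf sum_distrib_left)
    then show ?thesis using g h that by simp
  qed
  moreover have "(\<Sum>x\<in>X. (g x - q * h x) * f s x) = 0"
    using rs[of "\<lambda>x. g x - q * h x"] S hh by simp
  ultimately show ?case by (intro exI[of _ c]) simp
qed

text \<open>Over an ordered field \<open>F F\<^sup>T\<close> has the same image as \<open>F\<close>.\<close>

lemma frame_operator_surjective:
  fixes f :: "'i \<Rightarrow> 'x \<Rightarrow> 'a::linordered_field"
  assumes S: "finite S" and X: "finite X" and j: "j \<in> S"
  shows "\<exists>u. \<forall>x\<in>X. (\<Sum>i\<in>S. (\<Sum>y\<in>X. f i y * u y) * f i x) = f j x"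
proof -
  \<comment> \<open>\<open>g y\<close> is the value of the frame operator at the unit vector of
    \<open>y\<close>, so combinations of the \<open>g y\<close> form the image to be hit. The
    \<open>u\<close> obtained next gives the orthogonal projection of \<open>f j\<close> onto
    it.\<close>
  define g where "g y x = (\<Sum>i\<in>S. f i y * f i x)" for y x
  obtain u where u: "\<And>y. y \<in> X \<Longrightarrow> (\<Sum>x\<in>X. (f j x - (\<Sum>z\<in>X. u z * g z x)) * g y x) = 0"
    using orthogonal_decomposition[OF X X, of "f j" g] by blast
  define h where "h x = f j x - (\<Sum>z\<in>X. u z * g z x)" for x
  have hg: "(\<Sum>x\<in>X. h x * g y x) = 0" if "y \<in> X" for y using u[OF that] by (simp add: h_def)
  \<comment> \<open>The quadratic form of the frame operator at \<open>h\<close> is the sum of the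
    squares of the pairings with the \<open>f i\<close>, so orthogonality to the image forces
    orthogonality to each \<open>f i\<close>.\<close>
  have "(\<Sum>y\<in>X. h y * (\<Sum>x\<in>X. h x * g y x)) = (\<Sum>i\<in>S. (\<Sum>x\<in>X. h x * f i x) * (\<Sum>y\<in>X. h y * f i y))"
  proof -
    have "(\<Sum>y\<in>X. h y * (\<Sum>x\<in>X. h x * g y x)) = (\<Sum>y\<in>X. \<Sum>x\<in>X. \<Sum>i\<in>S. h x * f i x * (h y * f i y))"
      by (simp add: g_def sum_distrib_left algebra_simps)
    also have "\<dots> = (\<Sum>y\<in>X. \<Sum>i\<in>S. \<Sum>x\<in>X. h x * f i x * (h y * f i y))"
      by (intro sum.cong refl sum.swap)
    also have "\<dots> = (\<Sum>i\<in>S. \<Sum>y\<in>X. \<Sum>x\<in>X. h x * f i x * (h y * f i y))"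
      by (rule sum.swap)
    also have "\<dots> = (\<Sum>i\<in>S. (\<Sum>x\<in>X. h x * f i x) * (\<Sum>y\<in>X. h y * f i y))"
      by (simp add: sum_product) (subst sum.swap, simp)
    finally show ?thesis .
  qed
  then have "(\<Sum>i\<in>S. (\<Sum>x\<in>X. h x * f i x) * (\<Sum>y\<in>X. h y * f i y)) = 0" using hg by simp
  then have hf: "(\<Sum>x\<in>X. h x * f i x) = 0" if "i \<in> S" for i
    using S that by (simp add: sum_nonneg_eq_0_iff)
  have "(\<Sum>x\<in>X. h x * h x) = (\<Sum>x\<in>X. h x * f j x) - (\<Sum>x\<in>X. h x * (\<Sum>z\<in>X. u z * g z x))"
    unfolding sum_subtractf[symmetric] right_diff_distrib[symmetric] h_def[symmetric] ..
  also have "(\<Sum>x\<in>X. h x * (\<Sum>z\<in>X. u z * g z x)) = (\<Sum>z\<in>X. u z * (\<Sum>x\<in>X. h x * g z x))"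
    unfolding sum_distrib_left by (subst sum.swap) (simp add: algebra_simps)
  finally have "(\<Sum>x\<in>X. h x * h x) = 0" using hg hf[OF j] by simp
  then have "h x = 0" if "x \<in> X" for x using X that by (simp add: sum_nonneg_eq_0_iff)
  then have "(\<Sum>z\<in>X. u z * g z x) = f j x" if "x \<in> X" for x using that by (simp add: h_def)
  moreover have "(\<Sum>i\<in>S. (\<Sum>y\<in>X. f i y * u y) * f i x) = (\<Sum>z\<in>X. u z * g z x)" for x
    unfolding g_def sum_distrib_left sum_distrib_right
    by (subst sum.swap) (simp add: algebra_simps)
  ultimately show ?thesis by (intro exI[of _ u]) simp
qed

section \<open>Polarization by inclusion and exclusion\<close>

lemma alternating_sum_supersets:
  assumes I: "finite I" and K: "K \<subseteq> I"
  shows "(\<Sum>J | K \<subseteq> J \<and> J \<subseteq> I. (-1) ^ card (I - J)) = (of_bool (K = I) :: 'a::comm_ring_1)"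
proof (cases "K = I")
  case True
  then have "{J. K \<subseteq> J \<and> J \<subseteq> I} = {I}" by auto
  then show ?thesis using True by simp
next
  case False
  then obtain j where j: "j \<in> I" "j \<notin> K" using K by blast
  \<comment> \<open>Toggling membership of a fixed \<open>j\<close> in \<open>I - K\<close> pairs
    the summands with opposite signs.\<close>
  define X where "X = {J. K \<subseteq> J \<and> J \<subseteq> I \<and> j \<notin> J}"
  have fX: "finite X" unfolding X_def by (rule finite_subset[of _ "Pow I"]) (use I in auto)
  have split: "{J. K \<subseteq> J \<and> J \<subseteq> I} = X \<union> insert j ` X"
  proof (intro equalityI subsetI)
    fix J assume J: "J \<in> {J. K \<subseteq> J \<and> J \<subseteq> I}"
    show "J \<in> X \<union> insert j ` X"
    proof (cases "j \<in> J")
      case True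
      then have "J = insert j (J - {j})" "J - {j} \<in> X" using J j by (auto simp: X_def)
      then show ?thesis by blast
    qed (use J in \<open>auto simp: X_def\<close>)
  qed (use j in \<open>auto simp: X_def\<close>)
  have disj: "X \<inter> insert j ` X = {}" by (auto simp: X_def)
  have inj: "inj_on (insert j) X" by (rule inj_onI) (auto simp: X_def)
  have "card (I - J) = Suc (card (I - insert j J))" if "J \<in> X" for J
  proof -
    have "I - J = insert j (I - insert j J)" using that j by (auto simp: X_def)
    then show ?thesis using I by (metis Diff_iff card_insert_disjoint finite_Diff insertI1)
  qed
  then show ?thesis
    using False fX disj inj
    by (simp add: split sum.union_disjoint sum.reindex sum.distrib[symmetric])
qed

text \<open>Expanding the product on the right gives one term for every map from \<open>I\<close> to
  \<open>J\<close>; the signed sum over \<open>J\<close> keeps the surjective maps, which are the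
  permutations of the finite set \<open>I\<close>. When \<open>a j i\<close> is an entry of an
  operator \<open>z j\<close>, each \<open>J\<close> contributes the tensor power of the single
  operator \<open>\<Sum>j\<in>J. z j\<close>, so commuting with powers yields commuting with
  symmetrized products.\<close>

lemma ryser_formula:
  fixes a :: "'i \<Rightarrow> 'i \<Rightarrow> 'a::comm_ring_1"
  assumes I: "finite I"
  shows "(\<Sum>\<sigma> | \<sigma> permutes I. \<Prod>i\<in>I. a (\<sigma> i) i) =
         (\<Sum>J\<in>Pow I. (-1) ^ card (I - J) * (\<Prod>i\<in>I. \<Sum>j\<in>J. a j i))"
proof -
  let ?P = "\<lambda>h. \<Prod>i\<in>I. a (h i) i"
  have fin: "finite (I \<rightarrow>\<^sub>E I)" using I by (simp add: finite_PiE)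
  have "(\<Sum>J\<in>Pow I. (-1) ^ card (I - J) * (\<Prod>i\<in>I. \<Sum>j\<in>J. a j i)) =
        (\<Sum>J\<in>Pow I. \<Sum>h \<in> I \<rightarrow>\<^sub>E I. of_bool (h ` I \<subseteq> J) * (-1) ^ card (I - J) * ?P h)"
  proof (rule sum.cong[OF refl])
    fix J assume J: "J \<in> Pow I"
    have "(\<Prod>i\<in>I. \<Sum>j\<in>J. a j i) = (\<Sum>h \<in> I \<rightarrow>\<^sub>E J. ?P h)"
      by (rule prod_sum_PiE) (use I J finite_subset in auto)
    also have "\<dots> = (\<Sum>h \<in> I \<rightarrow>\<^sub>E I. of_bool (h ` I \<subseteq> J) * ?P h)"
      by (rule sum.mono_neutral_cong_left[OF fin]) (use J in \<open>auto simp: PiE_iff\<close>)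
    finally show "(-1) ^ card (I - J) * (\<Prod>i\<in>I. \<Sum>j\<in>J. a j i) =
        (\<Sum>h \<in> I \<rightarrow>\<^sub>E I. of_bool (h ` I \<subseteq> J) * (-1) ^ card (I - J) * ?P h)"
      by (simp add: sum_distrib_left algebra_simps)
  qed
  also have "\<dots> = (\<Sum>h \<in> I \<rightarrow>\<^sub>E I. (\<Sum>J\<in>Pow I. of_bool (h ` I \<subseteq> J) * (-1) ^ card (I - J)) * ?P h)"
    by (subst sum.swap) (simp add: sum_distrib_right)
  also have "\<dots> = (\<Sum>h \<in> I \<rightarrow>\<^sub>E I. of_bool (h ` I = I) * ?P h)"
  proof (rule sum.cong[OF refl])
    fix h assume h: "h \<in> I \<rightarrow>\<^sub>E I"
    have "(\<Sum>J\<in>Pow I. of_bool (h ` I \<subseteq> J) * (-1) ^ card (I - J)) =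
          (\<Sum>J | h ` I \<subseteq> J \<and> J \<subseteq> I. (-1) ^ card (I - J) :: 'a)"
      by (rule sum.mono_neutral_cong_right) (use I in auto)
    also have "\<dots> = of_bool (h ` I = I)"
      by (rule alternating_sum_supersets[OF I]) (use h in auto)
    finally show "(\<Sum>J\<in>Pow I. of_bool (h ` I \<subseteq> J) * (-1) ^ card (I - J)) * ?P h = of_bool (h ` I = I) * ?P h"
      by simp
  qed
  also have "\<dots> = (\<Sum>h | h \<in> I \<rightarrow>\<^sub>E I \<and> h ` I = I. ?P h)"
    by (rule sum.mono_neutral_cong_right[OF fin]) auto
  also have "\<dots> = (\<Sum>\<sigma> | \<sigma> permutes I. ?P \<sigma>)"
  \<comment> \<open>Maps in the function space are \<open>undefined\<close> off \<open>I\<close>,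
    permutations are the identity there; the two witnesses translate between these
    conventions.\<close>
  proof (rule sum.reindex_bij_witness[where i = "\<lambda>\<sigma>. restrict \<sigma> I"
        and j = "\<lambda>h i. if i \<in> I then h i else i"])
    fix h assume h: "h \<in> {h. h \<in> I \<rightarrow>\<^sub>E I \<and> h ` I = I}"
    show "restrict (\<lambda>i. if i \<in> I then h i else i) I = h"
      using h by (auto simp: fun_eq_iff PiE_iff extensional_def)
    have "inj_on h I" using h I by (simp add: eq_card_imp_inj_on)
    then have "bij_betw h I I" using h by (simp add: bij_betw_def)
    then have "bij_betw (\<lambda>i. if i \<in> I then h i else i) I I"
      by (rule bij_betw_cong[THEN iffD1, rotated]) simp
    then show "(\<lambda>i. if i \<in> I then h i else i) \<in> {\<sigma>. \<sigma> permutes I}"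
      by (auto intro!: bij_imp_permutes)
  next
    fix \<sigma> assume \<sigma>: "\<sigma> \<in> {\<sigma>. \<sigma> permutes I}"
    then show "(\<lambda>i. if i \<in> I then restrict \<sigma> I i else i) = \<sigma>"
      by (auto simp: fun_eq_iff permutes_not_in)
    show "restrict \<sigma> I \<in> {h. h \<in> I \<rightarrow>\<^sub>E I \<and> h ` I = I}"
      using \<sigma> by (auto simp: permutes_image permutes_in_image)
  qed simp
  finally show ?thesis by simp
qed

lemma sum_mult_of_bool_eq:
  fixes f :: "'i \<Rightarrow> 'a::semiring_1"
  assumes "finite A" "c \<in> A"
  shows "(\<Sum>v\<in>A. f v * of_bool (v = c)) = f c"
proof -
  have "(\<Sum>v\<in>A. f v * of_bool (v = c)) = (\<Sum>v\<in>{c}. f v * of_bool (v = c))"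
    by (rule sum.mono_neutral_right) (use assms in auto)
  then show ?thesis by simp
qed

lemma restrict_permutes_in_PiE:
  assumes "\<sigma> permutes I" "w \<in> I \<rightarrow>\<^sub>E B"
  shows "(\<lambda>i\<in>I. w (\<sigma> i)) \<in> I \<rightarrow>\<^sub>E B"
  using assms by (auto simp: permutes_in_image)

lemma prod_of_bool_eq_word:
  assumes "finite I" "v \<in> I \<rightarrow>\<^sub>E B"
  shows "(\<Prod>i\<in>I. of_bool (v i = p i)) = (of_bool (v = restrict p I) :: 'a::comm_semiring_1)"
proof (cases "v = restrict p I")
  case True
  then show ?thesis by simp
next
  case False
  then have "\<not> (\<forall>i\<in>I. v i = p i)"
    using assms(2) by (auto simp: fun_eq_iff PiE_iff extensional_def split: if_splits)
  then obtain i where "i \<in> I" "v i \<noteq> p i" by blast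
  then have "(\<Prod>i\<in>I. of_bool (v i = p i)) = (0 :: 'a)"
    using assms(1) by (intro prod_zero) auto
  then show ?thesis using False by simp
qed

text \<open>Polarized with matrix units, the hypothesis lets \<open>m\<close> pass from outside the
  frame operator to its argument; at a preimage of the identity this writes \<open>m\<close> as a
  combination of permutations. The hypothesis covers singular \<open>z\<close> as well, because sums
  of matrix units are in general not invertible.\<close>

lemma commutant_of_tensor_powers:
  fixes m :: "('i \<Rightarrow> 'b) \<Rightarrow> ('i \<Rightarrow> 'b) \<Rightarrow> 'a::linordered_field"
  assumes I: "finite I" and B: "finite B"
    and comm: "\<And>z u w. u \<in> I \<rightarrow>\<^sub>E B \<Longrightarrow> w \<in> I \<rightarrow>\<^sub>E B \<Longrightarrow>
      (\<Sum>v \<in> I \<rightarrow>\<^sub>E B. m u v * (\<Prod>i\<in>I. z (v i) (w i))) =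
      (\<Sum>v \<in> I \<rightarrow>\<^sub>E B. (\<Prod>i\<in>I. z (u i) (v i)) * m v w)"
  shows "\<exists>\<alpha>. \<forall>u \<in> I \<rightarrow>\<^sub>E B. \<forall>w \<in> I \<rightarrow>\<^sub>E B.
    m u w = (\<Sum>\<sigma> | \<sigma> permutes I. \<alpha> \<sigma> * of_bool (u = (\<lambda>i\<in>I. w (\<sigma> i))))"
proof -
  let ?W = "I \<rightarrow>\<^sub>E B" and ?S = "{\<sigma>. \<sigma> permutes I}"
  define act where "act w \<sigma> = (\<lambda>i\<in>I. w (\<sigma> i))" for w :: "'i \<Rightarrow> 'b" and \<sigma>
  have fW: "finite ?W" using I B by (simp add: finite_PiE)
  have fS: "finite ?S" using I by (rule finite_permutations)
  have actW: "act w \<sigma> \<in> ?W" if "w \<in> ?W" "\<sigma> \<in> ?S" for w \<sigma>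
    unfolding act_def using that by (intro restrict_permutes_in_PiE) auto
  \<comment> \<open>Polarization: \<open>z\<close> may now depend on the tensor slot, at the price
    of symmetrizing.\<close>
  have sym: "(\<Sum>v\<in>?W. m u v * (\<Sum>\<sigma>\<in>?S. \<Prod>i\<in>I. z (\<sigma> i) (v i) (w i))) =
      (\<Sum>v\<in>?W. (\<Sum>\<sigma>\<in>?S. \<Prod>i\<in>I. z (\<sigma> i) (u i) (v i)) * m v w)"
    if "u \<in> ?W" "w \<in> ?W" for z u w
  proof -
    have "(\<Sum>v\<in>?W. m u v * (\<Sum>\<sigma>\<in>?S. \<Prod>i\<in>I. z (\<sigma> i) (v i) (w i))) =
        (\<Sum>v\<in>?W. \<Sum>J\<in>Pow I. (-1) ^ card (I - J) * (m u v * (\<Prod>i\<in>I. \<Sum>j\<in>J. z j (v i) (w i))))"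
      by (subst ryser_formula[OF I, of "\<lambda>j i. z j (_ i) (w i)"]) (simp add: sum_distrib_left algebra_simps)
    also have "\<dots> = (\<Sum>J\<in>Pow I. (-1) ^ card (I - J) * (\<Sum>v\<in>?W. m u v * (\<Prod>i\<in>I. \<Sum>j\<in>J. z j (v i) (w i))))"
      by (subst sum.swap) (simp add: sum_distrib_left)
    also have "\<dots> = (\<Sum>J\<in>Pow I. (-1) ^ card (I - J) * (\<Sum>v\<in>?W. (\<Prod>i\<in>I. \<Sum>j\<in>J. z j (u i) (v i)) * m v w))"
      using comm[OF that, of "\<lambda>x y. \<Sum>j\<in>_. z j x y"] by simp
    also have "\<dots> = (\<Sum>v\<in>?W. \<Sum>J\<in>Pow I. (-1) ^ card (I - J) * ((\<Prod>i\<in>I. \<Sum>j\<in>J. z j (u i) (v i)) * m v w))"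
      by (subst sum.swap) (simp add: sum_distrib_left)
    also have "\<dots> = (\<Sum>v\<in>?W. (\<Sum>\<sigma>\<in>?S. \<Prod>i\<in>I. z (\<sigma> i) (u i) (v i)) * m v w)"
      by (subst ryser_formula[OF I, of "\<lambda>j i. z j (u i) (_ i)"]) (simp add: sum_distrib_right mult.assoc)
    finally show ?thesis .
  qed
  \<comment> \<open>With \<open>z j\<close> the matrix unit at \<open>(p j, q j)\<close>, the
    symmetrized product is the sum over \<sigma> of the units at
    \<open>(act p \<sigma>, act q \<sigma>)\<close>.\<close>
  have key: "(\<Sum>\<sigma>\<in>?S. m u (act p \<sigma>) * of_bool (w = act q \<sigma>)) =
      (\<Sum>\<sigma>\<in>?S. of_bool (u = act p \<sigma>) * m (act q \<sigma>) w)"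
    if u: "u \<in> ?W" and w: "w \<in> ?W" and p: "p \<in> ?W" and q: "q \<in> ?W" for u w p q
  proof -
    define z where "z j x y = (of_bool (x = p j) * of_bool (y = q j) :: 'a)" for j x y
    have z: "(\<Prod>i\<in>I. z (\<sigma> i) (v i) (v' i)) = of_bool (v = act p \<sigma>) * of_bool (v' = act q \<sigma>)"
      if "v \<in> ?W" "v' \<in> ?W" for v v' \<sigma>
      unfolding z_def prod.distrib act_def
      by (simp only: prod_of_bool_eq_word[OF I that(1)] prod_of_bool_eq_word[OF I that(2)])
    have "(\<Sum>\<sigma>\<in>?S. m u (act p \<sigma>) * of_bool (w = act q \<sigma>)) =
        (\<Sum>\<sigma>\<in>?S. \<Sum>v\<in>?W. m u v * (of_bool (v = act p \<sigma>) * of_bool (w = act q \<sigma>)))"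
    proof (rule sum.cong[OF refl])
      fix \<sigma> assume "\<sigma> \<in> ?S"
      then show "m u (act p \<sigma>) * of_bool (w = act q \<sigma>) =
          (\<Sum>v\<in>?W. m u v * (of_bool (v = act p \<sigma>) * of_bool (w = act q \<sigma>)))"
        using actW[OF p] fW by (simp add: of_bool_def if_distrib[where f = "\<lambda>x. _ * x"] cong: if_cong)
    qed
    also have "\<dots> = (\<Sum>v\<in>?W. m u v * (\<Sum>\<sigma>\<in>?S. \<Prod>i\<in>I. z (\<sigma> i) (v i) (w i)))"
      by (subst sum.swap) (simp add: z w sum_distrib_left)
    also have "\<dots> = (\<Sum>v\<in>?W. (\<Sum>\<sigma>\<in>?S. \<Prod>i\<in>I. z (\<sigma> i) (u i) (v i)) * m v w)"
      by (rule sym[OF u w])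
    also have "\<dots> = (\<Sum>\<sigma>\<in>?S. \<Sum>v\<in>?W. of_bool (u = act p \<sigma>) * of_bool (v = act q \<sigma>) * m v w)"
      by (subst sum.swap) (simp add: z u sum_distrib_right)
    also have "\<dots> = (\<Sum>\<sigma>\<in>?S. of_bool (u = act p \<sigma>) * m (act q \<sigma>) w)"
    proof (rule sum.cong[OF refl])
      fix \<sigma> assume "\<sigma> \<in> ?S"
      then show "(\<Sum>v\<in>?W. of_bool (u = act p \<sigma>) * of_bool (v = act q \<sigma>) * m v w) =
          of_bool (u = act p \<sigma>) * m (act q \<sigma>) w"
        using actW[OF q] fW by (simp add: of_bool_def)
          (auto simp: if_distrib[where f = "\<lambda>x. x * _"] cong: if_cong)
    qed
    finally show ?thesis .
  qed
  \<comment> \<open>\<open>f \<sigma>\<close> is the permutation matrix of \<sigma> viewed as a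
    vector of entries; \<open>f id\<close> is the identity matrix, and \<open>U\<close> will be a
    preimage of it.\<close>
  define f where "f \<sigma> = (\<lambda>(x, y). of_bool (x = act y \<sigma>) :: 'a)" for \<sigma>
  have "finite (?W \<times> ?W)" using fW by simp
  moreover have "id \<in> ?S" by (simp add: permutes_id)
  ultimately obtain U where U: "\<forall>x\<in>?W \<times> ?W. (\<Sum>\<sigma>\<in>?S. (\<Sum>y\<in>?W \<times> ?W. f \<sigma> y * U y) * f \<sigma> x) = f id x"
    using frame_operator_surjective[OF fS, of "?W \<times> ?W" id f] by blast
  have fU: "(\<Sum>y\<in>?W \<times> ?W. f \<sigma> y * U y) = (\<Sum>a\<in>?W. \<Sum>w\<in>?W. of_bool (w = act a \<sigma>) * U (w, a))" for \<sigma>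
  proof -
    have "(\<Sum>y\<in>?W \<times> ?W. f \<sigma> y * U y) = (\<Sum>w\<in>?W. \<Sum>a\<in>?W. of_bool (w = act a \<sigma>) * U (w, a))"
      by (simp add: f_def sum.cartesian_product split_def)
    also have "\<dots> = (\<Sum>a\<in>?W. \<Sum>w\<in>?W. of_bool (w = act a \<sigma>) * U (w, a))"
      by (rule sum.swap)
    finally show ?thesis .
  qed
  have delta: "(\<Sum>\<sigma>\<in>?S. (\<Sum>a\<in>?W. \<Sum>w\<in>?W. of_bool (w = act a \<sigma>) * U (w, a)) * of_bool (x = act c \<sigma>)) =
      of_bool (x = c)" if "x \<in> ?W" "c \<in> ?W" for x c
  proof -
    have "act c id = c" using that(2) by (auto simp: act_def fun_eq_iff PiE_iff extensional_def)
    moreover have "f \<sigma> (x, c) = of_bool (x = act c \<sigma>)" for \<sigma> by (simp add: f_def)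
    moreover have "(x, c) \<in> ?W \<times> ?W" using that by simp
    ultimately show ?thesis using bspec[OF U, of "(x, c)"] by (simp only: fU)
  qed
  \<comment> \<open>The pairing of the permutation matrix of \<sigma> with the matrix product of
    \<open>m\<close> and \<open>U\<close>.\<close>
  define \<alpha> where "\<alpha> \<sigma> = (\<Sum>a\<in>?W. \<Sum>w\<in>?W. U (w, a) * m (act a \<sigma>) w)" for \<sigma>
  have "m x c = (\<Sum>\<sigma>\<in>?S. \<alpha> \<sigma> * of_bool (x = act c \<sigma>))" if x: "x \<in> ?W" and c: "c \<in> ?W" for x c
  proof -
    have "m x c = (\<Sum>v\<in>?W. m x v * of_bool (v = c))" by (rule sum_mult_of_bool_eq[OF fW c, symmetric])
    also have "\<dots> = (\<Sum>v\<in>?W. \<Sum>\<sigma>\<in>?S. (\<Sum>a\<in>?W. \<Sum>w\<in>?W. of_bool (w = act a \<sigma>) * U (w, a)) *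
        (m x v * of_bool (v = act c \<sigma>)))"
      by (simp add: delta[OF _ c, symmetric] sum_distrib_left algebra_simps)
    also have "\<dots> = (\<Sum>\<sigma>\<in>?S. (\<Sum>a\<in>?W. \<Sum>w\<in>?W. of_bool (w = act a \<sigma>) * U (w, a)) *
        (\<Sum>v\<in>?W. m x v * of_bool (v = act c \<sigma>)))"
      by (subst sum.swap) (simp add: sum_distrib_left)
    also have "\<dots> = (\<Sum>\<sigma>\<in>?S. (\<Sum>a\<in>?W. \<Sum>w\<in>?W. of_bool (w = act a \<sigma>) * U (w, a)) * m x (act c \<sigma>))"
      using actW[OF c] by (intro sum.cong refl) (simp add: sum_mult_of_bool_eq[OF fW])
    also have "\<dots> = (\<Sum>\<sigma>\<in>?S. \<Sum>a\<in>?W. \<Sum>w\<in>?W. U (w, a) * (m x (act c \<sigma>) * of_bool (w = act a \<sigma>)))"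
      by (simp add: sum_distrib_left sum_distrib_right algebra_simps)
    also have "\<dots> = (\<Sum>a\<in>?W. \<Sum>w\<in>?W. \<Sum>\<sigma>\<in>?S. U (w, a) * (m x (act c \<sigma>) * of_bool (w = act a \<sigma>)))"
      by (subst sum.swap) (intro sum.cong refl sum.swap)
    \<comment> \<open>Here \<open>m\<close> moves from the outer position to the argument of the
      frame operator.\<close>
    also have "\<dots> = (\<Sum>a\<in>?W. \<Sum>w\<in>?W. \<Sum>\<sigma>\<in>?S. U (w, a) * (of_bool (x = act c \<sigma>) * m (act a \<sigma>) w))"
      unfolding sum_distrib_left[symmetric]
      by (rule sum.cong[OF refl], rule sum.cong[OF refl]) (simp only: key[OF x _ c])
    also have "\<dots> = (\<Sum>\<sigma>\<in>?S. \<Sum>a\<in>?W. \<Sum>w\<in>?W. U (w, a) * (of_bool (x = act c \<sigma>) * m (act a \<sigma>) w))"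
      by (subst sum.swap[of _ ?S]) (intro sum.cong refl sum.swap)
    also have "\<dots> = (\<Sum>\<sigma>\<in>?S. \<alpha> \<sigma> * of_bool (x = act c \<sigma>))"
      by (simp add: \<alpha>_def sum_distrib_left sum_distrib_right algebra_simps)
    finally show ?thesis .
  qed
  then show ?thesis unfolding act_def by blast
qed

section \<open>Multilinear maps, traces and matrix units\<close>

lemma vector_space_rat: "vector_space ((*) :: rat \<Rightarrow> rat \<Rightarrow> rat)"
  by unfold_locales (auto simp: algebra_simps)

lemma vector_space_fun_scale:
  assumes "vector_space s"
  shows "vector_space (fun_scale s)"
proof -
  interpret vector_space s by fact
  show ?thesis
    by unfold_locales (simp_all add: fun_scale_def fun_eq_iff scale_right_distrib scale_left_distrib)
qed

lemma linear_rat_iff: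
  fixes sA :: "rat \<Rightarrow> 'a \<Rightarrow> 'a::ab_group_add" and sB :: "rat \<Rightarrow> 'b \<Rightarrow> 'b::ab_group_add"
  assumes "vector_space sA" "vector_space sB"
  shows "Vector_Spaces.linear sA sB f \<longleftrightarrow> (\<forall>x y. f (x + y) = f x + f y) \<and> (\<forall>c x. f (sA c x) = sB c (f x))"
proof -
  show ?thesis using assms by (auto simp: Vector_Spaces.linear_iff)
qed

lemma multilinear_on_add:
  "multilinear_on m U sa sb f \<Longrightarrow> x \<in> {1..m} \<rightarrow>\<^sub>E U \<Longrightarrow> i \<in> {1..m} \<Longrightarrow> a \<in> U \<Longrightarrow> b \<in> U \<Longrightarrow>
    f (x(i := a + b)) = f (x(i := a)) + f (x(i := b))"
  and multilinear_on_scale: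
  "multilinear_on m U sa sb f \<Longrightarrow> x \<in> {1..m} \<rightarrow>\<^sub>E U \<Longrightarrow> i \<in> {1..m} \<Longrightarrow> a \<in> U \<Longrightarrow>
    f (x(i := sa c a)) = sb c (f (x(i := a)))"
  by (simp_all add: multilinear_on_def)

text \<open>The slots are released from \<open>P\<close> to \<open>U\<close> one at a time;
  \<open>j\<close> counts those already released.\<close>

lemma multilinear_on_eq_on_span:
  assumes sa: "vector_space sa" and sb: "vector_space sb"
    and f: "multilinear_on m U sa sb f" and g: "multilinear_on m U sa sb g"
    and U: "module.subspace sa U" and P: "P \<subseteq> U" "U \<subseteq> module.span sa P"
    and eq: "\<And>x. x \<in> {1..m} \<rightarrow>\<^sub>E P \<Longrightarrow> f x = g x"
    and x: "x \<in> {1..m} \<rightarrow>\<^sub>E U"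
  shows "f x = g x"
proof -
  interpret A: vector_space sa by fact
  interpret B: vector_space sb by fact
  have "f x = g x" if "j \<le> m" "x \<in> {1..m} \<rightarrow>\<^sub>E U" "\<forall>i\<in>{j<..m}. x i \<in> P" for j x
    using that
  proof (induction j arbitrary: x)
    case 0
    then have "x \<in> {1..m} \<rightarrow>\<^sub>E P" by (fastforce simp: PiE_iff)
    then show ?case by (rule eq)
  next
    case (Suc j)
    let ?i = "Suc j"
    have i: "?i \<in> {1..m}" using Suc.prems by simp
    have "x ?i \<in> A.span P" using Suc.prems(2) i P by (auto simp: PiE_iff)
    \<comment> \<open>Membership in \<open>U\<close> is carried along the span induction because
      additivity is only available for arguments in \<open>U\<close>.\<close>
    moreover have "a \<in> U \<and> f (x(?i := a)) = g (x(?i := a))" if "a \<in> A.span P" for a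
      using that
    proof (induction rule: A.span_induct_alt)
      case base
      have "0 \<in> U" by (rule A.subspace_0[OF U])
      then show ?case
        using multilinear_on_scale[OF f Suc.prems(2) i, of 0 0] multilinear_on_scale[OF g Suc.prems(2) i, of 0 0]
        by (simp add: fun_upd_def)
    next
      case (step c p a)
      have p: "p \<in> U" using step.hyps P(1) by blast
      have cp: "sa c p \<in> U" by (rule A.subspace_scale[OF U p])
      have "x(?i := p) \<in> {1..m} \<rightarrow>\<^sub>E U" using Suc.prems(2) i p 
        by (auto simp: PiE_iff extensional_def)
      moreover have "\<forall>l\<in>{j<..m}. (x(?i := p)) l \<in> P" using Suc.prems(3) step.hyps by auto
      ultimately have "f (x(?i := p)) = g (x(?i := p))" using Suc.prems(1) by (intro Suc.IH) auto
      then show ?case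
        using step.IH A.subspace_add[OF U cp, of a]
          multilinear_on_add[OF f Suc.prems(2) i cp, of a] multilinear_on_add[OF g Suc.prems(2) i cp, of a]
          multilinear_on_scale[OF f Suc.prems(2) i p] multilinear_on_scale[OF g Suc.prems(2) i p]
        by (simp add: fun_upd_def)
    qed
    ultimately show ?case by (metis fun_upd_triv)
  qed
  from this[of m x] x show ?thesis by simp
qed

text \<open>\<open>lin_trace\<close> refers to an unspecified basis. Expanding \<open>F b\<close>
  through \<open>e\<close>, and \<open>e w\<close> through that basis, turns both sides into the
  same double sum; so the trace can be read from any finite family with linear coefficient
  functionals, linearly independent or not.\<close>

lemma lin_trace_eq_sum_dual:
  assumes "vector_space s" and W: "finite W"
    and \<phi>: "\<And>w. w \<in> W \<Longrightarrow> Vector_Spaces.linear s (*) (\<phi> w)"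
    and expand: "\<And>t. t = (\<Sum>w\<in>W. s (\<phi> w t) (e w))"
    and F: "Vector_Spaces.linear s s F"
  shows "lin_trace s F = (\<Sum>w\<in>W. \<phi> w (F (e w)))"
proof -
  interpret vector_space s by fact
  interpret F: Vector_Spaces.linear s s F by fact
  define B where "B = extend_basis {}"
  have ind: "independent B" and span: "span B = UNIV"
    by (simp_all add: B_def independent_extend_basis independent_empty span_extend_basis)
  \<comment> \<open>The expansion hypothesis makes the finite family spanning, which bounds the
    unspecified basis.\<close>
  have "t \<in> span (e ` W)" for t
    by (subst expand) (intro span_sum span_scale span_base imageI)
  then have B: "finite B"
    using independent_span_bound[OF finite_imageI[OF W, of e] ind] by auto
  have rep: "(\<Sum>b\<in>B. s (representation B t b) b) = t" for t
    by (rule sum_representation_eq) (use ind span B in auto)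
  have "lin_trace s F = (\<Sum>b\<in>B. representation B (F b) b)"
    by (simp add: lin_trace_def B_def[symmetric])
  also have "\<dots> = (\<Sum>b\<in>B. \<Sum>w\<in>W. \<phi> w (F b) * representation B (e w) b)"
  proof (rule sum.cong[OF refl])
    fix b
    have "representation B (F b) b = representation B (\<Sum>w\<in>W. s (\<phi> w (F b)) (e w)) b"
      by (subst expand) simp
    also have "\<dots> = (\<Sum>w\<in>W. \<phi> w (F b) * representation B (e w) b)"
      using ind span by (simp add: representation_sum representation_scale)
    finally show "representation B (F b) b = \<dots>" .
  qed
  also have "\<dots> = (\<Sum>w\<in>W. \<Sum>b\<in>B. \<phi> w (F b) * representation B (e w) b)"
    by (rule sum.swap)
  also have "\<dots> = (\<Sum>w\<in>W. \<phi> w (F (e w)))"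
  proof (rule sum.cong[OF refl])
    fix w assume "w \<in> W"
    then interpret \<phi>: Vector_Spaces.linear s "(*)" "\<phi> w" by (rule \<phi>)
    have "\<phi> w (F (e w)) = \<phi> w (F (\<Sum>b\<in>B. s (representation B (e w) b) b))" by (simp add: rep)
    also have "\<dots> = (\<Sum>b\<in>B. \<phi> w (F b) * representation B (e w) b)"
      by (simp add: F.sum F.scale \<phi>.sum \<phi>.scale algebra_simps)
    finally show "(\<Sum>b\<in>B. \<phi> w (F b) * representation B (e w) b) = \<phi> w (F (e w))" by simp
  qed
  finally show ?thesis .
qed

section \<open>Matrices of endomorphisms\<close>

locale fd_rat_space = finite_dimensional_vector_space s B
  for s :: "rat \<Rightarrow> 'v::ab_group_add \<Rightarrow> 'v" and B
begin

definition mat :: "('v \<Rightarrow> 'v) \<Rightarrow> 'v \<Rightarrow> 'v \<Rightarrow> rat" where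
  "mat z b c = representation B (z c) b"

definition munit :: "'v \<Rightarrow> 'v \<Rightarrow> 'v \<Rightarrow> 'v" where
  "munit b c v = s (representation B v c) b"

lemma span_UNIV: "v \<in> span B" by (simp add: span_Basis)

lemmas rep_add = representation_add[OF independent_Basis span_UNIV span_UNIV]
lemmas rep_scale = representation_scale[OF independent_Basis span_UNIV]
lemmas rep_basis = representation_basis[OF independent_Basis]

lemma rep_sum: "representation B (sum f A) b = (\<Sum>a\<in>A. representation B (f a) b)"
  by (simp add: representation_sum[OF independent_Basis] span_UNIV)

lemma rep_expand: "(\<Sum>b\<in>B. s (representation B v b) b) = v"
  by (rule sum_representation_eq) (simp_all add: independent_Basis finite_Basis span_UNIV)

lemma linear_iff': "z \<in> lin_End s \<longleftrightarrow> (\<forall>x y. z (x + y) = z x + z y) \<and> (\<forall>c x. z (s c x) = s c (z x))"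
  unfolding lin_End_def by (simp add: linear_rat_iff vector_space_axioms)

lemma linear_rep: "Vector_Spaces.linear s (*) (\<lambda>v. representation B v b)"
  by (simp add: linear_rat_iff vector_space_axioms vector_space_rat rep_add rep_scale)

lemma munit_lin: "munit b c \<in> lin_End s"
  by (simp add: linear_iff' munit_def rep_add rep_scale scale_left_distrib)

lemma mat_munit:
  assumes "b \<in> B" "c \<in> B" "a' \<in> B"
  shows "mat (munit b c) a a' = of_bool (a = b) * of_bool (a' = c)"
  using assms by (auto simp: mat_def munit_def rep_scale rep_basis)

lemma rep_apply:
  assumes "z \<in> lin_End s"
  shows "representation B (z v) b = (\<Sum>c\<in>B. mat z b c * representation B v c)"
proof -
  interpret z: Vector_Spaces.linear s s z using assms by (simp add: lin_End_def)
  have "representation B (z v) b = representation B (z (\<Sum>c\<in>B. s (representation B v c) c)) b"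
    by (simp add: rep_expand)
  also have "\<dots> = (\<Sum>c\<in>B. mat z b c * representation B v c)"
    by (simp add: z.sum z.scale rep_sum rep_scale mat_def algebra_simps)
  finally show ?thesis .
qed

lemma mat_comp:
  "y \<in> lin_End s \<Longrightarrow> mat (y \<circ> z) a c = (\<Sum>b\<in>B. mat y a b * mat z b c)"
  unfolding mat_def comp_def by (subst rep_apply) (simp_all add: mat_def)

lemma mat_id: "c \<in> B \<Longrightarrow> mat id b c = of_bool (b = c)"
  by (auto simp: mat_def rep_basis)

lemma mat_add: "mat (y + z) b c = mat y b c + mat z b c"
  and mat_scale: "mat (fun_scale s r z) b c = r * mat z b c"
  by (simp_all add: mat_def fun_scale_def rep_add rep_scale)

lemma lin_trace_mat: "z \<in> lin_End s \<Longrightarrow> lin_trace s z = (\<Sum>b\<in>B. mat z b b)"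
  unfolding mat_def lin_End_def
  by (rule lin_trace_eq_sum_dual) (simp_all add: vector_space_axioms finite_Basis linear_rep rep_expand)

lemma lin_comp: "y \<in> lin_End s \<Longrightarrow> z \<in> lin_End s \<Longrightarrow> y \<circ> z \<in> lin_End s"
  and lin_id: "id \<in> lin_End s"
  and lin_add: "y \<in> lin_End s \<Longrightarrow> z \<in> lin_End s \<Longrightarrow> y + z \<in> lin_End s"
  and lin_scale: "z \<in> lin_End s \<Longrightarrow> fun_scale s r z \<in> lin_End s"
  by (simp_all add: linear_iff' fun_scale_def scale_right_distrib scale_left_commute algebra_simps)

sublocale E: vector_space "fun_scale s :: rat \<Rightarrow> ('v \<Rightarrow> 'v) \<Rightarrow> 'v \<Rightarrow> 'v"
  by (rule vector_space_fun_scale[OF vector_space_axioms])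

lemma lin_zero: "0 \<in> lin_End s"
  by (simp add: linear_iff')

lemma subspace_lin_End: "E.subspace (lin_End s)"
  by (simp add: E.subspace_def lin_add lin_scale lin_zero)

definition munits :: "('v \<Rightarrow> 'v) set" where
  "munits = (\<lambda>(b, c). munit b c) ` (B \<times> B)"

lemma munits_lin: "munits \<subseteq> lin_End s"
  by (auto simp: munits_def munit_lin)

lemma sum_fun_apply: "sum f A x = (\<Sum>a\<in>A. f a x)"
  by (induction A rule: infinite_finite_induct) simp_all

lemma lin_End_subset_span_munits: "lin_End s \<subseteq> E.span munits"
proof
  fix z assume z: "z \<in> lin_End s"
  have "z = (\<Sum>b\<in>B. \<Sum>c\<in>B. fun_scale s (mat z b c) (munit b c))"
  proof
    fix v
    have "(\<Sum>b\<in>B. \<Sum>c\<in>B. fun_scale s (mat z b c) (munit b c)) v =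
        (\<Sum>b\<in>B. s (\<Sum>c\<in>B. mat z b c * representation B v c) b)"
      by (simp add: sum_fun_apply fun_scale_def munit_def scale_sum_left)
    also have "\<dots> = z v" by (simp add: rep_apply[OF z, symmetric] rep_expand)
    finally show "z v = (\<Sum>b\<in>B. \<Sum>c\<in>B. fun_scale s (mat z b c) (munit b c)) v" by simp
  qed
  also have "\<dots> \<in> E.span munits"
    by (intro E.span_sum E.span_scale E.span_base) (auto simp: munits_def)
  finally show "z \<in> E.span munits" .
qed

lemma linear_inj_imp_GL:
  assumes "z \<in> lin_End s" "inj z"
  shows "z \<in> lin_GL s"
  using assms linear_inj_imp_surj[of z] by (simp add: lin_GL_def bij_def lin_End_def)

lemma inv_GL:
  assumes "g \<in> lin_GL s"
  shows "inv g \<in> lin_GL s" "g \<circ> inv g = id" "inv g \<circ> g = id"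
proof -
  have g: "bij g" "g \<in> lin_End s" using assms by (simp_all add: lin_GL_def)
  then show "g \<circ> inv g = id" "inv g \<circ> g = id"
    by (simp_all add: fun_eq_iff bij_is_surj surj_f_inv_f bij_is_inj)
  have inv: "g (inv g y) = y" for y using g(1) by (simp add: bij_is_surj surj_f_inv_f)
  have lin: "g (x + y) = g x + g y" "g (s c x) = s c (g x)" for x y c
    using g(2) by (simp_all add: linear_iff')
  have "inv g (x + y) = inv g x + inv g y" for x y
    by (rule injD[OF bij_is_inj[OF g(1)]]) (simp add: inv lin)
  moreover have "inv g (s c x) = s c (inv g x)" for c x
    by (rule injD[OF bij_is_inj[OF g(1)]]) (simp add: inv lin)
  ultimately show "inv g \<in> lin_GL s" using g by (simp add: lin_GL_def linear_iff' bij_imp_bij_inv)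
qed

lemma GL_lin: "g \<in> lin_GL s \<Longrightarrow> g \<in> lin_End s"
  by (simp add: lin_GL_def)

text \<open>For such \<open>t\<close> the operator is strictly diagonally dominant, hence injective.\<close>

lemma shifted_GL:
  assumes z: "z \<in> lin_End s" and t: "t > (\<Sum>b\<in>B. \<Sum>c\<in>B. \<bar>mat z b c\<bar>)"
  shows "z + fun_scale s t id \<in> lin_GL s"
proof (rule linear_inj_imp_GL)
  show lin: "z + fun_scale s t id \<in> lin_End s" using z by (intro lin_add lin_scale lin_id)
  have "v = 0" if v: "(z + fun_scale s t id) v = 0" for v
  proof (cases "B = {}")
    case True
    then show ?thesis using rep_expand[of v] by simp
  next
    case False
    define r where "r = representation B v"
    have eq: "(\<Sum>c\<in>B. mat z b c * r c) + t * r b = 0" if "b \<in> B" for b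
    proof -
      have "representation B (z v + s t v) b = 0"
        using v by (simp add: fun_scale_def representation_zero)
      then show ?thesis by (simp add: rep_add rep_scale rep_apply[OF z] r_def)
    qed
    \<comment> \<open>A coordinate of maximal modulus is singled out: its row of the equation bounds
      \<open>t\<close> times that modulus by the absolute row sum times the same modulus.\<close>
    have "finite ((\<lambda>b. \<bar>r b\<bar>) ` B)" "(\<lambda>b. \<bar>r b\<bar>) ` B \<noteq> {}" using finite_Basis False by auto
    then have "Max ((\<lambda>b. \<bar>r b\<bar>) ` B) \<in> (\<lambda>b. \<bar>r b\<bar>) ` B" by (rule Max_in)
    then obtain b where b: "b \<in> B" and Max: "Max ((\<lambda>b. \<bar>r b\<bar>) ` B) = \<bar>r b\<bar>" by auto
    have max: "\<bar>r c\<bar> \<le> \<bar>r b\<bar>" if "c \<in> B" for c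
      unfolding Max[symmetric] using that finite_Basis by (intro Max_ge) auto
    have row: "(\<Sum>c\<in>B. \<bar>mat z b c\<bar>) \<le> (\<Sum>b\<in>B. \<Sum>c\<in>B. \<bar>mat z b c\<bar>)"
      using b finite_Basis by (intro member_le_sum) (auto intro: sum_nonneg)
    have "(\<Sum>b\<in>B. \<Sum>c\<in>B. \<bar>mat z b c\<bar>) \<ge> 0" by (intro sum_nonneg) simp
    then have tpos: "t > 0" using t by simp
    have "(\<Sum>c\<in>B. mat z b c * r c) = - (t * r b)" using eq[OF b] by simp
    then have "t * \<bar>r b\<bar> = \<bar>\<Sum>c\<in>B. mat z b c * r c\<bar>"
      using tpos by (simp add: abs_mult)
    also have "\<dots> \<le> (\<Sum>c\<in>B. \<bar>mat z b c\<bar> * \<bar>r c\<bar>)"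
      by (rule order_trans[OF sum_abs]) (simp add: abs_mult)
    also have "\<dots> \<le> (\<Sum>c\<in>B. \<bar>mat z b c\<bar> * \<bar>r b\<bar>)"
      by (intro sum_mono mult_left_mono max) auto
    also have "\<dots> = (\<Sum>c\<in>B. \<bar>mat z b c\<bar>) * \<bar>r b\<bar>" by (simp add: sum_distrib_right)
    finally have "(t - (\<Sum>c\<in>B. \<bar>mat z b c\<bar>)) * \<bar>r b\<bar> \<le> 0" by (simp add: algebra_simps)
    moreover have "t - (\<Sum>c\<in>B. \<bar>mat z b c\<bar>) > 0" using t row by simp
    ultimately have "\<bar>r b\<bar> \<le> 0" by (simp add: mult_le_0_iff)
    then have "r c = 0" if "c \<in> B" for c using max[OF that] by simp
    then show ?thesis using rep_expand[of v] by (simp add: r_def)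
  qed
  then show "inj (z + fun_scale s t id)"
    using lin module_hom.inj_iff_eq_0[OF Vector_Spaces.linear.axioms(3)] unfolding lin_End_def by blast
qed

end

section \<open>Tensor powers in coordinates\<close>

declare One_nat_def [simp del]

lemma prod_fun_upd:
  assumes "finite I" "i \<in> I"
  shows "(\<Prod>j\<in>I. h j ((x(i := a)) j)) = h i a * (\<Prod>j\<in>I - {i}. h j (x j) :: 'a::comm_monoid_mult)"
  using assms by (simp add: prod.remove)

lemma multilinear_on_prod:
  fixes h :: "nat \<Rightarrow> 'a::ab_group_add \<Rightarrow> rat"
  assumes "\<And>i a b. h i (a + b) = h i a + h i b" "\<And>i c a. h i (sa c a) = c * h i a"
  shows "multilinear_on m U sa (*) (\<lambda>v. \<Prod>i\<in>{1..m}. h i (v i))"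
  unfolding multilinear_on_def using assms
  by (auto simp only: prod_fun_upd[OF finite_atLeastAtMost] distrib_right mult.assoc)

locale finite_tensor_power = V: fd_rat_space sV Bas
  for sV :: "rat \<Rightarrow> 'v::ab_group_add \<Rightarrow> 'v" and Bas +
  fixes m :: nat and sT :: "rat \<Rightarrow> 't::ab_group_add \<Rightarrow> 't" and tens :: "(nat \<Rightarrow> 'v) \<Rightarrow> 't"
  assumes tensor_power: "is_tensor_power sV m sT tens"
begin

sublocale T: vector_space sT
  using tensor_power by (simp add: is_tensor_power_def)

sublocale TE: vector_space "fun_scale sT :: rat \<Rightarrow> ('t \<Rightarrow> 't) \<Rightarrow> 't \<Rightarrow> 't"
  by (rule vector_space_fun_scale[OF T.vector_space_axioms])

abbreviation words :: "(nat \<Rightarrow> 'v) set" where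
  "words \<equiv> {1..m} \<rightarrow>\<^sub>E Bas"

abbreviation vecs :: "(nat \<Rightarrow> 'v) set" where
  "vecs \<equiv> {1..m} \<rightarrow>\<^sub>E UNIV"

abbreviation tmap :: "(nat \<Rightarrow> 'v \<Rightarrow> 'v) \<Rightarrow> 't \<Rightarrow> 't" where
  "tmap \<equiv> tensor_map m sT tens"

abbreviation pop :: "(nat \<Rightarrow> nat) \<Rightarrow> 't \<Rightarrow> 't" where
  "pop \<equiv> perm_op m sT tens"

lemma words_vecs: "w \<in> words \<Longrightarrow> w \<in> vecs"
  by (auto simp: PiE_iff)

lemma finite_words: "finite words"
  by (simp add: finite_PiE V.finite_Basis)

lemma multilinear_tens: "multilinear_on m UNIV sV sT tens"
  using tensor_power by (simp add: is_tensor_power_def)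

text \<open>Multilinearity carries the equality from words in the basis to all pure tensors, and the
  uniqueness half of the universal property from these to the whole space.\<close>

lemma linear_eq_on_words:
  assumes W: "vector_space sW"
    and F: "Vector_Spaces.linear sT sW F" and G: "Vector_Spaces.linear sT sW G"
    and eq: "\<And>w. w \<in> words \<Longrightarrow> F (tens w) = G (tens w)"
  shows "F = G"
proof -
  have FG: "multilinear_on m UNIV sV sW (\<lambda>v. F (tens v))" "multilinear_on m UNIV sV sW (\<lambda>v. G (tens v))"
    using F G multilinear_tens
    by (simp_all add: multilinear_on_def linear_rat_iff[OF T.vector_space_axioms W])
  have "F (tens v) = G (tens v)" if "v \<in> vecs" for v
    by (rule multilinear_on_eq_on_span[OF V.vector_space_axioms W FG _ _ _ eq that])
      (auto simp: V.span_Basis)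
  then show ?thesis
    using ex1E[OF tensor_power_universal[OF tensor_power W FG(2)]] F G by (metis (no_types, lifting))
qed

lemma the_linear:
  assumes W: "vector_space sW" and f: "multilinear_on m UNIV sV sW f"
  shows "Vector_Spaces.linear sT sW (THE F. Vector_Spaces.linear sT sW F \<and> (\<forall>v \<in> vecs. F (tens v) = f v))"
    and "v \<in> vecs \<Longrightarrow> (THE F. Vector_Spaces.linear sT sW F \<and> (\<forall>v \<in> vecs. F (tens v) = f v)) (tens v) = f v"
  using theI'[OF tensor_power_universal[OF tensor_power W f]] by auto

text \<open>The functional dual to the basis tensor of the word \<open>u\<close>, obtained by
  extending a product of coordinates through the universal property.\<close>

definition coord :: "(nat \<Rightarrow> 'v) \<Rightarrow> 't \<Rightarrow> rat" where
  "coord u = (THE F. Vector_Spaces.linear sT (*) F \<and>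
     (\<forall>v \<in> vecs. F (tens v) = (\<Prod>i\<in>{1..m}. V.representation Bas (v i) (u i))))"

lemma multilinear_coord:
  "multilinear_on m UNIV sV (*) (\<lambda>v. \<Prod>i\<in>{1..m}. V.representation Bas (v i) (u i))"
  by (rule multilinear_on_prod) (simp_all add: V.rep_add V.rep_scale)

lemma coord_linear: "Vector_Spaces.linear sT (*) (coord u)"
  unfolding coord_def by (rule the_linear(1)[OF vector_space_rat multilinear_coord])

lemma coord_tens: "v \<in> vecs \<Longrightarrow> coord u (tens v) = (\<Prod>i\<in>{1..m}. V.representation Bas (v i) (u i))"
  unfolding coord_def by (rule the_linear(2)[OF vector_space_rat multilinear_coord])

lemma coord_add: "coord u (x + y) = coord u x + coord u y"
  and coord_scale: "coord u (sT c x) = c * coord u x"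
  using coord_linear by (simp_all add: linear_rat_iff T.vector_space_axioms vector_space_rat)

lemma coord_sum: "coord u (sum f A) = (\<Sum>a\<in>A. coord u (f a))"
proof -
  interpret Vector_Spaces.linear sT "(*)" "coord u" by (rule coord_linear)
  show ?thesis by (rule sum)
qed

lemma coord_word:
  assumes "u \<in> words" "w \<in> words"
  shows "coord u (tens w) = of_bool (w = u)"
proof -
  have "coord u (tens w) = (\<Prod>i\<in>{1..m}. of_bool (w i = u i))"
    unfolding coord_tens[OF words_vecs[OF assms(2)]]
    by (rule prod.cong) (use assms in \<open>auto simp: V.rep_basis PiE_iff\<close>)
  also have "\<dots> = of_bool (w = restrict u {1..m})"
    by (rule prod_of_bool_eq_word[OF finite_atLeastAtMost assms(2)])
  also have "restrict u {1..m} = u" using assms(1) by (simp add: PiE_iff extensional_restrict)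
  finally show ?thesis .
qed

lemma lin_T_iff: "F \<in> lin_End sT \<longleftrightarrow> (\<forall>x y. F (x + y) = F x + F y) \<and> (\<forall>c x. F (sT c x) = sT c (F x))"
  unfolding lin_End_def by (simp add: linear_rat_iff T.vector_space_axioms)

lemma lin_T_comp: "F \<in> lin_End sT \<Longrightarrow> G \<in> lin_End sT \<Longrightarrow> F \<circ> G \<in> lin_End sT"
  and lin_T_id: "id \<in> lin_End sT"
  and lin_T_add: "F \<in> lin_End sT \<Longrightarrow> G \<in> lin_End sT \<Longrightarrow> F + G \<in> lin_End sT"
  and lin_T_scale: "F \<in> lin_End sT \<Longrightarrow> fun_scale sT r F \<in> lin_End sT"
  and lin_T_zero: "0 \<in> lin_End sT"
  by (simp_all add: lin_T_iff fun_scale_def T.scale_right_distrib T.scale_left_commute algebra_simps)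

lemma subspace_lin_T: "TE.subspace (lin_End sT)"
  by (simp add: TE.subspace_def lin_T_add lin_T_scale lin_T_zero)

lemma lin_T_eqI:
  assumes "F \<in> lin_End sT" "G \<in> lin_End sT" "\<And>w. w \<in> words \<Longrightarrow> F (tens w) = G (tens w)"
  shows "F = G"
  using assms by (intro linear_eq_on_words[OF T.vector_space_axioms]) (auto simp: lin_End_def)

lemma coord_expand: "(\<Sum>w\<in>words. sT (coord w t) (tens w)) = t"
proof -
  have "(\<lambda>t. \<Sum>w\<in>words. sT (coord w t) (tens w)) = id"
  proof (rule lin_T_eqI[OF _ lin_T_id])
    show "(\<lambda>t. \<Sum>w\<in>words. sT (coord w t) (tens w)) \<in> lin_End sT"
      by (simp add: lin_T_iff coord_add coord_scale T.scale_left_distrib sum.distrib T.scale_sum_right)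
    fix u assume u: "u \<in> words"
    have "(\<Sum>w\<in>words. sT (coord w (tens u)) (tens w)) = (\<Sum>w\<in>{u}. sT (coord w (tens u)) (tens w))"
      by (rule sum.mono_neutral_right) (use u finite_words in \<open>auto simp: coord_word\<close>)
    then show "(\<Sum>w\<in>words. sT (coord w (tens u)) (tens w)) = id (tens u)"
      using u by (simp add: coord_word)
  qed
  from fun_cong[OF this, of t] show ?thesis by simp
qed

lemma lin_trace_coord:
  "F \<in> lin_End sT \<Longrightarrow> lin_trace sT F = (\<Sum>w\<in>words. coord w (F (tens w)))"
  unfolding lin_End_def
  by (rule lin_trace_eq_sum_dual[where \<phi> = coord and e = tens])
    (simp_all add: T.vector_space_axioms finite_words coord_linear coord_expand)

lemma coord_apply:
  assumes "F \<in> lin_End sT"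
  shows "coord u (F t) = (\<Sum>w\<in>words. coord u (F (tens w)) * coord w t)"
proof -
  interpret F: Vector_Spaces.linear sT sT F using assms by (simp add: lin_End_def)
  have "coord u (F t) = coord u (F (\<Sum>w\<in>words. sT (coord w t) (tens w)))" by (simp add: coord_expand)
  also have "\<dots> = (\<Sum>w\<in>words. coord u (F (tens w)) * coord w t)"
    by (simp only: F.sum F.scale coord_sum coord_scale mult.commute)
  finally show ?thesis .
qed

lemma coord_eqI:
  assumes "\<And>u. u \<in> words \<Longrightarrow> coord u s = coord u t"
  shows "s = t"
proof -
  have "(\<Sum>w\<in>words. sT (coord w s) (tens w)) = (\<Sum>w\<in>words. sT (coord w t) (tens w))"
    by (rule sum.cong) (simp_all add: assms)
  then show ?thesis by (simp only: coord_expand)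
qed

lemma lin_T_ext:
  assumes "F \<in> lin_End sT" "G \<in> lin_End sT"
    and "\<And>u w. u \<in> words \<Longrightarrow> w \<in> words \<Longrightarrow> coord u (F (tens w)) = coord u (G (tens w))"
  shows "F = G"
  by (rule lin_T_eqI[OF assms(1,2)], rule coord_eqI) (rule assms(3))

text \<open>Builds the operator from prescribed coefficients; both directions of the correspondence
  obtain their operators this way.\<close>

definition of_mat :: "((nat \<Rightarrow> 'v) \<Rightarrow> (nat \<Rightarrow> 'v) \<Rightarrow> rat) \<Rightarrow> 't \<Rightarrow> 't" where
  "of_mat a t = (\<Sum>u\<in>words. sT (\<Sum>w\<in>words. a u w * coord w t) (tens u))"

lemma of_mat_lin: "of_mat a \<in> lin_End sT"
  by (simp add: lin_T_iff of_mat_def coord_add coord_scale distrib_left sum.distrib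
      T.scale_left_distrib T.scale_sum_right sum_distrib_left mult.left_commute)

lemma coord_of_mat:
  assumes "u \<in> words" "w \<in> words"
  shows "coord u (of_mat a (tens w)) = a u w"
proof -
  have "(\<Sum>v\<in>words. a u' v * coord v (tens w)) = a u' w" for u'
    using sum_mult_of_bool_eq[OF finite_words assms(2), of "a u'"] assms(2)
    by (simp add: coord_word eq_commute[of w] cong: sum.cong)
  then have "coord u (of_mat a (tens w)) = (\<Sum>u'\<in>words. a u' w * of_bool (u' = u))"
    by (simp add: of_mat_def coord_sum coord_scale coord_word assms(1) cong: sum.cong)
  then show ?thesis by (simp add: sum_mult_of_bool_eq[OF finite_words assms(1)])
qed

section \<open>Tensor product operators and permutation operators\<close>

lemma multilinear_tens_comp:
  assumes "y \<in> {1..m} \<rightarrow> lin_End sV"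
  shows "multilinear_on m UNIV sV sT (\<lambda>v. tens (\<lambda>i\<in>{1..m}. y i (v i)))"
proof -
  have upd: "(\<lambda>j\<in>{1..m}. y j ((x(i := a)) j)) = (\<lambda>j\<in>{1..m}. y j (x j))(i := y i a)"
    if "i \<in> {1..m}" for x i a using that by auto
  show ?thesis
    unfolding multilinear_on_def
  proof (intro ballI conjI allI)
    fix x i assume x: "x \<in> vecs" and i: "i \<in> {1..m}"
    let ?x = "\<lambda>j\<in>{1..m}. y j (x j)"
    have yx: "?x \<in> vecs" by auto
    have y: "y i (a + b) = y i a + y i b" "y i (sV c a) = sV c (y i a)" for a b c
      using funcset_mem[OF assms i] by (simp_all add: V.linear_iff')
    show "tens (\<lambda>j\<in>{1..m}. y j ((x(i := a + b)) j)) =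
        tens (\<lambda>j\<in>{1..m}. y j ((x(i := a)) j)) + tens (\<lambda>j\<in>{1..m}. y j ((x(i := b)) j))" for a b
      unfolding upd[OF i] y by (rule multilinear_on_add[OF multilinear_tens yx i]) auto
    show "tens (\<lambda>j\<in>{1..m}. y j ((x(i := sV c a)) j)) = sT c (tens (\<lambda>j\<in>{1..m}. y j ((x(i := a)) j)))" for a c
      unfolding upd[OF i] y by (rule multilinear_on_scale[OF multilinear_tens yx i]) auto
  qed
qed

lemma tmap_lin:
  assumes "y \<in> {1..m} \<rightarrow> lin_End sV"
  shows "tmap y \<in> lin_End sT"
  unfolding tensor_map_def lin_End_def
  using the_linear(1)[OF T.vector_space_axioms multilinear_tens_comp[OF assms]] by simp

lemma tmap_tens:
  assumes "y \<in> {1..m} \<rightarrow> lin_End sV" "v \<in> vecs"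
  shows "tmap y (tens v) = tens (\<lambda>i\<in>{1..m}. y i (v i))"
  unfolding tensor_map_def
  using the_linear(2)[OF T.vector_space_axioms multilinear_tens_comp[OF assms(1)] assms(2)] by simp

lemma tmap_cong: "(\<And>i. i \<in> {1..m} \<Longrightarrow> y i = z i) \<Longrightarrow> tmap y = tmap z"
  unfolding tensor_map_def by (simp cong: restrict_cong)

lemma tmap_comp:
  assumes y: "y \<in> {1..m} \<rightarrow> lin_End sV" and z: "z \<in> {1..m} \<rightarrow> lin_End sV"
  shows "tmap y \<circ> tmap z = tmap (\<lambda>i. y i \<circ> z i)"
proof (rule lin_T_eqI)
  have yz: "(\<lambda>i. y i \<circ> z i) \<in> {1..m} \<rightarrow> lin_End sV"
    using y z by (auto intro: V.lin_comp)
  show "tmap y \<circ> tmap z \<in> lin_End sT" by (intro lin_T_comp tmap_lin y z)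
  show "tmap (\<lambda>i. y i \<circ> z i) \<in> lin_End sT" by (rule tmap_lin[OF yz])
  fix w assume "w \<in> words"
  then have w: "w \<in> vecs" by (rule words_vecs)
  have "(\<lambda>i\<in>{1..m}. z i (w i)) \<in> vecs" by auto
  then show "(tmap y \<circ> tmap z) (tens w) = tmap (\<lambda>i. y i \<circ> z i) (tens w)"
    by (simp add: tmap_tens[OF y] tmap_tens[OF z w] tmap_tens[OF yz w] cong: restrict_cong)
qed

lemma const_lin: "g \<in> lin_End sV \<Longrightarrow> (\<lambda>_. g) \<in> {1..m} \<rightarrow> lin_End sV"
  by simp

lemma tmap_id: "tmap (\<lambda>_. id) = id"
proof (rule lin_T_eqI[OF tmap_lin[OF const_lin[OF V.lin_id]] lin_T_id])
  fix w assume w: "w \<in> words"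
  then have "(\<lambda>i\<in>{1..m}. id (w i)) = w" by (auto simp: PiE_iff extensional_def)
  then show "tmap (\<lambda>_. id) (tens w) = id (tens w)"
    unfolding tmap_tens[OF const_lin[OF V.lin_id] words_vecs[OF w]] by simp
qed

lemma coord_tmap:
  assumes "y \<in> {1..m} \<rightarrow> lin_End sV" "w \<in> words"
  shows "coord u (tmap y (tens w)) = (\<Prod>i\<in>{1..m}. V.mat (y i) (u i) (w i))"
proof -
  have v: "(\<lambda>i\<in>{1..m}. y i (w i)) \<in> vecs" by auto
  show ?thesis
    unfolding tmap_tens[OF assms(1) words_vecs[OF assms(2)]] coord_tens[OF v] by (simp add: V.mat_def)
qed

lemma multilinear_perm:
  assumes \<sigma>: "\<sigma> permutes {1..m}"
  shows "multilinear_on m UNIV sV sT (\<lambda>v. tens (\<lambda>i\<in>{1..m}. v (inv \<sigma> i)))"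
proof -
  \<comment> \<open>A change in slot \<open>i\<close> of the argument shows up in slot
    \<open>\<sigma> i\<close> of the permuted tuple.\<close>
  have upd: "(\<lambda>j\<in>{1..m}. (x(i := a)) (inv \<sigma> j)) = (\<lambda>j\<in>{1..m}. x (inv \<sigma> j))(\<sigma> i := a)"
    if "i \<in> {1..m}" for x :: "nat \<Rightarrow> 'v" and i a
  proof
    fix j
    have "\<sigma> i \<in> {1..m}" using that \<sigma> by (simp only: permutes_in_image)
    moreover have "inv \<sigma> j = i \<longleftrightarrow> j = \<sigma> i" using permutes_inv_eq[OF \<sigma>] by metis
    ultimately show "(\<lambda>j\<in>{1..m}. (x(i := a)) (inv \<sigma> j)) j = ((\<lambda>j\<in>{1..m}. x (inv \<sigma> j))(\<sigma> i := a)) j"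
      by auto
  qed
  show ?thesis
    unfolding multilinear_on_def
  proof (intro ballI conjI allI)
    fix x i assume x: "x \<in> vecs" and i: "i \<in> {1..m}"
    let ?x = "\<lambda>j\<in>{1..m}. x (inv \<sigma> j)"
    have sx: "?x \<in> vecs" by auto
    have si: "\<sigma> i \<in> {1..m}" using i \<sigma> by (simp only: permutes_in_image)
    show "tens (\<lambda>j\<in>{1..m}. (x(i := a + b)) (inv \<sigma> j)) =
        tens (\<lambda>j\<in>{1..m}. (x(i := a)) (inv \<sigma> j)) + tens (\<lambda>j\<in>{1..m}. (x(i := b)) (inv \<sigma> j))" for a b
      unfolding upd[OF i] by (rule multilinear_on_add[OF multilinear_tens sx si]) auto
    show "tens (\<lambda>j\<in>{1..m}. (x(i := sV c a)) (inv \<sigma> j)) = sT c (tens (\<lambda>j\<in>{1..m}. (x(i := a)) (inv \<sigma> j)))" for a c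
      unfolding upd[OF i] by (rule multilinear_on_scale[OF multilinear_tens sx si]) auto
  qed
qed

lemma pop_lin: "\<sigma> permutes {1..m} \<Longrightarrow> pop \<sigma> \<in> lin_End sT"
  unfolding perm_op_def lin_End_def
  using the_linear(1)[OF T.vector_space_axioms multilinear_perm] by simp

lemma pop_tens:
  "\<sigma> permutes {1..m} \<Longrightarrow> v \<in> vecs \<Longrightarrow> pop \<sigma> (tens v) = tens (\<lambda>i\<in>{1..m}. v (inv \<sigma> i))"
  unfolding perm_op_def
  using the_linear(2)[OF T.vector_space_axioms multilinear_perm] by simp

lemma pop_inv_tens:
  assumes \<sigma>: "\<sigma> permutes {1..m}" and v: "v \<in> vecs"
  shows "pop (inv \<sigma>) (tens v) = tens (\<lambda>i\<in>{1..m}. v (\<sigma> i))"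
  using pop_tens[OF permutes_inv[OF \<sigma>] v] by (simp add: permutes_inv_inv[OF \<sigma>])

lemma pop_End_GL:
  assumes "\<sigma> permutes {1..m}"
  shows "pop \<sigma> \<in> End_GL sV m sT tens"
  unfolding End_GL_def
proof (intro CollectI conjI ballI)
  show "pop \<sigma> \<in> lin_End sT" by (rule pop_lin[OF assms])
  fix g assume "g \<in> lin_GL sV"
  then have g: "g \<in> lin_End sV" by (rule V.GL_lin)
  show "pop \<sigma> \<circ> tmap (\<lambda>_. g) = tmap (\<lambda>_. g) \<circ> pop \<sigma>"
  proof (rule lin_T_eqI)
    show "pop \<sigma> \<circ> tmap (\<lambda>_. g) \<in> lin_End sT" "tmap (\<lambda>_. g) \<circ> pop \<sigma> \<in> lin_End sT"
      by (intro lin_T_comp tmap_lin const_lin g pop_lin[OF assms])+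
    fix w assume "w \<in> words"
    then have w: "w \<in> vecs" by (rule words_vecs)
    have "(\<lambda>i\<in>{1..m}. w (inv \<sigma> i)) \<in> vecs" "(\<lambda>i\<in>{1..m}. g (w i)) \<in> vecs" by auto
    moreover have "inv \<sigma> i \<in> {1..m} \<longleftrightarrow> i \<in> {1..m}" for i
      by (rule permutes_in_image[OF permutes_inv[OF assms]])
    ultimately show "(pop \<sigma> \<circ> tmap (\<lambda>_. g)) (tens w) = (tmap (\<lambda>_. g) \<circ> pop \<sigma>) (tens w)"
      using w by (simp add: tmap_tens[OF const_lin[OF g]] pop_tens[OF assms] cong: restrict_cong)
  qed
qed

section \<open>Traces against tensor products of endomorphisms\<close>

lemma lin_trace_tmap:
  assumes E: "E \<in> lin_End sT" and y: "y \<in> {1..m} \<rightarrow> lin_End sV"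
  shows "lin_trace sT (E \<circ> tmap y) =
    (\<Sum>w\<in>words. \<Sum>u\<in>words. coord w (E (tens u)) * (\<Prod>i\<in>{1..m}. V.mat (y i) (u i) (w i)))"
proof -
  have "E \<circ> tmap y \<in> lin_End sT" by (intro lin_T_comp E tmap_lin y)
  then have "lin_trace sT (E \<circ> tmap y) = (\<Sum>w\<in>words. coord w (E (tmap y (tens w))))"
    by (simp add: lin_trace_coord)
  also have "\<dots> = (\<Sum>w\<in>words. \<Sum>u\<in>words. coord w (E (tens u)) * (\<Prod>i\<in>{1..m}. V.mat (y i) (u i) (w i)))"
    by (rule sum.cong[OF refl], subst coord_apply[OF E]) (simp add: coord_tmap[OF y])
  finally show ?thesis .
qed

text \<open>The tensor product of these units sends \<open>tens q\<close> to \<open>tens p\<close>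
  and kills every other word, so a single diagonal term survives.\<close>

lemma lin_trace_munits:
  assumes E: "E \<in> lin_End sT" and p: "p \<in> words" and q: "q \<in> words"
  shows "lin_trace sT (E \<circ> tmap (\<lambda>i. V.munit (p i) (q i))) = coord q (E (tens p))"
proof -
  have mu: "(\<Prod>i\<in>{1..m}. V.mat (V.munit (p i) (q i)) (u i) (w i)) = of_bool (u = p) * of_bool (w = q)"
    if "u \<in> words" "w \<in> words" for u w
  proof -
    have "(\<Prod>i\<in>{1..m}. V.mat (V.munit (p i) (q i)) (u i) (w i)) =
        (\<Prod>i\<in>{1..m}. of_bool (u i = p i)) * (\<Prod>i\<in>{1..m}. of_bool (w i = q i))"
      unfolding prod.distrib[symmetric]
      by (intro prod.cong refl V.mat_munit) (use p q that in \<open>auto simp: PiE_iff\<close>)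
    moreover have "restrict p {1..m} = p" "restrict q {1..m} = q"
      using p q by (simp_all add: PiE_iff extensional_restrict)
    ultimately show ?thesis
      by (simp only: prod_of_bool_eq_word[OF finite_atLeastAtMost that(1)]
          prod_of_bool_eq_word[OF finite_atLeastAtMost that(2)])
  qed
  have "(\<lambda>i. V.munit (p i) (q i)) \<in> {1..m} \<rightarrow> lin_End sV" by (simp add: V.munit_lin)
  from lin_trace_tmap[OF E this]
  have "lin_trace sT (E \<circ> tmap (\<lambda>i. V.munit (p i) (q i))) =
      (\<Sum>w\<in>words. (\<Sum>u\<in>words. coord w (E (tens u)) * of_bool (u = p)) * of_bool (w = q))"
    by (simp add: mu sum_distrib_right mult.assoc)
  then show ?thesis by (simp only: sum_mult_of_bool_eq[OF finite_words] p q)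
qed

lemma trace_nondegenerate:
  assumes "E \<in> lin_End sT" "E' \<in> lin_End sT"
    and "\<And>y. y \<in> {1..m} \<rightarrow>\<^sub>E lin_End sV \<Longrightarrow> lin_trace sT (E \<circ> tmap y) = lin_trace sT (E' \<circ> tmap y)"
  shows "E = E'"
proof (rule lin_T_ext[OF assms(1,2)])
  fix u w assume uw: "u \<in> words" "w \<in> words"
  let ?y = "\<lambda>i\<in>{1..m}. V.munit (w i) (u i)"
  have "tmap (\<lambda>i. V.munit (w i) (u i)) = tmap ?y" by (rule tmap_cong) simp
  moreover have "?y \<in> {1..m} \<rightarrow>\<^sub>E lin_End sV" by (simp add: V.munit_lin)
  ultimately show "coord u (E (tens w)) = coord u (E' (tens w))"
    using assms uw by (simp add: lin_trace_munits[symmetric])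
qed

lemma lin_trace_T_add:
  "F \<in> lin_End sT \<Longrightarrow> G \<in> lin_End sT \<Longrightarrow> lin_trace sT (F + G) = lin_trace sT F + lin_trace sT G"
  by (simp add: lin_trace_coord lin_T_add coord_add sum.distrib)

lemma lin_trace_T_scale:
  "F \<in> lin_End sT \<Longrightarrow> lin_trace sT (fun_scale sT c F) = c * lin_trace sT F"
  unfolding lin_trace_coord[OF lin_T_scale]
  by (simp add: lin_trace_coord fun_scale_def coord_scale sum_distrib_left)

lemma lin_trace_T_comm:
  assumes "F \<in> lin_End sT" "G \<in> lin_End sT"
  shows "lin_trace sT (F \<circ> G) = lin_trace sT (G \<circ> F)"
proof -
  have "lin_trace sT (F \<circ> G) =
      (\<Sum>w\<in>words. \<Sum>u\<in>words. coord w (F (tens u)) * coord u (G (tens w)))"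
    if "F \<in> lin_End sT" "G \<in> lin_End sT" for F G
    unfolding lin_trace_coord[OF lin_T_comp[OF that]] comp_apply
    by (intro sum.cong refl coord_apply[OF that(1)])
  from this[OF assms] this[OF assms(2,1)] show ?thesis
    by simp (subst sum.swap, simp add: mult.commute)
qed

text \<open>Slot \<open>i\<close> of the tuple enters each summand of the coordinate formula through
  exactly one matrix entry.\<close>

lemma multilinear_lin_trace_tmap:
  assumes E: "E \<in> lin_End sT"
  shows "multilinear_on m (lin_End sV) (fun_scale sV) (*) (\<lambda>y. lin_trace sT (E \<circ> tmap y))"
  unfolding multilinear_on_def
proof (intro ballI conjI allI)
  fix x i assume x: "x \<in> {1..m} \<rightarrow>\<^sub>E lin_End sV" and i: "i \<in> {1..m}"
  have upd: "lin_trace sT (E \<circ> tmap (x(i := a))) =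
      (\<Sum>w\<in>words. \<Sum>u\<in>words. V.mat a (u i) (w i) *
        (coord w (E (tens u)) * (\<Prod>j\<in>{1..m} - {i}. V.mat (x j) (u j) (w j))))"
    if "a \<in> lin_End sV" for a
  proof -
    have "x(i := a) \<in> {1..m} \<rightarrow> lin_End sV"
      using x that by (auto simp: PiE_iff)
    from lin_trace_tmap[OF E this] show ?thesis
      by (simp only: prod_fun_upd[OF finite_atLeastAtMost i, of "\<lambda>j z. V.mat z (_ j) (_ j)"] mult.left_commute)
  qed
  show "lin_trace sT (E \<circ> tmap (x(i := a + b))) =
      lin_trace sT (E \<circ> tmap (x(i := a))) + lin_trace sT (E \<circ> tmap (x(i := b)))"
    if "a \<in> lin_End sV" "b \<in> lin_End sV" for a b
    using that by (simp add: upd V.lin_add V.mat_add distrib_right sum.distrib)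
  show "lin_trace sT (E \<circ> tmap (x(i := fun_scale sV c a))) = c * lin_trace sT (E \<circ> tmap (x(i := a)))"
    if "a \<in> lin_End sV" for a c
    using that by (simp add: upd V.lin_scale V.mat_scale sum_distrib_left mult.assoc)
qed

lemma End_GL_commute_all:
  assumes E: "E \<in> End_GL sV m sT tens" and z: "z \<in> lin_End sV" and u: "u \<in> words" and w: "w \<in> words"
  shows "(\<Sum>v\<in>words. coord u (E (tens v)) * (\<Prod>i\<in>{1..m}. V.mat z (v i) (w i))) =
    (\<Sum>v\<in>words. (\<Prod>i\<in>{1..m}. V.mat z (u i) (v i)) * coord v (E (tens w)))"
proof -
  have Elin: "E \<in> lin_End sT" using E by (simp add: End_GL_def)
  \<comment> \<open>\<open>poly (p b c) t\<close> is the entry of \<open>z\<close> shifted by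
    \<open>t\<close> times the identity; the value at zero returns the entry of
    \<open>z\<close>.\<close>
  define p where "p b c = [:V.mat z b c, of_bool (b = c):]" for b c
  define P where "P = (\<Sum>v\<in>words. smult (coord u (E (tens v))) (\<Prod>i\<in>{1..m}. p (v i) (w i))) -
    (\<Sum>v\<in>words. smult (coord v (E (tens w))) (\<Prod>i\<in>{1..m}. p (u i) (v i)))"
  \<comment> \<open>The bound of the diagonal dominance criterion: every larger shift is invertible
    and hence a root of \<open>P\<close>.\<close>
  define R where "R = (\<Sum>b\<in>Bas. \<Sum>c\<in>Bas. \<bar>V.mat z b c\<bar>)"
  have "poly P t = 0" if t: "t > R" for t
  proof -
    define g where "g = z + fun_scale sV t id"
    have g: "g \<in> lin_GL sV" unfolding g_def using V.shifted_GL[OF z] t by (simp add: R_def)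
    have glin: "g \<in> lin_End sV" by (rule V.GL_lin[OF g])
    have p: "poly (p b c) t = V.mat g b c" if "c \<in> Bas" for b c
      using that by (simp add: p_def g_def V.mat_add V.mat_scale V.mat_id)
    have "E \<circ> tmap (\<lambda>_. g) = tmap (\<lambda>_. g) \<circ> E" using E g by (simp add: End_GL_def)
    then have "coord u (E (tmap (\<lambda>_. g) (tens w))) = coord u (tmap (\<lambda>_. g) (E (tens w)))"
      by (metis comp_apply)
    then have "(\<Sum>v\<in>words. coord u (E (tens v)) * coord v (tmap (\<lambda>_. g) (tens w))) =
        (\<Sum>v\<in>words. coord u (tmap (\<lambda>_. g) (tens v)) * coord v (E (tens w)))"
      by (simp only: coord_apply[OF Elin, of u "tmap (\<lambda>_. g) (tens w)"]
          coord_apply[OF tmap_lin[OF const_lin[OF glin]], of u "E (tens w)"])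
    then have "(\<Sum>v\<in>words. coord u (E (tens v)) * (\<Prod>i\<in>{1..m}. V.mat g (v i) (w i))) =
        (\<Sum>v\<in>words. (\<Prod>i\<in>{1..m}. V.mat g (u i) (v i)) * coord v (E (tens w)))"
      using w by (simp add: coord_tmap[OF const_lin[OF glin]])
    moreover have "(\<Prod>i\<in>{1..m}. poly (p (a i) (v i)) t) = (\<Prod>i\<in>{1..m}. V.mat g (a i) (v i))"
      if "v \<in> words" for a v
      by (intro prod.cong refl p) (use that in auto)
    ultimately show ?thesis using w by (simp add: P_def poly_sum poly_prod mult.commute)
  qed
  then have "infinite {t. poly P t = 0}"
    using infinite_super[of "{R<..}" "{t. poly P t = 0}"] infinite_Ioi[of R] by auto
  then have "P = 0" using poly_roots_finite by blast
  then have "poly P 0 = 0" by simp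
  then show ?thesis by (simp add: P_def poly_sum poly_prod p_def mult.commute)
qed

theorem End_GL_spanned_by_permutations:
  assumes E: "E \<in> End_GL sV m sT tens"
  shows "\<exists>\<alpha>. E = (\<Sum>\<sigma> | \<sigma> permutes {1..m}. fun_scale sT (\<alpha> \<sigma>) (pop (inv \<sigma>)))"
proof -
  have "\<exists>\<alpha>. \<forall>u \<in> words. \<forall>w \<in> words. coord u (E (tens w)) =
      (\<Sum>\<sigma> | \<sigma> permutes {1..m}. \<alpha> \<sigma> * of_bool (u = (\<lambda>i\<in>{1..m}. w (\<sigma> i))))"
  proof (rule commutant_of_tensor_powers[OF finite_atLeastAtMost V.finite_Basis])
    fix z :: "'v \<Rightarrow> 'v \<Rightarrow> rat" and u w
    assume uw: "u \<in> words" "w \<in> words"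
    \<comment> \<open>Every matrix on the basis is realised by an endomorphism, so the commutation
      holds for arbitrary \<open>z\<close>.\<close>
    define Z where "Z = (\<Sum>a\<in>Bas. \<Sum>b\<in>Bas. fun_scale sV (z a b) (V.munit a b))"
    have Z: "Z \<in> lin_End sV"
      unfolding Z_def
      by (intro V.E.subspace_sum V.subspace_lin_End V.lin_scale V.munit_lin)
    have matZ: "V.mat Z b c = z b c" if "b \<in> Bas" "c \<in> Bas" for b c
    proof -
      have "V.mat Z b c = (\<Sum>a\<in>Bas. \<Sum>a'\<in>Bas. z a a' * V.mat (V.munit a a') b c)"
        unfolding Z_def V.mat_def by (simp add: V.sum_fun_apply V.rep_sum fun_scale_def V.rep_scale)
      also have "\<dots> = (\<Sum>a\<in>Bas. (\<Sum>a'\<in>Bas. z a a' * of_bool (a' = c)) * of_bool (a = b))"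
        using that by (intro sum.cong refl)
          (simp add: V.mat_munit sum_distrib_right eq_commute[of b] eq_commute[of c] mult_ac)
      finally show ?thesis using that by (simp only: sum_mult_of_bool_eq[OF V.finite_Basis])
    qed
    have "(\<Prod>i\<in>{1..m}. V.mat Z (a i) (v i)) = (\<Prod>i\<in>{1..m}. z (a i) (v i))"
      if "a \<in> words" "v \<in> words" for a v
      by (intro prod.cong refl matZ) (use that in \<open>auto simp: PiE_iff\<close>)
    then show "(\<Sum>v\<in>words. coord u (E (tens v)) * (\<Prod>i\<in>{1..m}. z (v i) (w i))) =
        (\<Sum>v\<in>words. (\<Prod>i\<in>{1..m}. z (u i) (v i)) * coord v (E (tens w)))"
      using End_GL_commute_all[OF E Z uw] uw by (simp cong: sum.cong)
  qed
  then obtain \<alpha> where \<alpha>: "\<And>u w. u \<in> words \<Longrightarrow> w \<in> words \<Longrightarrow> coord u (E (tens w)) =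
      (\<Sum>\<sigma> | \<sigma> permutes {1..m}. \<alpha> \<sigma> * of_bool (u = (\<lambda>i\<in>{1..m}. w (\<sigma> i))))" by blast
  have "E = (\<Sum>\<sigma> | \<sigma> permutes {1..m}. fun_scale sT (\<alpha> \<sigma>) (pop (inv \<sigma>)))"
  proof (rule lin_T_ext)
    show "E \<in> lin_End sT" using E by (simp add: End_GL_def)
    show "(\<Sum>\<sigma> | \<sigma> permutes {1..m}. fun_scale sT (\<alpha> \<sigma>) (pop (inv \<sigma>))) \<in> lin_End sT"
    proof (rule TE.subspace_sum[OF subspace_lin_T])
      fix \<sigma> assume "\<sigma> \<in> {\<sigma>. \<sigma> permutes {1..m}}"
      then have "inv \<sigma> permutes {1..m}" by (simp only: mem_Collect_eq permutes_inv)
      then show "fun_scale sT (\<alpha> \<sigma>) (pop (inv \<sigma>)) \<in> lin_End sT" by (intro lin_T_scale pop_lin)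
    qed
    fix u w assume u: "u \<in> words" and w: "w \<in> words"
    \<comment> \<open>\<open>pop (inv \<sigma>)\<close> composes words with \<sigma>, which is the
      shape in which the commutant theorem delivers the permutations.\<close>
    have pop: "coord u (pop (inv \<sigma>) (tens w)) = of_bool (u = (\<lambda>i\<in>{1..m}. w (\<sigma> i)))"
      if "\<sigma> permutes {1..m}" for \<sigma>
      unfolding pop_inv_tens[OF that words_vecs[OF w]]
      unfolding coord_word[OF u restrict_permutes_in_PiE[OF that w]]
      by (rule arg_cong[where f = of_bool]) (rule eq_commute)
    have "coord u ((\<Sum>\<sigma> | \<sigma> permutes {1..m}. fun_scale sT (\<alpha> \<sigma>) (pop (inv \<sigma>))) (tens w)) =
        (\<Sum>\<sigma> | \<sigma> permutes {1..m}. \<alpha> \<sigma> * coord u (pop (inv \<sigma>) (tens w)))"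
      by (simp only: V.sum_fun_apply coord_sum fun_scale_def coord_scale)
    also have "\<dots> = coord u (E (tens w))"
      unfolding \<alpha>[OF u w] by (rule sum.cong[OF refl]) (simp only: pop mem_Collect_eq)
    finally show "coord u (E (tens w)) =
        coord u ((\<Sum>\<sigma> | \<sigma> permutes {1..m}. fun_scale sT (\<alpha> \<sigma>) (pop (inv \<sigma>))) (tens w))" ..
  qed
  then show ?thesis by blast
qed

end

section \<open>The trace pairing\<close>

context finite_tensor_power
begin

lemma tmap_GL:
  assumes "g \<in> lin_GL sV"
  shows "tmap (\<lambda>_. g) \<circ> tmap (\<lambda>_. inv g) = id" "tmap (\<lambda>_. inv g) \<circ> tmap (\<lambda>_. g) = id"
proof -
  have "(\<lambda>_. g) \<in> {1..m} \<rightarrow> lin_End sV" "(\<lambda>_. inv g) \<in> {1..m} \<rightarrow> lin_End sV"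
    using V.GL_lin[OF assms] V.GL_lin[OF V.inv_GL(1)[OF assms]] by simp_all
  note comp = tmap_comp[OF this] tmap_comp[OF this(2,1)]
  show "tmap (\<lambda>_. g) \<circ> tmap (\<lambda>_. inv g) = id" "tmap (\<lambda>_. inv g) \<circ> tmap (\<lambda>_. g) = id"
    unfolding comp by (simp_all only: V.inv_GL(2,3)[OF assms] tmap_id)
qed

lemma GL_tmap_lin:
  assumes "g \<in> lin_GL sV"
  shows "tmap (\<lambda>_. g) \<in> lin_End sT" "tmap (\<lambda>_. inv g) \<in> lin_End sT"
  by (intro tmap_lin const_lin V.GL_lin V.inv_GL(1) assms)+

lemma conj_lin:
  assumes "g \<in> lin_GL sV" "z \<in> lin_End sV"
  shows "g \<circ> z \<circ> inv g \<in> lin_End sV"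
  by (intro V.lin_comp V.GL_lin V.inv_GL(1) assms)

lemma conj_PiE:
  assumes "g \<in> lin_GL sV" "z \<in> I \<rightarrow>\<^sub>E lin_End sV"
  shows "(\<lambda>i\<in>I. g \<circ> z i \<circ> inv g) \<in> I \<rightarrow>\<^sub>E lin_End sV"
  using assms by (auto intro!: conj_lin)

text \<open>Conjugating every slot conjugates the tensor product by the tensor power of
  \<open>g\<close>; the inner powers cancel, and cyclicity of the trace removes the outer
  ones.\<close>

lemma trace_conj:
  assumes g: "g \<in> lin_GL sV" and E: "E \<in> lin_End sT" and z: "z \<in> {1..m} \<rightarrow>\<^sub>E lin_End sV"
  shows "lin_trace sT ((tmap (\<lambda>_. g) \<circ> E \<circ> tmap (\<lambda>_. inv g)) \<circ> tmap (\<lambda>i\<in>{1..m}. g \<circ> z i \<circ> inv g)) =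
    lin_trace sT (E \<circ> tmap z)"
proof -
  let ?G = "tmap (\<lambda>_. g)" and ?G' = "tmap (\<lambda>_. inv g)"
  have gl: "(\<lambda>_. g) \<in> {1..m} \<rightarrow> lin_End sV" "(\<lambda>_. inv g) \<in> {1..m} \<rightarrow> lin_End sV"
    and zl: "z \<in> {1..m} \<rightarrow> lin_End sV"
    using V.GL_lin[OF g] V.GL_lin[OF V.inv_GL(1)[OF g]] z by auto
  have gz: "(\<lambda>i. g \<circ> z i) \<in> {1..m} \<rightarrow> lin_End sV"
    using V.GL_lin[OF g] zl by (auto intro!: V.lin_comp)
  have Z: "tmap z \<in> lin_End sT" by (rule tmap_lin[OF zl])
  have "tmap (\<lambda>i\<in>{1..m}. g \<circ> z i \<circ> inv g) = tmap (\<lambda>i. (g \<circ> z i) \<circ> inv g)"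
    by (rule tmap_cong) simp
  also have "\<dots> = ?G \<circ> tmap z \<circ> ?G'" using tmap_comp[OF gl(1) zl] tmap_comp[OF gz gl(2)] by simp
  finally have "(?G \<circ> E \<circ> ?G') \<circ> tmap (\<lambda>i\<in>{1..m}. g \<circ> z i \<circ> inv g) = ?G \<circ> E \<circ> (?G' \<circ> ?G) \<circ> tmap z \<circ> ?G'"
    by (simp only: comp_assoc)
  then have "(?G \<circ> E \<circ> ?G') \<circ> tmap (\<lambda>i\<in>{1..m}. g \<circ> z i \<circ> inv g) = ?G \<circ> (E \<circ> tmap z \<circ> ?G')"
    by (simp only: tmap_GL[OF g] comp_id comp_assoc)
  moreover have "lin_trace sT (?G \<circ> (E \<circ> tmap z \<circ> ?G')) = lin_trace sT ((E \<circ> tmap z \<circ> ?G') \<circ> ?G)"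
    by (intro lin_trace_T_comm lin_T_comp E Z GL_tmap_lin g)
  ultimately show ?thesis by (simp only: comp_assoc tmap_GL[OF g] comp_id)
qed

text \<open>Every tuple is the conjugate by \<open>g\<close> of some tuple, so testing against
  conjugated tuples loses nothing and nondegeneracy applies.\<close>

lemma conj_eqI:
  assumes g: "g \<in> lin_GL sV" and E: "E \<in> lin_End sT" "E' \<in> lin_End sT"
    and eq: "\<And>z. z \<in> {1..m} \<rightarrow>\<^sub>E lin_End sV \<Longrightarrow>
      lin_trace sT (E' \<circ> tmap (\<lambda>i\<in>{1..m}. g \<circ> z i \<circ> inv g)) = lin_trace sT (E \<circ> tmap z)"
  shows "E' = tmap (\<lambda>_. g) \<circ> E \<circ> tmap (\<lambda>_. inv g)"
proof (rule trace_nondegenerate[OF E(2)])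
  show "tmap (\<lambda>_. g) \<circ> E \<circ> tmap (\<lambda>_. inv g) \<in> lin_End sT"
    by (intro lin_T_comp E GL_tmap_lin g)
  fix y assume y: "y \<in> {1..m} \<rightarrow>\<^sub>E lin_End sV"
  define z where "z = (\<lambda>i\<in>{1..m}. inv g \<circ> y i \<circ> g)"
  have z: "z \<in> {1..m} \<rightarrow>\<^sub>E lin_End sV"
    unfolding z_def using y by (auto intro!: V.lin_comp V.GL_lin[OF g] V.GL_lin[OF V.inv_GL(1)[OF g]])
  have "g \<circ> (inv g \<circ> y i \<circ> g) \<circ> inv g = y i" for i
    by (simp only: comp_assoc V.inv_GL[OF g] comp_id) (simp only: comp_assoc[symmetric] V.inv_GL[OF g] id_comp)
  then have "(\<lambda>i\<in>{1..m}. g \<circ> z i \<circ> inv g) = y"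
    using y by (auto simp: z_def fun_eq_iff PiE_iff extensional_def)
  then show "lin_trace sT (E' \<circ> tmap y) = lin_trace sT (tmap (\<lambda>_. g) \<circ> E \<circ> tmap (\<lambda>_. inv g) \<circ> tmap y)"
    using eq[OF z] trace_conj[OF g E(1) z] by simp
qed

text \<open>Conjugation invariance is the form of the commutation condition that the trace pairing
  can test.\<close>

lemma End_GL_iff_conj:
  assumes "E \<in> lin_End sT"
  shows "E \<in> End_GL sV m sT tens \<longleftrightarrow> (\<forall>g\<in>lin_GL sV. tmap (\<lambda>_. g) \<circ> E \<circ> tmap (\<lambda>_. inv g) = E)"
proof -
  have "E \<circ> tmap (\<lambda>_. g) = tmap (\<lambda>_. g) \<circ> E \<longleftrightarrow> tmap (\<lambda>_. g) \<circ> E \<circ> tmap (\<lambda>_. inv g) = E"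
    if "g \<in> lin_GL sV" for g
  proof
    assume "E \<circ> tmap (\<lambda>_. g) = tmap (\<lambda>_. g) \<circ> E"
    then have "tmap (\<lambda>_. g) \<circ> E \<circ> tmap (\<lambda>_. inv g) = E \<circ> tmap (\<lambda>_. g) \<circ> tmap (\<lambda>_. inv g)" by simp
    then show "tmap (\<lambda>_. g) \<circ> E \<circ> tmap (\<lambda>_. inv g) = E"
      by (simp only: comp_assoc tmap_GL[OF that] comp_id)
  next
    assume "tmap (\<lambda>_. g) \<circ> E \<circ> tmap (\<lambda>_. inv g) = E"
    then have "E \<circ> tmap (\<lambda>_. g) = tmap (\<lambda>_. g) \<circ> E \<circ> tmap (\<lambda>_. inv g) \<circ> tmap (\<lambda>_. g)" by simp
    then show "E \<circ> tmap (\<lambda>_. g) = tmap (\<lambda>_. g) \<circ> E"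
      by (simp only: comp_assoc tmap_GL[OF that] comp_id)
  qed
  then show ?thesis using assms by (simp add: End_GL_def)
qed

end

section \<open>The correspondence between equivariant maps and invariant operators\<close>

locale tensor_pair =
  S: finite_tensor_power sV Bas n sS tensS + T: finite_tensor_power sV Bas "n + k" sT tensT
  for sV :: "rat \<Rightarrow> 'v::ab_group_add \<Rightarrow> 'v" and Bas
    and n and sS :: "rat \<Rightarrow> 's::ab_group_add \<Rightarrow> 's" and tensS
    and k and sT :: "rat \<Rightarrow> 't::ab_group_add \<Rightarrow> 't" and tensT
begin

abbreviation lin :: "('v \<Rightarrow> 'v) set" where
  "lin \<equiv> lin_End sV"

abbreviation eqv :: "((nat \<Rightarrow> 'v \<Rightarrow> 'v) \<Rightarrow> 's \<Rightarrow> 's) set" where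
  "eqv \<equiv> equivariant_maps sV n k sS tensS"

abbreviation EGL :: "('t \<Rightarrow> 't) set" where
  "EGL \<equiv> End_GL sV (n + k) sT tensT"

abbreviation corr :: "((nat \<Rightarrow> 'v \<Rightarrow> 'v) \<Rightarrow> 's \<Rightarrow> 's) \<Rightarrow> ('t \<Rightarrow> 't) \<Rightarrow> bool" where
  "corr \<equiv> corresponds sV n k sS tensS sT tensT"

text \<open>Restricting to \<open>{1..n + k}\<close> makes the combined family a genuine tuple, to
  which the span and multilinearity arguments apply; by \<open>tr_E_restrict\<close> the pairing
  does not see the restriction.\<close>

definition joint :: "(nat \<Rightarrow> 'v \<Rightarrow> 'v) \<Rightarrow> (nat \<Rightarrow> 'v \<Rightarrow> 'v) \<Rightarrow> nat \<Rightarrow> 'v \<Rightarrow> 'v" where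
  "joint y x = (\<lambda>i\<in>{1..n + k}. if i \<le> n then y i else x (i - n))"

definition tr_E :: "('t \<Rightarrow> 't) \<Rightarrow> (nat \<Rightarrow> 'v \<Rightarrow> 'v) \<Rightarrow> rat" where
  "tr_E E z = lin_trace sT (E \<circ> T.tmap z)"

lemma tr_E_restrict: "tr_E E (restrict z {1..n + k}) = tr_E E z"
  unfolding tr_E_def by (rule arg_cong[where f = "\<lambda>F. lin_trace sT (E \<circ> F)"], rule T.tmap_cong) simp

lemma corr_iff:
  "corr H E \<longleftrightarrow> (\<forall>x \<in> {1..k} \<rightarrow>\<^sub>E lin. \<forall>y \<in> {1..n} \<rightarrow>\<^sub>E lin.
    lin_trace sS (H x \<circ> S.tmap y) = tr_E E (joint y x))"
  unfolding joint_def tr_E_restrict by (simp only: corresponds_def tr_E_def)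

lemma corrD:
  "corr H E \<Longrightarrow> x \<in> {1..k} \<rightarrow>\<^sub>E lin \<Longrightarrow> y \<in> {1..n} \<rightarrow>\<^sub>E lin \<Longrightarrow>
    lin_trace sS (H x \<circ> S.tmap y) = tr_E E (joint y x)"
  by (simp only: corr_iff)

lemma joint_PiE:
  assumes "x \<in> {1..k} \<rightarrow>\<^sub>E lin" "y \<in> {1..n} \<rightarrow>\<^sub>E lin"
  shows "joint y x \<in> {1..n + k} \<rightarrow>\<^sub>E lin"
proof -
  have "x (i - n) \<in> lin" if "i \<in> {1..n + k}" "\<not> i \<le> n" for i
    by (rule PiE_mem[OF assms(1)]) (use that in auto)
  then show ?thesis using assms(2) by (auto simp: joint_def PiE_iff)
qed

lemma joint_upd_left: "i \<in> {1..n} \<Longrightarrow> joint (y(i := a)) x = (joint y x)(i := a)"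
  by (auto simp: joint_def fun_eq_iff)

lemma joint_upd_right: "i \<in> {1..k} \<Longrightarrow> joint y (x(i := a)) = (joint y x)(n + i := a)"
  by (auto simp: joint_def fun_eq_iff)

lemma joint_split:
  assumes "z \<in> {1..n + k} \<rightarrow>\<^sub>E lin"
  obtains y x where "y \<in> {1..n} \<rightarrow>\<^sub>E lin" "x \<in> {1..k} \<rightarrow>\<^sub>E lin" "z = joint y x"
proof
  show "restrict z {1..n} \<in> {1..n} \<rightarrow>\<^sub>E lin" "(\<lambda>j\<in>{1..k}. z (n + j)) \<in> {1..k} \<rightarrow>\<^sub>E lin"
    using assms by (auto simp: PiE_iff)
  show "z = joint (restrict z {1..n}) (\<lambda>j\<in>{1..k}. z (n + j))"
    using assms by (auto simp: joint_def fun_eq_iff PiE_iff extensional_def)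
qed

lemma joint_conj:
  "(\<lambda>i\<in>{1..n + k}. g \<circ> joint y x i \<circ> inv g) =
    joint (\<lambda>i\<in>{1..n}. g \<circ> y i \<circ> inv g) (\<lambda>i\<in>{1..k}. g \<circ> x i \<circ> inv g)"
  by (auto simp: joint_def fun_eq_iff)

lemma tr_E_multilinear: "E \<in> lin_End sT \<Longrightarrow> multilinear_on (n + k) lin (fun_scale sV) (*) (tr_E E)"
  unfolding tr_E_def by (rule T.multilinear_lin_trace_tmap)

lemma tr_E_multilinear_left:
  assumes "E \<in> lin_End sT" "x \<in> {1..k} \<rightarrow>\<^sub>E lin"
  shows "multilinear_on n lin (fun_scale sV) (*) (\<lambda>y. tr_E E (joint y x))"
  unfolding multilinear_on_def
  by (auto simp: joint_upd_left joint_PiE[OF assms(2)] multilinear_on_add[OF tr_E_multilinear[OF assms(1)]]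
      multilinear_on_scale[OF tr_E_multilinear[OF assms(1)]])

lemma munits_PiE:
  assumes "z \<in> {1..l} \<rightarrow>\<^sub>E S.V.munits"
  obtains p q where "p \<in> {1..l} \<rightarrow>\<^sub>E Bas" "q \<in> {1..l} \<rightarrow>\<^sub>E Bas" "z = (\<lambda>i\<in>{1..l}. S.V.munit (p i) (q i))"
proof -
  have "\<forall>i\<in>{1..l}. \<exists>b. fst b \<in> Bas \<and> snd b \<in> Bas \<and> z i = S.V.munit (fst b) (snd b)"
    using assms by (fastforce simp: PiE_iff S.V.munits_def)
  then obtain b where b: "\<And>i. i \<in> {1..l} \<Longrightarrow> fst (b i) \<in> Bas \<and> snd (b i) \<in> Bas \<and> z i = S.V.munit (fst (b i)) (snd (b i))"
    by metis
  show ?thesis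
  proof (rule that[of "\<lambda>i\<in>{1..l}. fst (b i)" "\<lambda>i\<in>{1..l}. snd (b i)"])
    show "z = (\<lambda>i\<in>{1..l}. S.V.munit ((\<lambda>i\<in>{1..l}. fst (b i)) i) ((\<lambda>i\<in>{1..l}. snd (b i)) i))"
      using assms b by (auto simp: fun_eq_iff PiE_iff extensional_def)
  qed (use b in auto)
qed

lemma multilinear_eq_on_munits:
  assumes "multilinear_on l lin (fun_scale sV) (*) f" "multilinear_on l lin (fun_scale sV) (*) g"
    and eq: "\<And>p q. p \<in> {1..l} \<rightarrow>\<^sub>E Bas \<Longrightarrow> q \<in> {1..l} \<rightarrow>\<^sub>E Bas \<Longrightarrow>
      f (\<lambda>i\<in>{1..l}. S.V.munit (p i) (q i)) = g (\<lambda>i\<in>{1..l}. S.V.munit (p i) (q i))"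
    and "z \<in> {1..l} \<rightarrow>\<^sub>E lin"
  shows "f z = g z"
proof (rule multilinear_on_eq_on_span[OF S.V.E.vector_space_axioms vector_space_rat assms(1,2)
        S.V.subspace_lin_End S.V.munits_lin S.V.lin_End_subset_span_munits _ assms(4)])
  fix z assume "z \<in> {1..l} \<rightarrow>\<^sub>E S.V.munits"
  then obtain p q where "p \<in> {1..l} \<rightarrow>\<^sub>E Bas" "q \<in> {1..l} \<rightarrow>\<^sub>E Bas"
    and z: "z = (\<lambda>i\<in>{1..l}. S.V.munit (p i) (q i))" by (rule munits_PiE)
  then show "f z = g z" using eq by blast
qed

lemma eqv_lin: "H \<in> eqv \<Longrightarrow> x \<in> {1..k} \<rightarrow>\<^sub>E lin \<Longrightarrow> H x \<in> lin_End sS"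
  and eqv_zero: "H \<in> eqv \<Longrightarrow> x \<notin> {1..k} \<rightarrow>\<^sub>E lin \<Longrightarrow> H x = 0"
  and eqv_multilinear: "H \<in> eqv \<Longrightarrow> multilinear_on k lin (fun_scale sV) (fun_scale sS) H"
  and eqv_conj: "H \<in> eqv \<Longrightarrow> g \<in> lin_GL sV \<Longrightarrow> x \<in> {1..k} \<rightarrow>\<^sub>E lin \<Longrightarrow>
    H (\<lambda>i\<in>{1..k}. g \<circ> x i \<circ> inv g) = S.tmap (\<lambda>_. g) \<circ> H x \<circ> S.tmap (\<lambda>_. inv g)"
  by (auto simp: equivariant_maps_def Pi_iff)

text \<open>Nondegeneracy in the first \<open>n\<close> slots pins down each value of
  \<open>H\<close>. This serves both the uniqueness of \<open>H\<close> and the evaluation of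
  \<open>T_map\<close>.\<close>

lemma corr_value:
  assumes "corr H E" "H \<in> eqv" and x: "x \<in> {1..k} \<rightarrow>\<^sub>E lin" and F: "F \<in> lin_End sS"
    and eq: "\<And>y. y \<in> {1..n} \<rightarrow>\<^sub>E lin \<Longrightarrow> lin_trace sS (F \<circ> S.tmap y) = tr_E E (joint y x)"
  shows "H x = F"
proof (rule S.trace_nondegenerate[OF eqv_lin[OF assms(2) x] F])
  fix y assume "y \<in> {1..n} \<rightarrow>\<^sub>E lin"
  then show "lin_trace sS (H x \<circ> S.tmap y) = lin_trace sS (F \<circ> S.tmap y)"
    using assms(1) x eq by (simp add: corr_iff)
qed

lemma corr_unique_left:
  assumes "H \<in> eqv" "H' \<in> eqv" "corr H E" "corr H' E"
  shows "H = H'"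
proof
  fix x
  show "H x = H' x"
  proof (cases "x \<in> {1..k} \<rightarrow>\<^sub>E lin")
    case True
    then show ?thesis
      using assms(4) by (intro corr_value[OF assms(3,1) True eqv_lin[OF assms(2) True]]) (simp add: corr_iff)
  next
    \<comment> \<open>Off the tuples of endomorphisms both maps vanish by convention, so they agree
      as total functions.\<close>
    case False
    then show ?thesis using eqv_zero[OF assms(1)] eqv_zero[OF assms(2)] by simp
  qed
qed

lemma corr_unique_right:
  assumes "E \<in> lin_End sT" "E' \<in> lin_End sT" "corr H E" "corr H E'"
  shows "E = E'"
proof (rule T.trace_nondegenerate[OF assms(1,2)])
  fix z assume "z \<in> {1..n + k} \<rightarrow>\<^sub>E lin"
  then obtain y x where "y \<in> {1..n} \<rightarrow>\<^sub>E lin" "x \<in> {1..k} \<rightarrow>\<^sub>E lin" "z = joint y x"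
    by (rule joint_split)
  then show "lin_trace sT (E \<circ> T.tmap z) = lin_trace sT (E' \<circ> T.tmap z)"
    using assms(3,4) by (simp add: corr_iff tr_E_def)
qed

text \<open>The pairing of \<open>H\<close> regarded as one function of an
  \<open>n + k\<close>-tuple; for equivariant \<open>H\<close> it is multilinear in all slots and
  therefore determined by matrix units.\<close>

definition tr_H :: "((nat \<Rightarrow> 'v \<Rightarrow> 'v) \<Rightarrow> 's \<Rightarrow> 's) \<Rightarrow> (nat \<Rightarrow> 'v \<Rightarrow> 'v) \<Rightarrow> rat" where
  "tr_H H z = lin_trace sS (H (\<lambda>j\<in>{1..k}. z (n + j)) \<circ> S.tmap (restrict z {1..n}))"

lemma tr_H_joint:
  assumes "x \<in> {1..k} \<rightarrow>\<^sub>E U" "y \<in> {1..n} \<rightarrow>\<^sub>E U"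
  shows "tr_H H (joint y x) = lin_trace sS (H x \<circ> S.tmap y)"
proof -
  have "(\<lambda>j\<in>{1..k}. joint y x (n + j)) = x" "restrict (joint y x) {1..n} = y"
    using assms by (auto simp: joint_def fun_eq_iff PiE_iff extensional_def)
  then show ?thesis by (simp add: tr_H_def)
qed

lemma tr_H_multilinear:
  assumes H: "H \<in> eqv"
  shows "multilinear_on (n + k) lin (fun_scale sV) (*) (tr_H H)"
  unfolding multilinear_on_def
proof (rule ballI, rule ballI)
  fix z i assume z: "z \<in> {1..n + k} \<rightarrow>\<^sub>E lin" and i: "i \<in> {1..n + k}"
  obtain y x where y: "y \<in> {1..n} \<rightarrow>\<^sub>E lin" and x: "x \<in> {1..k} \<rightarrow>\<^sub>E lin" and z: "z = joint y x"
    using joint_split[OF z] .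
  show "(\<forall>a\<in>lin. \<forall>b\<in>lin. tr_H H (z(i := a + b)) = tr_H H (z(i := a)) + tr_H H (z(i := b))) \<and>
      (\<forall>c. \<forall>a\<in>lin. tr_H H (z(i := fun_scale sV c a)) = c * tr_H H (z(i := a)))"
  proof (cases "i \<le> n")
    case True
    then have i': "i \<in> {1..n}" using i by simp
    have upd: "tr_H H (z(i := a)) = lin_trace sS (H x \<circ> S.tmap (y(i := a)))" if "a \<in> lin" for a
      unfolding z joint_upd_left[OF i', symmetric]
      by (rule tr_H_joint[OF x]) (use that y i' in \<open>auto simp: PiE_iff extensional_def\<close>)
    note ml = S.multilinear_lin_trace_tmap[OF eqv_lin[OF H x]]
    show ?thesis
      using multilinear_on_add[OF ml y i'] multilinear_on_scale[OF ml y i']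
      by (simp add: upd S.V.lin_add S.V.lin_scale)
  next
    case False
    define j where "j = i - n"
    have j: "j \<in> {1..k}" "i = n + j" using i False by (auto simp: j_def)
    have xa: "x(j := a) \<in> {1..k} \<rightarrow>\<^sub>E lin" if "a \<in> lin" for a
      using that x j by (auto simp: PiE_iff extensional_def)
    have upd: "tr_H H (z(i := a)) = lin_trace sS (H (x(j := a)) \<circ> S.tmap y)" if "a \<in> lin" for a
      unfolding z j(2) joint_upd_right[OF j(1), symmetric] by (rule tr_H_joint[OF xa[OF that] y])
    have Y: "S.tmap y \<in> lin_End sS" by (rule S.tmap_lin) (use y in auto)
    have Hl: "H (x(j := a)) \<circ> S.tmap y \<in> lin_End sS" if "a \<in> lin" for a
      by (intro S.lin_T_comp Y eqv_lin[OF H] xa that)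
    note ml = eqv_multilinear[OF H]
    have "(F + G) \<circ> S.tmap y = (F \<circ> S.tmap y) + (G \<circ> S.tmap y)"
      "fun_scale sS c F \<circ> S.tmap y = fun_scale sS c (F \<circ> S.tmap y)" for F G c
      by (auto simp: fun_scale_def fun_eq_iff)
    then show ?thesis
      using multilinear_on_add[OF ml x j(1)] multilinear_on_scale[OF ml x j(1)]
      by (simp add: upd S.V.lin_add S.V.lin_scale S.lin_trace_T_add S.lin_trace_T_scale Hl)
  qed
qed

lemma EGL_lin: "E \<in> EGL \<Longrightarrow> E \<in> lin_End sT"
  by (simp add: End_GL_def)

lemma ex_corr_right:
  assumes H: "H \<in> eqv"
  shows "\<exists>E\<in>EGL. corr H E"
proof
  \<comment> \<open>The matrix of \<open>E\<close> is forced: pairing with the units at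
    \<open>(u i, w i)\<close> must give the coefficient of \<open>tensT w\<close> in
    \<open>E (tensT u)\<close>.\<close>
  define E where "E = T.of_mat (\<lambda>w u. tr_H H (\<lambda>i\<in>{1..n + k}. S.V.munit (u i) (w i)))"
  have E: "E \<in> lin_End sT" unfolding E_def by (rule T.of_mat_lin)
  have eq: "tr_H H z = tr_E E z" if "z \<in> {1..n + k} \<rightarrow>\<^sub>E lin" for z
  proof (rule multilinear_eq_on_munits[OF tr_H_multilinear[OF H] tr_E_multilinear[OF E] _ that])
    fix p q assume pq: "p \<in> T.words" "q \<in> T.words"
    show "tr_H H (\<lambda>i\<in>{1..n + k}. S.V.munit (p i) (q i)) = tr_E E (\<lambda>i\<in>{1..n + k}. S.V.munit (p i) (q i))"
      unfolding tr_E_restrict unfolding tr_E_def T.lin_trace_munits[OF E pq]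
      by (simp add: E_def T.coord_of_mat[OF pq(2,1)])
  qed
  then show corr: "corr H E" by (simp add: corr_iff joint_PiE tr_H_joint[symmetric])
  \<comment> \<open>Conjugating all slots simultaneously leaves the pairing of \<open>H\<close>
    unchanged, by equivariance and cyclicity; hence it leaves the pairing of \<open>E\<close>
    unchanged.\<close>
  have "T.tmap (\<lambda>_. g) \<circ> E \<circ> T.tmap (\<lambda>_. inv g) = E" if g: "g \<in> lin_GL sV" for g
  proof (rule T.conj_eqI[OF g E E, symmetric])
    fix z assume "z \<in> {1..n + k} \<rightarrow>\<^sub>E lin"
    then obtain y x where y: "y \<in> {1..n} \<rightarrow>\<^sub>E lin" and x: "x \<in> {1..k} \<rightarrow>\<^sub>E lin" and z: "z = joint y x"
      by (rule joint_split)
    show "lin_trace sT (E \<circ> T.tmap (\<lambda>i\<in>{1..n + k}. g \<circ> z i \<circ> inv g)) = lin_trace sT (E \<circ> T.tmap z)"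
      unfolding z joint_conj tr_E_def[symmetric]
        corrD[OF corr x y, symmetric] corrD[OF corr S.conj_PiE[OF g x] S.conj_PiE[OF g y], symmetric]
        eqv_conj[OF H g x]
      by (rule S.trace_conj[OF g eqv_lin[OF H x] y])
  qed
  then show "E \<in> EGL" by (simp add: T.End_GL_iff_conj[OF E])
qed

lemma ex_corr_left:
  assumes E: "E \<in> EGL"
  shows "\<exists>H\<in>eqv. corr H E"
proof
  have El: "E \<in> lin_End sT" by (rule EGL_lin[OF E])
  define un where "un p q = (\<lambda>i\<in>{1..n}. S.V.munit (p i) (q i))" for p q :: "nat \<Rightarrow> 'v"
  have un: "un p q \<in> {1..n} \<rightarrow>\<^sub>E lin" for p q by (simp add: un_def S.V.munit_lin)
  \<comment> \<open>Units fill only the first \<open>n\<close> slots while \<open>x\<close> stays a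
    parameter, so \<open>H x\<close> is prescribed entry by entry. The value zero elsewhere is the
    convention in \<open>equivariant_maps\<close>.\<close>
  define H where "H x = (if x \<in> {1..k} \<rightarrow>\<^sub>E lin
    then S.of_mat (\<lambda>w u. tr_E E (joint (un u w) x)) else 0)" for x
  have Hl: "H x \<in> lin_End sS" for x by (simp add: H_def S.of_mat_lin S.lin_T_zero)
  have Hc: "S.coord q (H x (tensS p)) = tr_E E (joint (un p q) x)"
    if "p \<in> S.words" "q \<in> S.words" "x \<in> {1..k} \<rightarrow>\<^sub>E lin" for p q x
    using that by (simp add: H_def S.coord_of_mat)
  show corr: "corr H E"
    unfolding corr_iff
  proof (intro ballI)
    fix x y assume x: "x \<in> {1..k} \<rightarrow>\<^sub>E lin" and y: "y \<in> {1..n} \<rightarrow>\<^sub>E lin"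
    show "lin_trace sS (H x \<circ> S.tmap y) = tr_E E (joint y x)"
    proof (rule multilinear_eq_on_munits[OF S.multilinear_lin_trace_tmap[OF Hl]
          tr_E_multilinear_left[OF El x] _ y])
      fix p q assume pq: "p \<in> S.words" "q \<in> S.words"
      have "S.tmap (\<lambda>i\<in>{1..n}. S.V.munit (p i) (q i)) = S.tmap (\<lambda>i. S.V.munit (p i) (q i))"
        by (rule S.tmap_cong) simp
      then show "lin_trace sS (H x \<circ> S.tmap (\<lambda>i\<in>{1..n}. S.V.munit (p i) (q i))) =
          tr_E E (joint (\<lambda>i\<in>{1..n}. S.V.munit (p i) (q i)) x)"
        using Hc[OF pq x] by (simp add: S.lin_trace_munits[OF Hl pq] un_def)
    qed
  qed
  have ml: "multilinear_on k lin (fun_scale sV) (fun_scale sS) H"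
    unfolding multilinear_on_def
  proof (intro ballI conjI allI)
    fix x i assume x: "x \<in> {1..k} \<rightarrow>\<^sub>E lin" and i: "i \<in> {1..k}"
    have xa: "x(i := a) \<in> {1..k} \<rightarrow>\<^sub>E lin" if "a \<in> lin" for a
      using that x i by (auto simp: PiE_iff extensional_def)
    have ni: "n + i \<in> {1..n + k}" using i by simp
    note jn = joint_PiE[OF x un]
    show "H (x(i := a + b)) = H (x(i := a)) + H (x(i := b))" if "a \<in> lin" "b \<in> lin" for a b
    proof (rule S.lin_T_ext)
      fix q p assume "q \<in> S.words" "p \<in> S.words"
      then show "S.coord q (H (x(i := a + b)) (tensS p)) = S.coord q ((H (x(i := a)) + H (x(i := b))) (tensS p))"
        using that multilinear_on_add[OF tr_E_multilinear[OF El] jn ni that]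
        by (simp add: Hc xa S.V.lin_add S.coord_add joint_upd_right[OF i])
    qed (intro S.lin_T_add Hl)+
    show "H (x(i := fun_scale sV c a)) = fun_scale sS c (H (x(i := a)))" if "a \<in> lin" for a c
    proof (rule S.lin_T_ext)
      fix q p assume "q \<in> S.words" "p \<in> S.words"
      then show "S.coord q (H (x(i := fun_scale sV c a)) (tensS p)) = S.coord q (fun_scale sS c (H (x(i := a))) (tensS p))"
        using that multilinear_on_scale[OF tr_E_multilinear[OF El] jn ni that]
        by (simp add: Hc xa S.V.lin_scale S.coord_scale fun_scale_def[of sS] joint_upd_right[OF i])
    qed (intro S.lin_T_scale Hl)+
  qed
  \<comment> \<open>Invariance of \<open>E\<close> makes the pairing insensitive to conjugating
    \<open>x\<close> and \<open>y\<close> together; removing the arbitrary \<open>y\<close> by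
    nondegeneracy leaves equivariance in \<open>x\<close>.\<close>
  have conj: "H (\<lambda>i\<in>{1..k}. g \<circ> x i \<circ> inv g) = S.tmap (\<lambda>_. g) \<circ> H x \<circ> S.tmap (\<lambda>_. inv g)"
    if g: "g \<in> lin_GL sV" and x: "x \<in> {1..k} \<rightarrow>\<^sub>E lin" for g x
  proof (rule S.conj_eqI[OF g Hl Hl])
    fix y assume y: "y \<in> {1..n} \<rightarrow>\<^sub>E lin"
    have "T.tmap (\<lambda>_. g) \<circ> E \<circ> T.tmap (\<lambda>_. inv g) = E"
      using E g by (simp add: T.End_GL_iff_conj[OF El])
    then have "tr_E E (\<lambda>i\<in>{1..n + k}. g \<circ> joint y x i \<circ> inv g) = tr_E E (joint y x)"
      using T.trace_conj[OF g El joint_PiE[OF x y]] by (simp add: tr_E_def)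
    then show "lin_trace sS (H (\<lambda>i\<in>{1..k}. g \<circ> x i \<circ> inv g) \<circ> S.tmap (\<lambda>i\<in>{1..n}. g \<circ> y i \<circ> inv g)) =
        lin_trace sS (H x \<circ> S.tmap y)"
      unfolding corrD[OF corr x y] corrD[OF corr S.conj_PiE[OF g x] S.conj_PiE[OF g y]] joint_conj .
  qed
  show "H \<in> eqv"
    unfolding equivariant_maps_def using Hl ml conj by (auto simp: H_def)
qed

sublocale H: vector_space "fun_scale (fun_scale sS) :: rat \<Rightarrow> ((nat \<Rightarrow> 'v \<Rightarrow> 'v) \<Rightarrow> 's \<Rightarrow> 's) \<Rightarrow> _"
  by (rule vector_space_fun_scale[OF S.TE.vector_space_axioms])

lemma eqv_subspace: "H.subspace eqv"
proof -
  have comp: "F \<circ> (A + B) \<circ> G = (F \<circ> A \<circ> G) + (F \<circ> B \<circ> G)" "F \<circ> fun_scale sS c A \<circ> G = fun_scale sS c (F \<circ> A \<circ> G)"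
    "F \<circ> 0 \<circ> G = 0"
    if "F \<in> lin_End sS" for F and A B G :: "'s \<Rightarrow> 's" and c
  proof -
    have F: "F (a + b) = F a + F b" "F (sS r a) = sS r (F a)" for a b r
      using that by (simp_all add: S.lin_T_iff)
    have "F 0 = 0" using F(2)[of 0 0] by simp
    with F show "F \<circ> (A + B) \<circ> G = (F \<circ> A \<circ> G) + (F \<circ> B \<circ> G)"
      "F \<circ> fun_scale sS c A \<circ> G = fun_scale sS c (F \<circ> A \<circ> G)" "F \<circ> 0 \<circ> G = 0"
      by (simp_all add: fun_scale_def fun_eq_iff)
  qed
  have "0 \<in> eqv"
    using comp(3)[OF S.GL_tmap_lin(1)]
    by (auto simp: equivariant_maps_def S.lin_T_zero multilinear_on_def fun_scale_def)
  moreover have "H + H' \<in> eqv" if "H \<in> eqv" "H' \<in> eqv" for H H'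
    using that comp(1)[OF S.GL_tmap_lin(1)]
    by (auto simp: equivariant_maps_def Pi_iff S.lin_T_add multilinear_on_def S.TE.scale_right_distrib)
  moreover have "fun_scale (fun_scale sS) c H \<in> eqv" if "H \<in> eqv" for H c
    using that comp(2)[OF S.GL_tmap_lin(1)]
    by (auto simp: equivariant_maps_def Pi_iff S.lin_T_scale multilinear_on_def S.TE.scale_right_distrib
        S.TE.scale_left_commute fun_scale_def[of "fun_scale sS"])
  ultimately show ?thesis by (simp add: H.subspace_def)
qed

lemma corr_zero: "corr 0 0"
proof -
  have "lin_trace sS 0 = 0" "lin_trace sT 0 = 0"
    using S.lin_trace_T_scale[OF S.lin_T_zero, of 0] T.lin_trace_T_scale[OF T.lin_T_zero, of 0] by simp_all
  moreover have "(0 :: 's \<Rightarrow> 's) \<circ> S.tmap y = 0" "(0 :: 't \<Rightarrow> 't) \<circ> T.tmap z = 0" for y z by (auto simp: fun_eq_iff)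
  ultimately show ?thesis by (simp add: corr_iff tr_E_def)
qed

lemma joint_tmap_lin: "x \<in> {1..k} \<rightarrow>\<^sub>E lin \<Longrightarrow> y \<in> {1..n} \<rightarrow>\<^sub>E lin \<Longrightarrow> T.tmap (joint y x) \<in> lin_End sT"
  by (rule T.tmap_lin) (auto dest: joint_PiE)

lemma corr_add:
  assumes "H \<in> eqv" "H' \<in> eqv" "E \<in> lin_End sT" "E' \<in> lin_End sT" "corr H E" "corr H' E'"
  shows "corr (H + H') (E + E')"
  unfolding corr_iff
proof (intro ballI)
  fix x y assume x: "x \<in> {1..k} \<rightarrow>\<^sub>E lin" and y: "y \<in> {1..n} \<rightarrow>\<^sub>E lin"
  have Y: "S.tmap y \<in> lin_End sS" by (rule S.tmap_lin) (use y in auto)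
  have dist: "(H x + H' x) \<circ> S.tmap y = (H x \<circ> S.tmap y) + (H' x \<circ> S.tmap y)"
    "(E + E') \<circ> T.tmap (joint y x) = (E \<circ> T.tmap (joint y x)) + (E' \<circ> T.tmap (joint y x))"
    by (auto simp: fun_eq_iff)
  show "lin_trace sS ((H + H') x \<circ> S.tmap y) = tr_E (E + E') (joint y x)"
    using assms x y
    by (simp add: corr_iff dist S.lin_trace_T_add S.lin_T_comp Y eqv_lin[OF assms(1)] eqv_lin[OF assms(2)] tr_E_def T.lin_trace_T_add
        T.lin_T_comp joint_tmap_lin)
qed

lemma corr_scale:
  assumes "H \<in> eqv" "E \<in> lin_End sT" "corr H E"
  shows "corr (fun_scale (fun_scale sS) c H) (fun_scale sT c E)"
  unfolding corr_iff
proof (intro ballI)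
  fix x y assume x: "x \<in> {1..k} \<rightarrow>\<^sub>E lin" and y: "y \<in> {1..n} \<rightarrow>\<^sub>E lin"
  have Y: "S.tmap y \<in> lin_End sS" by (rule S.tmap_lin) (use y in auto)
  have "fun_scale (fun_scale sS) c H x \<circ> S.tmap y = fun_scale sS c (H x \<circ> S.tmap y)"
    "fun_scale sT c E \<circ> T.tmap (joint y x) = fun_scale sT c (E \<circ> T.tmap (joint y x))"
    by (auto simp: fun_eq_iff fun_scale_def)
  then show "lin_trace sS (fun_scale (fun_scale sS) c H x \<circ> S.tmap y) = tr_E (fun_scale sT c E) (joint y x)"
    using assms x y
    by (simp add: corr_iff S.lin_trace_T_scale S.lin_T_comp Y eqv_lin[OF assms(1)] tr_E_def T.lin_trace_T_scale
        T.lin_T_comp joint_tmap_lin)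
qed

lemma corr_sum:
  assumes "\<And>\<sigma>. \<sigma> \<in> A \<Longrightarrow> H \<sigma> \<in> eqv \<and> E \<sigma> \<in> lin_End sT \<and> corr (H \<sigma>) (E \<sigma>)"
  shows "corr (\<Sum>\<sigma>\<in>A. H \<sigma>) (\<Sum>\<sigma>\<in>A. E \<sigma>)"
  using assms
proof (induction A rule: infinite_finite_induct)
  case (insert \<sigma> A)
  have "(\<Sum>\<sigma>\<in>A. H \<sigma>) \<in> eqv" "(\<Sum>\<sigma>\<in>A. E \<sigma>) \<in> lin_End sT"
    using insert.prems by (intro H.subspace_sum eqv_subspace T.TE.subspace_sum T.subspace_lin_T; simp)+
  then show ?case
    unfolding sum.insert[OF insert.hyps(1,2)] using insert.prems insert.IH by (intro corr_add) simp_all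
qed (simp_all only: sum.infinite sum.empty corr_zero not_False_eq_True)

text \<open>For equivariant \<open>H\<close> the choice is forced, since nondegeneracy allows only
  one corresponding linear operator.\<close>

definition corr_map :: "((nat \<Rightarrow> 'v \<Rightarrow> 'v) \<Rightarrow> 's \<Rightarrow> 's) \<Rightarrow> 't \<Rightarrow> 't" where
  "corr_map H = (SOME E. E \<in> EGL \<and> corr H E)"

lemma corr_map:
  assumes "H \<in> eqv"
  shows "corr_map H \<in> EGL" "corr H (corr_map H)"
  using someI_ex[of "\<lambda>E. E \<in> EGL \<and> corr H E"] ex_corr_right[OF assms] unfolding corr_map_def by auto

lemma corr_map_eqI:
  "H \<in> eqv \<Longrightarrow> E \<in> lin_End sT \<Longrightarrow> corr H E \<Longrightarrow> corr_map H = E"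
  by (rule corr_unique_right[OF EGL_lin]) (auto intro: corr_map)

lemma corr_map_properties:
  "bij_betw corr_map eqv EGL"
  "H \<in> eqv \<Longrightarrow> H' \<in> eqv \<Longrightarrow> corr_map (H + H') = corr_map H + corr_map H'"
  "H \<in> eqv \<Longrightarrow> corr_map (fun_scale (fun_scale sS) c H) = fun_scale sT c (corr_map H)"
  "H \<in> eqv \<Longrightarrow> E \<in> EGL \<Longrightarrow> corr H E \<longleftrightarrow> E = corr_map H"
proof -
  show "bij_betw corr_map eqv EGL"
  proof (rule bij_betw_imageI)
    show "inj_on corr_map eqv" by (rule inj_onI) (metis corr_map(2) corr_unique_left)
    show "corr_map ` eqv = EGL"
    proof
      show "EGL \<subseteq> corr_map ` eqv"
        using ex_corr_left corr_map_eqI EGL_lin by (metis imageI subsetI)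
    qed (auto intro: corr_map)
  qed
  show "H \<in> eqv \<Longrightarrow> H' \<in> eqv \<Longrightarrow> corr_map (H + H') = corr_map H + corr_map H'"
    by (intro corr_map_eqI corr_add H.subspace_add[OF eqv_subspace] T.lin_T_add EGL_lin corr_map)
  show "H \<in> eqv \<Longrightarrow> corr_map (fun_scale (fun_scale sS) c H) = fun_scale sT c (corr_map H)"
    by (intro corr_map_eqI corr_scale H.subspace_scale[OF eqv_subspace] T.lin_T_scale EGL_lin corr_map)
  show "H \<in> eqv \<Longrightarrow> E \<in> EGL \<Longrightarrow> corr H E \<longleftrightarrow> E = corr_map H"
    using corr_map corr_map_eqI EGL_lin by metis
qed

abbreviation TM :: "(nat \<Rightarrow> nat) \<Rightarrow> (nat \<Rightarrow> 'v \<Rightarrow> 'v) \<Rightarrow> 's \<Rightarrow> 's" where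
  "TM \<equiv> T_map sV n k sS tensS sT tensT"

text \<open>Existence comes from the invariance of permutation operators, uniqueness from
  nondegeneracy; so the definite description in \<open>T_map\<close> denotes.\<close>

lemma T_map_eqv_corr:
  assumes \<tau>: "\<tau> permutes {1..n + k}"
  shows "TM \<tau> \<in> eqv \<and> corr (TM \<tau>) (T.pop (inv \<tau>))"
proof -
  obtain H where "H \<in> eqv" "corr H (T.pop (inv \<tau>))"
    using ex_corr_left[OF T.pop_End_GL[OF permutes_inv[OF \<tau>]]] by blast
  then have "\<exists>!H. H \<in> eqv \<and> corr H (T.pop (inv \<tau>))" using corr_unique_left by blast
  then show ?thesis unfolding T_map_def by (rule theI')
qed

theorem span_T_maps:
  "H.span {TM \<tau> | \<tau>. \<tau> permutes {1..n + k}} = eqv"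
proof
  show "H.span {TM \<tau> | \<tau>. \<tau> permutes {1..n + k}} \<subseteq> eqv"
    by (rule H.span_minimal[OF _ eqv_subspace]) (use T_map_eqv_corr in blast)
  show "eqv \<subseteq> H.span {TM \<tau> | \<tau>. \<tau> permutes {1..n + k}}"
  proof
    fix H assume H: "H \<in> eqv"
    obtain \<alpha> where \<alpha>: "corr_map H = (\<Sum>\<sigma> | \<sigma> permutes {1..n + k}. fun_scale sT (\<alpha> \<sigma>) (T.pop (inv \<sigma>)))"
      using T.End_GL_spanned_by_permutations[OF corr_map(1)[OF H]] by blast
    \<comment> \<open>The coefficients found for the operator are transported back unchanged:
      \<open>?H'\<close> and \<open>H\<close> correspond to the same operator and must
      coincide.\<close>
    let ?H' = "\<Sum>\<sigma> | \<sigma> permutes {1..n + k}. fun_scale (fun_scale sS) (\<alpha> \<sigma>) (TM \<sigma>)"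
    have "corr ?H' (corr_map H)"
      unfolding \<alpha>
    proof (rule corr_sum)
      fix \<sigma> assume "\<sigma> \<in> {\<sigma>. \<sigma> permutes {1..n + k}}"
      then have \<sigma>: "\<sigma> permutes {1..n + k}" by simp
      note TM = conjunct1[OF T_map_eqv_corr[OF \<sigma>]] conjunct2[OF T_map_eqv_corr[OF \<sigma>]]
      note pop = T.pop_lin[OF permutes_inv[OF \<sigma>]]
      show "fun_scale (fun_scale sS) (\<alpha> \<sigma>) (TM \<sigma>) \<in> eqv \<and> fun_scale sT (\<alpha> \<sigma>) (T.pop (inv \<sigma>)) \<in> lin_End sT \<and>
          corr (fun_scale (fun_scale sS) (\<alpha> \<sigma>) (TM \<sigma>)) (fun_scale sT (\<alpha> \<sigma>) (T.pop (inv \<sigma>)))"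
        by (intro conjI H.subspace_scale[OF eqv_subspace] T.lin_T_scale corr_scale TM pop)
    qed
    moreover have "?H' \<in> eqv"
    proof (rule H.subspace_sum[OF eqv_subspace])
      fix \<sigma> assume "\<sigma> \<in> {\<sigma>. \<sigma> permutes {1..n + k}}"
      then show "fun_scale (fun_scale sS) (\<alpha> \<sigma>) (TM \<sigma>) \<in> eqv"
        using T_map_eqv_corr by (intro H.subspace_scale[OF eqv_subspace]) simp
    qed
    ultimately have "H = ?H'" using corr_unique_left[OF H] corr_map(2)[OF H] by blast
    also have "\<dots> \<in> H.span {TM \<tau> | \<tau>. \<tau> permutes {1..n + k}}"
      by (intro H.span_sum H.span_scale H.span_base) auto
    finally show "H \<in> H.span {TM \<tau> | \<tau>. \<tau> permutes {1..n + k}}" .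
  qed
qed

end

section \<open>Splitting a permutation along first returns\<close>

locale first_return =
  fixes \<tau> :: "'i \<Rightarrow> 'i" and A B :: "'i set"
  assumes perm: "\<tau> permutes A \<union> B" and finA: "finite A" and finB: "finite B" and disj: "A \<inter> B = {}"
begin

text \<open>The first return time to \<open>A\<close>. Strict positivity excludes the start, so a
  fixed point in \<open>A\<close> has return time one.\<close>

definition ret :: "'i \<Rightarrow> nat" where
  "ret a = (LEAST q. 0 < q \<and> (\<tau> ^^ q) a \<in> A)"

definition frt :: "'i \<Rightarrow> 'i" where
  "frt a = (if a \<in> A then (\<tau> ^^ ret a) a else a)"

text \<open>The part of \<tau> formed by the cycles inside \<open>B\<close>, which is the prescribed
  \<open>\<tau>2\<close>.\<close>

definition pure :: "'i \<Rightarrow> 'i" where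
  "pure i = (if orbit \<tau> i \<subseteq> B then \<tau> i else i)"

lemma permutation: "permutation \<tau>"
  using perm finA finB permutation_permutes by blast

lemma inj_pow: "(\<tau> ^^ q) x = (\<tau> ^^ q) y \<longleftrightarrow> x = y"
  using inj_fn[OF permutes_inj[OF perm], of q] by (simp add: inj_eq)

lemma pow_in: "x \<in> A \<union> B \<Longrightarrow> (\<tau> ^^ q) x \<in> A \<union> B"
  by (induction q) (simp_all only: funpow.simps id_apply comp_apply permutes_in_image[OF perm])

lemma ret:
  assumes "a \<in> A"
  shows "0 < ret a" "(\<tau> ^^ ret a) a \<in> A"
proof -
  have "0 < least_power \<tau> a \<and> (\<tau> ^^ least_power \<tau> a) a \<in> A"
    using least_power_of_permutation[OF permutation, of a] assms by simp
  then have "0 < ret a \<and> (\<tau> ^^ ret a) a \<in> A" unfolding ret_def by (rule LeastI)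
  then show "0 < ret a" "(\<tau> ^^ ret a) a \<in> A" by auto
qed

lemma before_ret: "0 < q \<Longrightarrow> q < ret a \<Longrightarrow> (\<tau> ^^ q) a \<notin> A"
  unfolding ret_def using not_less_Least by blast

lemma before_ret_B: "a \<in> A \<Longrightarrow> 0 < q \<Longrightarrow> q < ret a \<Longrightarrow> (\<tau> ^^ q) a \<in> B"
  using before_ret[of q a] pow_in[of a q] by blast

text \<open>Undoing \<open>s\<close> steps on both sides puts \<open>a\<close> on the trajectory of
  \<open>a'\<close> at a time before the return; since \<open>a\<close> lies in \<open>A\<close>,
  that time must be zero.\<close>

lemma ret_inj_le:
  assumes "a \<in> A" and le: "s \<le> s'" and d: "s' - s < ret a'" and eq: "(\<tau> ^^ s) a = (\<tau> ^^ s') a'"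
  shows "a = a' \<and> s = s'"
proof -
  have "(\<tau> ^^ s) a = (\<tau> ^^ s) ((\<tau> ^^ (s' - s)) a')"
    using eq le by (simp add: funpow_add[symmetric, unfolded comp_def fun_eq_iff, rule_format])
  then have a: "a = (\<tau> ^^ (s' - s)) a'" by (simp only: inj_pow)
  then have "s' - s = 0" using before_ret[of "s' - s" a'] d assms(1) by (cases "s' - s = 0") auto
  then show ?thesis using a le by simp
qed

lemma ret_inj:
  assumes "a \<in> A" "a' \<in> A" "s < ret a" "s' < ret a'" "(\<tau> ^^ s) a = (\<tau> ^^ s') a'"
  shows "a = a' \<and> s = s'"
proof (cases "s \<le> s'")
  case True
  then show ?thesis using assms by (intro ret_inj_le) auto
next
  case False
  then have "a' = a \<and> s' = s" using assms by (intro ret_inj_le) auto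
  then show ?thesis by simp
qed

lemma orbit_pow: "(\<tau> ^^ q) x \<in> orbit \<tau> x"
  by (auto simp: orbit_altdef_permutation[OF permutation])

lemma orbit_eq: "y \<in> orbit \<tau> x \<Longrightarrow> orbit \<tau> y = orbit \<tau> x"
  by (rule orbit_cyclic_eq3[OF cyclic_on_orbit'[OF permutation]])

lemma frt_permutes: "frt permutes A"
proof (rule bij_imp_permutes)
  have inj: "inj_on frt A"
  proof (rule inj_onI)
    fix a a' assume a: "a \<in> A" "a' \<in> A" and eq: "frt a = frt a'"
    show "a = a'"
    proof (cases "ret a \<le> ret a'")
      \<comment> \<open>Both return times are positive, so their difference stays below
        \<open>ret a'\<close> as \<open>ret_inj_le\<close> requires.\<close>
      case True
      then show ?thesis using ret_inj_le[of a "ret a" "ret a'" a'] a eq ret(1)[OF a(1)] ret(1)[OF a(2)]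
        by (simp add: frt_def)
    next
      case False
      then show ?thesis using ret_inj_le[of a' "ret a'" "ret a" a] a eq ret(1)[OF a(1)] ret(1)[OF a(2)]
        by (simp add: frt_def)
    qed
  qed
  moreover have "frt ` A \<subseteq> A" by (auto simp: frt_def ret)
  ultimately show "bij_betw frt A A" using finA by (simp add: bij_betw_def endo_inj_surj)
qed (simp add: frt_def)

lemma pure_B: "orbit \<tau> i \<subseteq> B \<Longrightarrow> i \<in> B"
  using permutation_self_in_orbit[OF permutation] by auto

lemma pure_permutes: "pure permutes B"
proof (rule bij_imp_permutes)
  have orb: "orbit \<tau> (\<tau> i) = orbit \<tau> i" for i by (rule permutation_orbit_step[OF permutation])
  have "inj_on pure B"
  proof (rule inj_onI)
    fix i j assume "pure i = pure j"
    then show "i = j"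
      using orb[of i] orb[of j] inj_eq[OF permutes_inj[OF perm]]
      by (auto simp: pure_def split: if_splits)
  qed
  moreover have "pure ` B \<subseteq> B"
    using orb pure_B by (auto simp: pure_def split: if_splits)
  ultimately show "bij_betw pure B B" using finB by (simp add: bij_betw_def endo_inj_surj)
qed (use pure_B in \<open>auto simp: pure_def\<close>)

text \<open>Going back from \<open>b\<close> to the latest visit of \<open>A\<close>: the shortest
  way to write \<open>b\<close> as an iterate of a point of \<open>A\<close> cannot run past a
  return, because the return point would give a shorter one.\<close>

lemma reach:
  assumes b: "b \<in> B" and np: "\<not> orbit \<tau> b \<subseteq> B"
  obtains a s where "a \<in> A" "0 < s" "s < ret a" "b = (\<tau> ^^ s) a"
proof -
  obtain c where c: "c \<in> orbit \<tau> b" "c \<notin> B" using np by blast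
  have "orbit \<tau> b \<subseteq> A \<union> B" by (rule permutes_orbit_subset[OF perm]) (use b in simp)
  then have cA: "c \<in> A" using c by blast
  have "b \<in> orbit \<tau> c" using orbit_eq[OF c(1)] permutation_self_in_orbit[OF permutation] by simp
  then obtain q where "b = (\<tau> ^^ q) c" by (auto simp: orbit_altdef_permutation[OF permutation])
  then have ex: "\<exists>q. \<exists>a\<in>A. b = (\<tau> ^^ q) a" using cA by blast
  define s where "s = (LEAST q. \<exists>a\<in>A. b = (\<tau> ^^ q) a)"
  have "\<exists>a\<in>A. b = (\<tau> ^^ s) a" unfolding s_def using ex by (rule LeastI_ex)
  then obtain a where a: "a \<in> A" "b = (\<tau> ^^ s) a" by blast
  have "s < ret a"
  proof (rule ccontr)
    assume "\<not> s < ret a"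
    then have "b = (\<tau> ^^ (s - ret a)) ((\<tau> ^^ ret a) a)"
      using a by (simp add: funpow_add[symmetric, unfolded comp_def fun_eq_iff, rule_format])
    then have "\<exists>c\<in>A. b = (\<tau> ^^ (s - ret a)) c"
      using ret(2)[OF a(1)] by (intro bexI[where x = "(\<tau> ^^ ret a) a"])
    then have "s \<le> s - ret a" unfolding s_def by (rule Least_le)
    then show False using ret(1)[OF a(1)] \<open>\<not> s < ret a\<close> by simp
  qed
  moreover have "0 < s" using a b disj by (cases s) auto
  ultimately show ?thesis using that a by blast
qed

end

text \<open>
  Weaker than \<open>cycle_splitting\<close>, so that the consequences serve both existence and uniqueness.
\<close>

locale splitting = first_return +
  fixes \<tau>1 \<tau>3
  assumes \<tau>1: "\<tau>1 permutes A \<union> B" and \<tau>3: "\<tau>3 permutes A" and decomp: "\<tau> = \<tau>1 \<circ> pure \<circ> \<tau>3"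
begin

lemma \<tau>_A: "a \<in> A \<Longrightarrow> \<tau> a = \<tau>1 (\<tau>3 a)"
  using decomp permutes_in_image[OF \<tau>3, of a] permutes_not_in[OF pure_permutes, of "\<tau>3 a"] disj
  by (metis comp_apply disjoint_iff)

lemma \<tau>_B: "b \<in> B \<Longrightarrow> \<tau> b = \<tau>1 (pure b)"
  using decomp permutes_not_in[OF \<tau>3, of b] disj by (metis comp_apply disjoint_iff)

lemma \<tau>1_pure:
  assumes "orbit \<tau> b \<subseteq> B"
  shows "\<tau>1 b = b"
proof -
  obtain c where c: "b = \<tau> c" using permutes_surj[OF perm] by (metis surj_def)
  have "orbit \<tau> c \<subseteq> B" using assms permutation_orbit_step[OF permutation, of c] by (simp add: c)
  then show ?thesis using \<tau>_B[OF pure_B] by (simp add: pure_def c)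
qed

lemma \<tau>1_not_pure: "b \<in> B \<Longrightarrow> \<not> orbit \<tau> b \<subseteq> B \<Longrightarrow> \<tau>1 b = \<tau> b"
  using \<tau>_B[of b] by (simp add: pure_def)

lemma permutation1: "permutation \<tau>1"
  using \<tau>1 finA finB permutation_permutes by blast

text \<open>The first step of \<open>\<tau>1\<close> from \<open>\<tau>3 a\<close> leads to
  \<open>\<tau> a\<close>. Until the return, the trajectory then stays at points of \<open>B\<close>
  on a cycle meeting \<open>A\<close>, where \<open>\<tau>1\<close> and \<tau> agree. So
  \<open>\<tau>3 a\<close> takes the place of \<open>a\<close> as head of the segment.\<close>

lemma pow_\<tau>1:
  assumes a: "a \<in> A" and "0 < q" "q \<le> ret a"
  shows "(\<tau>1 ^^ q) (\<tau>3 a) = (\<tau> ^^ q) a"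
  using assms(2,3)
proof (induction q)
  case (Suc q)
  show ?case
  proof (cases "q = 0")
    case True
    then show ?thesis using \<tau>_A[OF a] by simp
  next
    case False
    have "orbit \<tau> ((\<tau> ^^ q) a) = orbit \<tau> a" by (rule orbit_eq[OF orbit_pow])
    then have "\<not> orbit \<tau> ((\<tau> ^^ q) a) \<subseteq> B"
      using permutation_self_in_orbit[OF permutation, of a] a disj by auto
    then have "\<tau>1 ((\<tau> ^^ q) a) = \<tau> ((\<tau> ^^ q) a)"
      using False Suc.prems before_ret_B[OF a] by (intro \<tau>1_not_pure) auto
    then show ?thesis using Suc False by simp
  qed
qed simp

text \<open>Taking \<open>frt\<close> for \<open>\<tau>3\<close> closes each segment: the
  \<open>\<tau>1\<close>-trajectory of \<open>frt a\<close> is back at its head after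
  \<open>ret a\<close> steps, with no other visit to \<open>A\<close>. Every point moved by
  \<open>\<tau>1\<close> lies on such a closed segment.\<close>

lemma frt_imp_unique_A:
  assumes "\<tau>3 = frt" and i: "\<tau>1 i \<noteq> i"
  shows "\<exists>!a. a \<in> orbit \<tau>1 i \<and> a \<in> A"
proof -
  have orb: "orbit \<tau>1 (frt a) \<inter> A = {frt a}" if a: "a \<in> A" for a
  proof -
    have "(\<tau>1 ^^ ret a) (frt a) = frt a"
      using pow_\<tau>1[OF a ret(1)[OF a]] assms(1) a by (simp add: frt_def)
    then have orb: "orbit \<tau>1 (frt a) = {(\<tau>1 ^^ q) (frt a) | q. q < ret a}"
      using ret(1)[OF a] by (rule orbit_altdef_bounded)
    have notin: "(\<tau>1 ^^ q) (frt a) \<notin> A" if "0 < q" "q < ret a" for q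
      using pow_\<tau>1[OF a that(1)] before_ret[OF that] that assms(1) by simp
    have "x = frt a" if x: "x \<in> orbit \<tau>1 (frt a)" "x \<in> A" for x
    proof -
      obtain q where q: "x = (\<tau>1 ^^ q) (frt a)" "q < ret a" using x(1) orb by auto
      show ?thesis using q notin[of q] x(2) by (cases "q = 0") auto
    qed
    moreover have "frt a \<in> A" using a ret(2)[OF a] by (simp add: frt_def)
    ultimately show ?thesis using permutation_self_in_orbit[OF permutation1, of "frt a"] by blast
  qed
  have "i \<in> A \<union> B" using i permutes_not_in[OF \<tau>1] by blast
  then obtain a where a: "a \<in> A" and "i \<in> orbit \<tau>1 (frt a)"
  proof
    assume "i \<in> A"
    then obtain a where "a \<in> A" "i = frt a" using permutes_image[OF frt_permutes] by blast
    then show ?thesis using that permutation_self_in_orbit[OF permutation1] by blast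
  next
    assume "i \<in> B"
    moreover have "\<not> orbit \<tau> i \<subseteq> B" using i \<tau>1_pure by blast
    ultimately obtain a s where a: "a \<in> A" and s: "0 < s" "s < ret a" "i = (\<tau> ^^ s) a"
      by (rule reach)
    then have "i = (\<tau>1 ^^ s) (frt a)" using pow_\<tau>1[OF a s(1)] assms(1) by simp
    then show ?thesis using that[OF a] by (auto simp: orbit_altdef_permutation[OF permutation1])
  qed
  then have "orbit \<tau>1 i = orbit \<tau>1 (frt a)"
    by (intro orbit_cyclic_eq3[OF cyclic_on_orbit'[OF permutation1]])
  then show ?thesis using orb[OF a] by (intro ex1I[of _ "frt a"]) auto
qed

text \<open>The \<open>\<tau>1\<close>-cycle through \<open>\<tau>3 a\<close> also contains the
  first return of \<open>a\<close>. Both points lie in \<open>A\<close>, so uniqueness identifies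
  them; the cycle closes after \<open>ret a\<close> steps, and no earlier because it would then meet
  \<open>A\<close> before the return.\<close>

lemma unique_A_imp_least_power:
  assumes uniq: "\<And>i. \<tau>1 i \<noteq> i \<Longrightarrow> \<exists>!a. a \<in> orbit \<tau>1 i \<and> a \<in> A" and a: "a \<in> A"
  shows "\<tau>3 a = frt a" "least_power \<tau>1 (\<tau>3 a) = ret a"
proof -
  let ?x = "\<tau>3 a"
  have x: "?x \<in> A" using a permutes_in_image[OF \<tau>3] by simp
  have r: "(\<tau>1 ^^ ret a) ?x \<in> A" using pow_\<tau>1[OF a ret(1)[OF a]] ret(2)[OF a] by simp
  have eq: "(\<tau>1 ^^ ret a) ?x = ?x"
  proof (cases "\<tau>1 ?x = ?x")
    case True
    have "(\<tau>1 ^^ q) ?x = ?x" for q by (induction q) (simp_all add: True)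
    then show ?thesis .
  next
    case False
    have "(\<tau>1 ^^ ret a) ?x \<in> orbit \<tau>1 ?x" "?x \<in> orbit \<tau>1 ?x"
      by (auto simp: orbit_altdef_permutation[OF permutation1] intro: exI[of _ 0])
    then show ?thesis using uniq[OF False] r x by blast
  qed
  then show "\<tau>3 a = frt a" using pow_\<tau>1[OF a ret(1)[OF a]] a by (simp add: frt_def)
  have "least_power \<tau>1 ?x \<le> ret a" by (rule least_power_le[OF eq ret(1)[OF a]])
  moreover have "\<not> least_power \<tau>1 ?x < ret a"
  proof
    assume less: "least_power \<tau>1 ?x < ret a"
    note lp = least_power_of_permutation[OF permutation1, of ?x]
    have "(\<tau> ^^ least_power \<tau>1 ?x) a = ?x" using pow_\<tau>1[OF a lp(2)] lp(1) less by simp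
    then show False using before_ret[OF lp(2) less] x by simp
  qed
  ultimately show "least_power \<tau>1 ?x = ret a" by simp
qed

end

section \<open>Existence and uniqueness of the cycle splitting\<close>

lemma atLeastAtMost_split: "{1..n + k} = {1..n} \<union> {n + 1..n + k :: nat}"
  by auto

lemma first_return_interval:
  assumes "\<tau> permutes {1..n + k :: nat}"
  shows "first_return \<tau> {1..n} {n + 1..n + k}"
  using assms unfolding atLeastAtMost_split by unfold_locales auto

lemma cycle_splittingD:
  assumes \<tau>: "\<tau> permutes {1..n + k}" and sp: "cycle_splitting n k \<tau> \<tau>1 \<tau>2 \<tau>3"
  shows "splitting \<tau> {1..n} {n + 1..n + k} \<tau>1 \<tau>3"
    and "\<tau>2 = first_return.pure \<tau> {n + 1..n + k}"
    and "\<tau>3 = first_return.frt \<tau> {1..n}"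
    and "a \<in> {1..n} \<Longrightarrow> least_power \<tau>1 (\<tau>3 a) = first_return.ret \<tau> {1..n} a"
proof -
  interpret first_return \<tau> "{1..n}" "{n + 1..n + k}" by (rule first_return_interval[OF \<tau>])
  show pure: "\<tau>2 = pure"
    using sp unfolding cycle_splitting_def pure_def by blast
  show s: "splitting \<tau> {1..n} {n + 1..n + k} \<tau>1 \<tau>3"
  proof unfold_locales
    show "\<tau>1 permutes {1..n} \<union> {n + 1..n + k}"
      using sp unfolding cycle_splitting_def atLeastAtMost_split[symmetric] by blast
    show "\<tau>3 permutes {1..n}" "\<tau> = \<tau>1 \<circ> pure \<circ> \<tau>3"
      using sp unfolding pure[symmetric] cycle_splitting_def by blast+
  qed
  interpret splitting \<tau> "{1..n}" "{n + 1..n + k}" \<tau>1 \<tau>3 by (rule s)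
  have uniq: "\<exists>!a. a \<in> orbit \<tau>1 i \<and> a \<in> {1..n}" if "\<tau>1 i \<noteq> i" for i
    using sp that unfolding cycle_splitting_def by blast
  show "\<tau>3 = frt"
  proof
    fix i show "\<tau>3 i = frt i"
      using unique_A_imp_least_power(1)[OF uniq] permutes_not_in[OF \<tau>3, of i] by (cases "i \<in> {1..n}") (auto simp: frt_def)
  qed
  show "a \<in> {1..n} \<Longrightarrow> least_power \<tau>1 (\<tau>3 a) = ret a"
    by (rule unique_A_imp_least_power(2)[OF uniq])
qed

theorem cycle_splitting_unique:
  assumes \<tau>: "\<tau> permutes {1..n + k}"
  shows "\<exists>!(\<tau>1, \<tau>2, \<tau>3). cycle_splitting n k \<tau> \<tau>1 \<tau>2 \<tau>3"
proof -
  interpret first_return \<tau> "{1..n}" "{n + 1..n + k}" by (rule first_return_interval[OF \<tau>])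
  \<comment> \<open>The only candidate, since the other two factors have to be \<open>pure\<close>
    and \<open>frt\<close>.\<close>
  define \<tau>1 where "\<tau>1 = \<tau> \<circ> inv frt \<circ> inv pure"
  have frtJ: "frt permutes {1..n + k}" and pureJ: "pure permutes {1..n + k}"
    by (rule permutes_subset[OF frt_permutes], auto) (rule permutes_subset[OF pure_permutes], auto)
  have \<tau>1J: "\<tau>1 permutes {1..n + k}"
    unfolding \<tau>1_def by (intro permutes_compose permutes_inv frtJ pureJ \<tau>)
  have dec: "\<tau> = \<tau>1 \<circ> pure \<circ> frt"
    unfolding \<tau>1_def comp_assoc permutes_inv_o[OF pureJ]
    by (simp only: comp_assoc[symmetric] permutes_inv_o[OF pureJ] comp_id)
      (simp only: comp_assoc permutes_inv_o[OF frtJ] permutes_inv_o[OF pureJ] id_comp comp_id)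
  interpret splitting \<tau> "{1..n}" "{n + 1..n + k}" \<tau>1 frt
    using \<tau>1J dec frt_permutes unfolding atLeastAtMost_split by unfold_locales
  have ex: "cycle_splitting n k \<tau> \<tau>1 pure frt"
    unfolding cycle_splitting_def
  proof (intro conjI allI impI)
    show "pure = (\<lambda>i. if orbit \<tau> i \<subseteq> {n + 1..n + k} then \<tau> i else i)"
      by (rule ext) (rule pure_def)
  qed (fact \<tau>1J pure_permutes frt_permutes dec frt_imp_unique_A[OF refl])+
  show ?thesis
  proof (rule ex1I[of _ "(\<tau>1, pure, frt)"])
    fix t assume "case t of (t1, t2, t3) \<Rightarrow> cycle_splitting n k \<tau> t1 t2 t3"
    then obtain t1 t2 t3 where t: "t = (t1, t2, t3)" and sp: "cycle_splitting n k \<tau> t1 t2 t3"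
      by (cases t) auto
    note D = cycle_splittingD[OF \<tau> sp]
    have "\<tau> = t1 \<circ> t2 \<circ> t3" using sp unfolding cycle_splitting_def by blast
    then have "t1 \<circ> (pure \<circ> frt) = \<tau>" by (simp only: D(2,3) comp_assoc)
    also have "\<tau> = \<tau>1 \<circ> (pure \<circ> frt)" by (subst dec) (rule comp_assoc)
    finally have "t1 \<circ> (pure \<circ> frt) = \<tau>1 \<circ> (pure \<circ> frt)" .
    then have "t1 \<circ> (pure \<circ> frt) \<circ> inv (pure \<circ> frt) = \<tau>1 \<circ> (pure \<circ> frt) \<circ> inv (pure \<circ> frt)"
      by simp
    then have "t1 = \<tau>1"
      by (simp only: comp_assoc[of _ "pure \<circ> frt"] permutes_inv_o[OF permutes_compose[OF frtJ pureJ]] comp_id)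
    then show "t = (\<tau>1, pure, frt)" using D(2,3) t by simp
  qed (use ex in simp)
qed

section \<open>Traces of permuted tensor products\<close>

lemma sum_PiE_Un:
  assumes "S \<inter> R = {}"
  shows "(\<Sum>w \<in> (S \<union> R) \<rightarrow>\<^sub>E X. G w) =
    (\<Sum>u \<in> S \<rightarrow>\<^sub>E X. \<Sum>v \<in> R \<rightarrow>\<^sub>E X. G (override_on v u S))"
  unfolding sum.cartesian_product
proof (rule sum.reindex_bij_witness[where i = "\<lambda>(u, v). override_on v u S"
      and j = "\<lambda>w. (restrict w S, restrict w R)"])
  fix w assume "w \<in> (S \<union> R) \<rightarrow>\<^sub>E X"
  then show w: "(case (restrict w S, restrict w R) of (u, v) \<Rightarrow> override_on v u S) = w"
    by (auto simp: override_on_def fun_eq_iff PiE_iff extensional_def)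
  show "(case (restrict w S, restrict w R) of (u, v) \<Rightarrow> G (override_on v u S)) = G w"
    using w by simp
qed (use assms in \<open>auto simp: override_on_def fun_eq_iff PiE_iff extensional_def\<close>)

text \<open>Distributivity: factors that read disjoint sets of letters can be summed
  separately.\<close>

lemma sum_PiE_UNION:
  fixes F :: "'c \<Rightarrow> ('i \<Rightarrow> 'b) \<Rightarrow> 'a::comm_semiring_1"
  assumes "finite K"
    and "\<And>c c'. c \<in> K \<Longrightarrow> c' \<in> K \<Longrightarrow> c \<noteq> c' \<Longrightarrow> S c \<inter> S c' = {}"
    and "\<And>c v w. c \<in> K \<Longrightarrow> (\<And>i. i \<in> S c \<Longrightarrow> v i = w i) \<Longrightarrow> F c v = F c w"
  shows "(\<Sum>w \<in> (\<Union>c\<in>K. S c) \<rightarrow>\<^sub>E X. \<Prod>c\<in>K. F c w) = (\<Prod>c\<in>K. \<Sum>w \<in> S c \<rightarrow>\<^sub>E X. F c w)"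
  using assms
proof (induction K rule: finite_induct)
  case (insert c K)
  have disj: "S c \<inter> (\<Union>c\<in>K. S c) = {}" using insert.hyps insert.prems(1) by fastforce
  have "(\<Sum>w \<in> (\<Union>c\<in>insert c K. S c) \<rightarrow>\<^sub>E X. \<Prod>c\<in>insert c K. F c w) =
      (\<Sum>u \<in> S c \<rightarrow>\<^sub>E X. \<Sum>v \<in> (\<Union>c\<in>K. S c) \<rightarrow>\<^sub>E X. \<Prod>c'\<in>insert c K. F c' (override_on v u (S c)))"
    unfolding UN_insert by (rule sum_PiE_Un[OF disj])
  also have "\<dots> = (\<Sum>u \<in> S c \<rightarrow>\<^sub>E X. \<Sum>v \<in> (\<Union>c\<in>K. S c) \<rightarrow>\<^sub>E X. F c u * (\<Prod>c'\<in>K. F c' v))"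
  proof (intro sum.cong refl)
    fix u v
    have "F c (override_on v u (S c)) = F c u"
      by (rule insert.prems(2)) (auto simp: override_on_def)
    moreover have "F c' (override_on v u (S c)) = F c' v" if "c' \<in> K" for c'
      by (rule insert.prems(2)) (use that disj in \<open>auto simp: override_on_def\<close>)
    ultimately show "(\<Prod>c'\<in>insert c K. F c' (override_on v u (S c))) = F c u * (\<Prod>c'\<in>K. F c' v)"
      using insert.hyps by simp
  qed
  also have "\<dots> = (\<Sum>u \<in> S c \<rightarrow>\<^sub>E X. F c u) * (\<Sum>v \<in> (\<Union>c\<in>K. S c) \<rightarrow>\<^sub>E X. \<Prod>c'\<in>K. F c' v)"
    by (simp add: sum_product)
  also have "(\<Sum>v \<in> (\<Union>c\<in>K. S c) \<rightarrow>\<^sub>E X. \<Prod>c'\<in>K. F c' v) = (\<Prod>c\<in>K. \<Sum>w \<in> S c \<rightarrow>\<^sub>E X. F c w)"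
  proof (rule insert.IH)
    show "S a \<inter> S b = {}" if "a \<in> K" "b \<in> K" "a \<noteq> b" for a b
      using insert.prems(1) that by simp
    show "F a v = F a w" if "a \<in> K" "\<And>i. i \<in> S a \<Longrightarrow> v i = w i" for a v w
      by (rule insert.prems(2)) (use that in simp_all)
  qed
  finally show ?case using insert.hyps by simp
qed simp

lemma sum_PiE_insert:
  assumes "j \<notin> S"
  shows "(\<Sum>w \<in> insert j S \<rightarrow>\<^sub>E X. G w) = (\<Sum>y\<in>X. \<Sum>w \<in> S \<rightarrow>\<^sub>E X. G (w(j := y)))"
  unfolding PiE_insert_eq sum.cartesian_product
  by (subst sum.reindex) (use assms in \<open>auto intro!: inj_combinator sum.cong\<close>)

text \<open>A product of matrix entries along consecutive positions, starting from the letter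
  \<open>x\<close>. The end weight \<open>e\<close> stays open so that one expression serves both
  segments that end at a fixed letter in \<open>A\<close> and cycles that close at their
  head.\<close>

fun path_prod :: "('i \<Rightarrow> 'b \<Rightarrow> 'b \<Rightarrow> 'a) \<Rightarrow> ('i \<Rightarrow> 'b) \<Rightarrow> ('b \<Rightarrow> 'a) \<Rightarrow> 'b \<Rightarrow> 'i list \<Rightarrow> 'a::comm_semiring_1" where
  "path_prod Z w e x [] = e x"
| "path_prod Z w e x (j # js) = Z j x (w j) * path_prod Z w e (w j) js"

lemma path_prod_cong:
  "(\<And>j. j \<in> set js \<Longrightarrow> v j = w j) \<Longrightarrow> path_prod Z v e x js = path_prod Z w e x js"
  by (induction js arbitrary: x) simp_all

text \<open>The list holds the positions strictly between \<open>f s\<close> and \<open>f p\<close>;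
  the last transition, into \<open>f p\<close>, becomes the end weight.\<close>

lemma prod_eq_path_prod:
  assumes "s < p"
  shows "(\<Prod>q\<in>{s..<p}. Z (f (Suc q)) (w (f q)) (w (f (Suc q)))) =
    path_prod Z w (\<lambda>b. Z (f p) b (w (f p))) (w (f s)) (map f [Suc s..<p])"
  using assms
proof (induction s rule: strict_inc_induct)
  case (step s)
  then have "[Suc s..<p] = Suc s # [Suc (Suc s)..<p]" by (simp add: upt_conv_Cons)
  moreover have "{s..<p} = insert s {Suc s..<p}" using step by auto
  ultimately show ?case using step.IH by simp
qed simp

definition comp_list :: "('i \<Rightarrow> 'v \<Rightarrow> 'v) \<Rightarrow> 'i list \<Rightarrow> 'v \<Rightarrow> 'v" where
  "comp_list z js = foldr (\<lambda>j f. z j \<circ> f) js id"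

lemma comp_list_simps: "comp_list z [] = id" "comp_list z (j # js) = z j \<circ> comp_list z js"
  by (simp_all add: comp_list_def)

context fd_rat_space
begin

lemma comp_list_lin: "(\<And>j. j \<in> set js \<Longrightarrow> z j \<in> lin_End s) \<Longrightarrow> comp_list z js \<in> lin_End s"
proof (induction js)
  case (Cons j js)
  then show ?case unfolding comp_list_simps by (intro lin_comp) auto
qed (simp add: comp_list_simps lin_id)

text \<open>Summing over the letter shared by two consecutive entries is a matrix product, so the
  whole segment contracts to the entries of one composite.\<close>

lemma sum_path_prod:
  assumes "distinct js" "\<And>j. j \<in> set js \<Longrightarrow> z j \<in> lin_End s" "x \<in> B"
  shows "(\<Sum>w \<in> set js \<rightarrow>\<^sub>E B. path_prod (\<lambda>j. mat (z j)) w e x js) =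
    (\<Sum>b\<in>B. mat (comp_list z js) x b * e b)"
  using assms
proof (induction js arbitrary: x)
  case Nil
  have "(\<Sum>b\<in>B. mat id x b * e b) = (\<Sum>b\<in>B. e b * of_bool (b = x))"
    by (rule sum.cong[OF refl]) (auto simp: mat_id)
  also have "\<dots> = e x" by (rule sum_mult_of_bool_eq[OF finite_Basis Nil.prems(3)])
  finally show ?case by (simp add: comp_list_simps id_def)
next
  case (Cons j js)
  have "(\<Sum>w \<in> set (j # js) \<rightarrow>\<^sub>E B. path_prod (\<lambda>j. mat (z j)) w e x (j # js)) =
      (\<Sum>y\<in>B. \<Sum>w \<in> set js \<rightarrow>\<^sub>E B. mat (z j) x y * path_prod (\<lambda>j. mat (z j)) w e y js)"
    unfolding list.set(2)
  proof (subst sum_PiE_insert)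
    show "j \<notin> set js" using Cons.prems(1) by simp
    then have "path_prod (\<lambda>j. mat (z j)) (w(j := y)) e y js = path_prod (\<lambda>j. mat (z j)) w e y js" for w y
      by (intro path_prod_cong) auto
    then show "(\<Sum>y\<in>B. \<Sum>w \<in> set js \<rightarrow>\<^sub>E B. path_prod (\<lambda>j. mat (z j)) (w(j := y)) e x (j # js)) =
        (\<Sum>y\<in>B. \<Sum>w \<in> set js \<rightarrow>\<^sub>E B. mat (z j) x y * path_prod (\<lambda>j. mat (z j)) w e y js)"
      by simp
  qed
  also have "\<dots> = (\<Sum>y\<in>B. mat (z j) x y * (\<Sum>b\<in>B. mat (comp_list z js) y b * e b))"
    using Cons by (intro sum.cong refl) (simp add: sum_distrib_left[symmetric])
  also have "\<dots> = (\<Sum>b\<in>B. \<Sum>y\<in>B. mat (z j) x y * mat (comp_list z js) y b * e b)"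
    unfolding sum_distrib_left by (subst sum.swap) (simp add: mult.assoc)
  also have "\<dots> = (\<Sum>b\<in>B. mat (comp_list z (j # js)) x b * e b)"
    using Cons.prems(2) by (simp add: comp_list_simps mat_comp sum_distrib_right)
  finally show ?case .
qed

lemma lin_trace_comm:
  assumes "y \<in> lin_End s" "z \<in> lin_End s"
  shows "lin_trace s (y \<circ> z) = lin_trace s (z \<circ> y)"
  using assms
  by (simp add: lin_trace_mat lin_comp mat_comp mult.commute[of "mat y _ _"]) (rule sum.swap)

text \<open>Fixing the letter at the head \<open>h\<close> leaves an open path. Summing over that
  letter gives a trace with \<open>z h\<close> at the end, which cyclicity moves to the
  front.\<close>

lemma sum_cycle_path_prod:
  assumes "distinct (h # js)" and z: "\<And>j. j \<in> set (h # js) \<Longrightarrow> z j \<in> lin_End s"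
  shows "(\<Sum>w \<in> set (h # js) \<rightarrow>\<^sub>E B. path_prod (\<lambda>j. mat (z j)) w (\<lambda>b. mat (z h) b (w h)) (w h) js) =
    lin_trace s (comp_list z (h # js))"
proof -
  have "(\<Sum>w \<in> set (h # js) \<rightarrow>\<^sub>E B. path_prod (\<lambda>j. mat (z j)) w (\<lambda>b. mat (z h) b (w h)) (w h) js) =
      (\<Sum>y\<in>B. \<Sum>w \<in> set js \<rightarrow>\<^sub>E B. path_prod (\<lambda>j. mat (z j)) w (\<lambda>b. mat (z h) b y) y js)"
    unfolding list.set(2)
  proof (subst sum_PiE_insert)
    show "h \<notin> set js" using assms(1) by simp
    then have "path_prod (\<lambda>j. mat (z j)) (w(h := y)) e y js = path_prod (\<lambda>j. mat (z j)) w e y js" for w y e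
      by (intro path_prod_cong) auto
    then show "(\<Sum>y\<in>B. \<Sum>w \<in> set js \<rightarrow>\<^sub>E B. path_prod (\<lambda>j. mat (z j)) (w(h := y)) (\<lambda>b. mat (z h) b ((w(h := y)) h)) ((w(h := y)) h) js) =
        (\<Sum>y\<in>B. \<Sum>w \<in> set js \<rightarrow>\<^sub>E B. path_prod (\<lambda>j. mat (z j)) w (\<lambda>b. mat (z h) b y) y js)"
      by simp
  qed
  also have "\<dots> = (\<Sum>y\<in>B. \<Sum>b\<in>B. mat (comp_list z js) y b * mat (z h) b y)"
    using assms by (intro sum.cong refl sum_path_prod) auto
  also have "\<dots> = lin_trace s (comp_list z js \<circ> z h)"
    using z by (simp add: lin_trace_mat lin_comp comp_list_lin mat_comp)
  also have "\<dots> = lin_trace s (comp_list z (h # js))"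
    unfolding comp_list_simps using z by (intro lin_trace_comm comp_list_lin) auto
  finally show ?thesis .
qed

text \<open>The transitions from \<open>j\<close> to \<open>\<tau> j\<close> are grouped by the
  place of \<open>j\<close>: in the block of some \<open>a\<close> up to its return, or in a cycle
  inside \<open>Q\<close>. With the letters on \<open>A\<close> held fixed, different groups read
  disjoint sets of letters on \<open>Q\<close>, so the inner sum splits into matrix entries for the
  blocks and traces for the cycles.\<close>

theorem sum_prod_cycles:
  fixes \<tau> :: "nat \<Rightarrow> nat"
  assumes fr: "first_return \<tau> A Q" and z: "\<And>j. j \<in> A \<union> Q \<Longrightarrow> z j \<in> lin_End s"
  shows "(\<Sum>w \<in> (A \<union> Q) \<rightarrow>\<^sub>E B. \<Prod>j\<in>A \<union> Q. mat (z (\<tau> j)) (w j) (w (\<tau> j))) =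
    (\<Prod>C | C \<subseteq> Q \<and> (\<exists>b\<in>Q. C = orbit \<tau> b). lin_trace s (comp_list z (support \<tau> (Min C)))) *
    (\<Sum>u \<in> A \<rightarrow>\<^sub>E B. \<Prod>a\<in>A. mat (comp_list z (map (\<lambda>q. (\<tau> ^^ q) a) [1..<first_return.ret \<tau> A a]) \<circ>
      z (first_return.frt \<tau> A a)) (u a) (u (first_return.frt \<tau> A a)))"
proof -
  interpret first_return \<tau> A Q by (rule fr)
  let ?Z = "\<lambda>j. mat (z j)"
  define Cs where "Cs = {C. C \<subseteq> Q \<and> (\<exists>b\<in>Q. C = orbit \<tau> b)}"
  \<comment> \<open>\<open>block a\<close> includes \<open>a\<close> and indexes the transitions of
    its segment; \<open>path a\<close> drops \<open>a\<close> and keeps the positions whose letters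
    are summed.\<close>
  define path where "path a = map (\<lambda>q. (\<tau> ^^ q) a) [1..<ret a]" for a
  define block where "block a = (\<lambda>q. (\<tau> ^^ q) a) ` {0..<ret a}" for a
  define cyc where "cyc C = map (\<lambda>q. (\<tau> ^^ q) (Min C)) [1..<least_power \<tau> (Min C)]" for C
  have finCs: "finite Cs"
    by (rule finite_subset[of _ "Pow Q"]) (use finB in \<open>auto simp: Cs_def\<close>)
  have finC: "finite C" if "C \<in> Cs" for C
    using that finB finite_subset by (auto simp: Cs_def)
  have lp: "0 < least_power \<tau> x" "(\<tau> ^^ least_power \<tau> x) x = x" for x
    using least_power_of_permutation[OF permutation] by auto
  have minC: "Min C \<in> C" if "C \<in> Cs" for C
    using that finC[OF that] orbit_nonempty[of \<tau>] by (intro Min_in) (auto simp: Cs_def)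
  have orbC: "C = orbit \<tau> x" if C: "C \<in> Cs" and x: "x \<in> C" for C x
  proof -
    obtain b where "C = orbit \<tau> b" using C by (auto simp: Cs_def)
    then show ?thesis using orbit_eq[of x b] x by simp
  qed
  have cyc: "Min C # cyc C = support \<tau> (Min C)" for C
    using lp(1)[of "Min C"] by (simp add: cyc_def upt_conv_Cons One_nat_def)
  have setcyc: "set (Min C # cyc C) = C" if "C \<in> Cs" for C
  proof -
    have "set (Min C # cyc C) = range (\<lambda>q. (\<tau> ^^ q) (Min C))"
      unfolding cyc by (rule support_set[OF permutation])
    also have "\<dots> = orbit \<tau> (Min C)"
      by (simp only: orbit_altdef_permutation[OF permutation]) auto
    also have "\<dots> = C" by (rule orbC[OF that minC[OF that], symmetric])
    finally show ?thesis .
  qed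
  have distcyc: "distinct (Min C # cyc C)" for C
    unfolding cyc by (rule cycle_of_permutation[OF permutation])
  have inj_block: "inj_on (\<lambda>q. (\<tau> ^^ q) a) {0..<ret a}" if "a \<in> A" for a
  proof (rule inj_onI)
    fix q q' assume "q \<in> {0..<ret a}" "q' \<in> {0..<ret a}" "(\<tau> ^^ q) a = (\<tau> ^^ q') a"
    then show "q = q'" using ret_inj[OF that that, of q q'] by simp
  qed
  have block_path: "block a = insert a (set (path a))" if "a \<in> A" for a
  proof -
    have "{0..<ret a} = insert 0 (set [1..<ret a])" using ret(1)[OF that] by auto
    then show ?thesis by (simp add: block_def path_def)
  qed
  have path_Q: "set (path a) \<subseteq> Q" if "a \<in> A" for a
    using before_ret_B[OF that] by (auto simp: path_def)
  have disj_block: "block a \<inter> block a' = {}" if "a \<in> A" "a' \<in> A" "a \<noteq> a'" for a a'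
  proof (rule ccontr)
    assume "block a \<inter> block a' \<noteq> {}"
    then obtain q q' where "q < ret a" "q' < ret a'" "(\<tau> ^^ q) a = (\<tau> ^^ q') a'"
      by (auto simp: block_def)
    then show False using ret_inj[OF that(1,2)] that(3) by blast
  qed
  have disj_bc: "block a \<inter> C = {}" if "a \<in> A" "C \<in> Cs" for a C
  proof (rule ccontr)
    assume "block a \<inter> C \<noteq> {}"
    then obtain q where q: "(\<tau> ^^ q) a \<in> C" by (auto simp: block_def)
    have "orbit \<tau> ((\<tau> ^^ q) a) = orbit \<tau> a" by (rule orbit_eq[OF orbit_pow])
    then have "a \<in> C"
      using orbC[OF that(2) q] permutation_self_in_orbit[OF permutation, of a] by simp
    then show False using that disj by (auto simp: Cs_def)
  qed
  have disj_cc: "C \<inter> C' = {}" if "C \<in> Cs" "C' \<in> Cs" "C \<noteq> C'" for C C'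
    using orbC[OF that(1)] orbC[OF that(2)] that(3) by blast
  have coverb: "b \<in> (\<Union>a\<in>A. set (path a)) \<union> \<Union>Cs" if b: "b \<in> Q" for b
  proof (cases "orbit \<tau> b \<subseteq> Q")
    case True
    then have "orbit \<tau> b \<in> Cs" using b by (auto simp: Cs_def)
    then show ?thesis using permutation_self_in_orbit[OF permutation, of b] by blast
  next
    case False
    then obtain a s where a: "a \<in> A" and s: "0 < s" "s < ret a" "b = (\<tau> ^^ s) a" by (rule reach[OF b])
    have "b \<in> set (path a)" unfolding path_def using s by auto
    then show ?thesis using a by blast
  qed
  have coverQ: "Q = (\<Union>a\<in>A. set (path a)) \<union> \<Union>Cs"
  proof (rule equalityI)
    show "(\<Union>a\<in>A. set (path a)) \<union> \<Union>Cs \<subseteq> Q" using path_Q by (auto simp: Cs_def)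
  qed (use coverb in blast)
  have cover: "A \<union> Q = (\<Union>a\<in>A. block a) \<union> \<Union>Cs" by (subst coverQ) (use block_path in auto)
  \<comment> \<open>A tagged union of blocks and cycles: \<open>S\<close> gives the letters each
    piece sums over, \<open>F\<close> its factor. The last transition of the block of
    \<open>a\<close> enters \<open>A\<close> at \<open>frt a\<close>, whose letter is already fixed
    by \<open>u\<close>.\<close>
  define K where "K = A <+> Cs"
  define S where "S = case_sum (\<lambda>a. set (path a)) (\<lambda>C. C)"
  define F where "F u = case_sum
      (\<lambda>a w. path_prod ?Z w (\<lambda>b. mat (z (frt a)) b (u (frt a))) (u a) (path a))
      (\<lambda>C w. path_prod ?Z w (\<lambda>b. mat (z (Min C)) b (w (Min C))) (w (Min C)) (cyc C))" for u
  have US: "(\<Union>c\<in>K. S c) = Q" by (subst coverQ) (auto simp: K_def S_def)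
  have disjS: "S c \<inter> S c' = {}" if "c \<in> K" "c' \<in> K" "c \<noteq> c'" for c c'
  proof -
    have pp: "set (path a) \<inter> set (path a') = {}" if "a \<in> A" "a' \<in> A" "a \<noteq> a'" for a a'
      using disj_block[OF that] block_path[OF that(1)] block_path[OF that(2)] by auto
    have pc: "set (path a) \<inter> C = {}" "C \<inter> set (path a) = {}" if "a \<in> A" "C \<in> Cs" for a C
      using disj_bc[OF that] block_path[OF that(1)] by auto
    have K: "Inl a \<in> K \<longleftrightarrow> a \<in> A" "Inr C \<in> K \<longleftrightarrow> C \<in> Cs" for a C by (auto simp: K_def)
    show ?thesis
      using that by (cases c; cases c') (simp_all only: K S_def sum.case pp pc disj_cc sum.inject)
  qed
  have cong: "F u c v = F u c w" if "c \<in> K" "\<And>i. i \<in> S c \<Longrightarrow> v i = w i" for u c v w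
  proof (cases c)
    case (Inl a)
    then show ?thesis using that(2) by (simp add: F_def S_def path_prod_cong[of "path a" v w])
  next
    case (Inr C)
    then have C: "C \<in> Cs" using that(1) by (auto simp: K_def)
    have "v j = w j" if "j \<in> C" for j
      using that \<open>\<And>i. i \<in> S c \<Longrightarrow> v i = w i\<close> Inr by (simp add: S_def)
    moreover have "set (cyc C) \<subseteq> C" "Min C \<in> C" using setcyc[OF C] by auto
    ultimately show ?thesis using Inr path_prod_cong[of "cyc C" v w] by (simp add: F_def subset_iff)
  qed
  have split: "(\<Prod>j\<in>A \<union> Q. mat (z (\<tau> j)) (w j) (w (\<tau> j))) = (\<Prod>c\<in>K. F u c v)"
    if w: "w = override_on v u A" for u v w
  proof -
    have wA: "w a = u a" if "a \<in> A" for a using that by (simp add: w)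
    have wQ: "w b = v b" if "b \<in> Q" for b using that disj by (auto simp: w override_on_def)
    let ?g = "\<lambda>j. mat (z (\<tau> j)) (w j) (w (\<tau> j))"
    have blk: "prod ?g (block a) = F u (Inl a) v" if a: "a \<in> A" for a
    proof -
      have "prod ?g (block a) = (\<Prod>q\<in>{0..<ret a}. ?g ((\<tau> ^^ q) a))"
        unfolding block_def by (simp only: prod.reindex[OF inj_block[OF a]] comp_def)
      also have "\<dots> = path_prod ?Z w (\<lambda>b. mat (z (frt a)) b (w (frt a))) (w a) (path a)"
        using prod_eq_path_prod[OF ret(1)[OF a], where Z = ?Z and w = w and f = "\<lambda>q. (\<tau> ^^ q) a"] a
        by (simp add: frt_def path_def One_nat_def)
      also have "\<dots> = path_prod ?Z v (\<lambda>b. mat (z (frt a)) b (w (frt a))) (w a) (path a)"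
        by (rule path_prod_cong) (use path_Q[OF a] wQ in blast)
      finally show ?thesis
        using wA[OF a] wA[of "frt a"] permutes_in_image[OF frt_permutes, of a] a by (simp add: F_def)
    qed
    have cy: "prod ?g C = F u (Inr C) v" if C: "C \<in> Cs" for C
    proof -
      let ?h = "Min C" and ?f = "\<lambda>q. (\<tau> ^^ q) (Min C)"
      have CQ: "C \<subseteq> Q" using C by (auto simp: Cs_def)
      have inj: "inj_on ?f {0..<least_power \<tau> ?h}"
        using distcyc[of C] unfolding cyc by (simp add: distinct_map)
      have "C = ?f ` {0..<least_power \<tau> ?h}"
        using setcyc[OF C] unfolding cyc by simp
      then have "prod ?g C = (\<Prod>q\<in>{0..<least_power \<tau> ?h}. ?g (?f q))"
        using prod.reindex[OF inj, of ?g] by (simp only: comp_def)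
      also have "\<dots> = path_prod ?Z w (\<lambda>b. mat (z ?h) b (w ?h)) (w ?h) (cyc C)"
        using prod_eq_path_prod[OF lp(1), where Z = ?Z and w = w and f = ?f] lp(2)
        by (simp add: cyc_def One_nat_def)
      also have "\<dots> = path_prod ?Z v (\<lambda>b. mat (z ?h) b (w ?h)) (w ?h) (cyc C)"
        by (rule path_prod_cong) (use setcyc[OF C] CQ wQ in auto)
      finally show ?thesis
        using wQ minC[OF C] CQ by (simp add: F_def subset_iff)
    qed
    have "(\<Prod>j\<in>A \<union> Q. ?g j) = prod ?g (\<Union>a\<in>A. block a) * prod ?g (\<Union>Cs)"
      unfolding cover using disj_bc finA finCs finC
      by (intro prod.union_disjoint) (auto simp: block_def)
    also have "prod ?g (\<Union>a\<in>A. block a) = (\<Prod>a\<in>A. prod ?g (block a))"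
      using finA disj_block by (intro prod.UNION_disjoint) (auto simp: block_def)
    also have "prod ?g (\<Union>Cs) = (\<Prod>C\<in>Cs. prod ?g C)"
      using finCs finC disj_cc by (subst prod.Union_disjoint) auto
    also have "(\<Prod>a\<in>A. prod ?g (block a)) * (\<Prod>C\<in>Cs. prod ?g C) = (\<Prod>c\<in>K. F u c v)"
      unfolding K_def prod.Plus[OF finA finCs] by (simp add: blk cy)
    finally show ?thesis .
  qed
  have "(\<Sum>w \<in> (A \<union> Q) \<rightarrow>\<^sub>E B. \<Prod>j\<in>A \<union> Q. mat (z (\<tau> j)) (w j) (w (\<tau> j))) =
      (\<Sum>u \<in> A \<rightarrow>\<^sub>E B. \<Sum>v \<in> Q \<rightarrow>\<^sub>E B. \<Prod>c\<in>K. F u c v)"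
    unfolding sum_PiE_Un[OF disj] by (simp only: split[OF refl])
  also have "\<dots> = (\<Sum>u \<in> A \<rightarrow>\<^sub>E B. \<Prod>c\<in>K. \<Sum>v \<in> S c \<rightarrow>\<^sub>E B. F u c v)"
  proof (rule sum.cong[OF refl])
    fix u
    have "finite K" using finA finCs by (simp add: K_def)
    from sum_PiE_UNION[where F = "F u" and S = S and X = B, OF this disjS cong]
    show "(\<Sum>v \<in> Q \<rightarrow>\<^sub>E B. \<Prod>c\<in>K. F u c v) = (\<Prod>c\<in>K. \<Sum>v \<in> S c \<rightarrow>\<^sub>E B. F u c v)"
      unfolding US .
  qed
  also have "\<dots> = (\<Sum>u \<in> A \<rightarrow>\<^sub>E B. (\<Prod>a\<in>A. mat (comp_list z (path a) \<circ> z (frt a)) (u a) (u (frt a))) *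
      (\<Prod>C\<in>Cs. lin_trace s (comp_list z (support \<tau> (Min C)))))"
  proof (rule sum.cong[OF refl])
    fix u assume u: "u \<in> A \<rightarrow>\<^sub>E B"
    have "(\<Sum>v \<in> set (path a) \<rightarrow>\<^sub>E B. F u (Inl a) v) = mat (comp_list z (path a) \<circ> z (frt a)) (u a) (u (frt a))"
      if a: "a \<in> A" for a
    proof -
      have lin: "\<And>j. j \<in> set (path a) \<Longrightarrow> z j \<in> lin_End s" using path_Q[OF a] z by auto
      have "(\<Sum>v \<in> set (path a) \<rightarrow>\<^sub>E B. F u (Inl a) v) =
          (\<Sum>b\<in>B. mat (comp_list z (path a)) (u a) b * mat (z (frt a)) b (u (frt a)))"
        unfolding F_def sum.case
      proof (rule sum_path_prod)
        show "distinct (path a)"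
          using inj_block[OF a] by (auto simp: path_def distinct_map intro: inj_on_subset)
        show "u a \<in> B" using u a by (rule PiE_mem)
      qed (rule lin)
      then show ?thesis using comp_list_lin[of "path a" z] lin by (simp add: mat_comp)
    qed
    moreover have "(\<Sum>v \<in> C \<rightarrow>\<^sub>E B. F u (Inr C) v) = lin_trace s (comp_list z (support \<tau> (Min C)))"
      if C: "C \<in> Cs" for C
    proof -
      have "z j \<in> lin_End s" if "j \<in> set (Min C # cyc C)" for j
        using that C z unfolding setcyc[OF C] by (auto simp: Cs_def)
      then have "(\<Sum>v \<in> set (Min C # cyc C) \<rightarrow>\<^sub>E B. F u (Inr C) v) = lin_trace s (comp_list z (Min C # cyc C))"
        unfolding F_def sum.case by (rule sum_cycle_path_prod[OF distcyc])
      then show ?thesis unfolding setcyc[OF C] unfolding cyc .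
    qed
    ultimately show "(\<Prod>c\<in>K. \<Sum>v \<in> S c \<rightarrow>\<^sub>E B. F u c v) =
        (\<Prod>a\<in>A. mat (comp_list z (path a) \<circ> z (frt a)) (u a) (u (frt a))) *
        (\<Prod>C\<in>Cs. lin_trace s (comp_list z (support \<tau> (Min C))))"
      unfolding K_def prod.Plus[OF finA finCs] by (simp add: S_def)
  qed
  finally show ?thesis
    unfolding path_def Cs_def by (simp only: sum_distrib_right[symmetric] mult.commute)
qed

end

text \<open>\<open>pop (inv \<sigma>)\<close> puts the vector of slot \<open>\<sigma> i\<close> into
  slot \<open>i\<close>, where its coordinate at \<open>w i\<close> is taken.\<close>

lemma (in finite_tensor_power) lin_trace_pop_tmap:
  assumes \<sigma>: "\<sigma> permutes {1..m}" and y: "y \<in> {1..m} \<rightarrow> lin_End sV"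
  shows "lin_trace sT (pop (inv \<sigma>) \<circ> tmap y) =
    (\<Sum>w\<in>words. \<Prod>i\<in>{1..m}. V.mat (y (\<sigma> i)) (w i) (w (\<sigma> i)))"
proof -
  have "pop (inv \<sigma>) \<circ> tmap y \<in> lin_End sT"
    by (intro lin_T_comp pop_lin permutes_inv \<sigma> tmap_lin y)
  then have "lin_trace sT (pop (inv \<sigma>) \<circ> tmap y) = (\<Sum>w\<in>words. coord w (pop (inv \<sigma>) (tmap y (tens w))))"
    by (simp add: lin_trace_coord)
  also have "\<dots> = (\<Sum>w\<in>words. \<Prod>i\<in>{1..m}. V.mat (y (\<sigma> i)) (w i) (w (\<sigma> i)))"
  proof (rule sum.cong[OF refl])
    fix w assume w: "w \<in> words"
    let ?v = "\<lambda>i\<in>{1..m}. y i (w i)"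
    have v: "?v \<in> vecs" "(\<lambda>i\<in>{1..m}. ?v (\<sigma> i)) \<in> vecs" by auto
    have "\<sigma> i \<in> {1..m} \<longleftrightarrow> i \<in> {1..m}" for i by (rule permutes_in_image[OF \<sigma>])
    then show "coord w (pop (inv \<sigma>) (tmap y (tens w))) = (\<Prod>i\<in>{1..m}. V.mat (y (\<sigma> i)) (w i) (w (\<sigma> i)))"
      unfolding tmap_tens[OF y words_vecs[OF w]] pop_inv_tens[OF \<sigma> v(1)] coord_tens[OF v(2)]
      by (intro prod.cong refl) (simp add: V.mat_def)
  qed
  finally show ?thesis .
qed

section \<open>The explicit formula\<close>

context tensor_pair
begin

text \<open>The definite description is not unfolded: the formula is paired with an arbitrary
  \<open>y\<close> and its pairing recognised as that of the permutation operator, so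
  \<open>corr_value\<close> identifies the two.\<close>

theorem T_map_eq_T_formula:
  assumes \<tau>: "\<tau> permutes {1..n + k}" and sp: "cycle_splitting n k \<tau> \<tau>1 \<tau>2 \<tau>3"
    and x: "x \<in> {1..k} \<rightarrow>\<^sub>E lin"
  shows "TM \<tau> x = T_formula sV n k sS tensS \<tau> \<tau>1 \<tau>3 x"
proof -
  interpret first_return \<tau> "{1..n}" "{n + 1..n + k}" by (rule first_return_interval[OF \<tau>])
  note D = cycle_splittingD[OF \<tau> sp]
  interpret splitting \<tau> "{1..n}" "{n + 1..n + k}" \<tau>1 \<tau>3 by (rule D(1))
  define M where "M i = word n x (tl (support \<tau>1 i))" for i
  define c where "c = (\<Prod>C \<in> B_cycles n k \<tau>. lin_trace sV (word n x (support \<tau> (Min C))))"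
  define F where "F = T_formula sV n k sS tensS \<tau> \<tau>1 \<tau>3 x"
  have F: "F = S.pop (inv \<tau>3) \<circ> fun_scale sS c (S.tmap M)"
    unfolding F_def T_formula_def c_def M_def ..
  have wd: "word n x js = comp_list (joint y x) js" if "set js \<subseteq> {n + 1..n + k}" for js y
    unfolding word_def comp_list_def
    by (rule foldr_cong[OF refl refl]) (use that in \<open>auto simp: joint_def\<close>)
  have wl: "word n x js \<in> lin" if "set js \<subseteq> {n + 1..n + k}" for js
  proof -
    \<comment> \<open>The identities are placeholders for \<open>y\<close>: words over
      \<open>B\<close> read only the slots filled by \<open>x\<close>.\<close>
    have "joint (\<lambda>i\<in>{1..n}. id) x j \<in> lin" if "j \<in> {n + 1..n + k}" for j
      by (rule PiE_mem[OF joint_PiE[OF x]]) (use that S.V.lin_id in auto)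
    then show ?thesis
      unfolding wd[OF that, of "\<lambda>i\<in>{1..n}. id"] using that by (intro S.V.comp_list_lin) auto
  qed
  have path: "tl (support \<tau>1 (\<tau>3 a)) = map (\<lambda>q. (\<tau> ^^ q) a) [1..<ret a]"
    "set (tl (support \<tau>1 (\<tau>3 a))) \<subseteq> {n + 1..n + k}" if a: "a \<in> {1..n}" for a
  proof -
    have "tl (support \<tau>1 (\<tau>3 a)) = map (\<lambda>q. (\<tau>1 ^^ q) (\<tau>3 a)) [1..<ret a]"
      unfolding D(4)[OF a] using ret(1)[OF a] by (simp add: upt_conv_Cons One_nat_def)
    also have "\<dots> = map (\<lambda>q. (\<tau> ^^ q) a) [1..<ret a]"
      by (rule map_cong[OF refl]) (use pow_\<tau>1[OF a] in auto)
    finally show eq: "tl (support \<tau>1 (\<tau>3 a)) = map (\<lambda>q. (\<tau> ^^ q) a) [1..<ret a]" .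
    show "set (tl (support \<tau>1 (\<tau>3 a))) \<subseteq> {n + 1..n + k}"
      unfolding eq using before_ret_B[OF a] by auto
  qed
  have M: "M \<in> {1..n} \<rightarrow> lin"
  proof
    fix i assume "i \<in> {1..n}"
    then obtain a where "a \<in> {1..n}" "i = \<tau>3 a" using permutes_image[OF \<tau>3] by blast
    then show "M i \<in> lin" unfolding M_def using wl path(2) by blast
  qed
  have Fl: "F \<in> lin_End sS"
    unfolding F by (intro S.lin_T_comp S.lin_T_scale S.pop_lin permutes_inv \<tau>3 S.tmap_lin M)
  have "lin_trace sS (F \<circ> S.tmap y) = tr_E (T.pop (inv \<tau>)) (joint y x)" if y: "y \<in> {1..n} \<rightarrow>\<^sub>E lin" for y
  proof -
    have yl: "y \<in> {1..n} \<rightarrow> lin" using y by auto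
    have My: "(\<lambda>i. M i \<circ> y i) \<in> {1..n} \<rightarrow> lin" using M yl by (auto intro!: S.V.lin_comp)
    have jl: "joint y x \<in> {1..n + k} \<rightarrow> lin" using joint_PiE[OF x y] by auto
    have pl: "S.pop (inv \<tau>3) \<in> lin_End sS" by (intro S.pop_lin permutes_inv \<tau>3)
    have "F \<circ> S.tmap y = fun_scale sS c (S.pop (inv \<tau>3) \<circ> (S.tmap M \<circ> S.tmap y))"
      unfolding F using pl by (simp add: fun_eq_iff fun_scale_def S.lin_T_iff)
    also have "S.tmap M \<circ> S.tmap y = S.tmap (\<lambda>i. M i \<circ> y i)" by (rule S.tmap_comp[OF M yl])
    finally have "lin_trace sS (F \<circ> S.tmap y) = c * lin_trace sS (S.pop (inv \<tau>3) \<circ> S.tmap (\<lambda>i. M i \<circ> y i))"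
      by (simp only: S.lin_trace_T_scale[OF S.lin_T_comp[OF pl S.tmap_lin[OF My]]])
    also have "lin_trace sS (S.pop (inv \<tau>3) \<circ> S.tmap (\<lambda>i. M i \<circ> y i)) =
        (\<Sum>u\<in>S.words. \<Prod>a\<in>{1..n}. S.V.mat (M (\<tau>3 a) \<circ> y (\<tau>3 a)) (u a) (u (\<tau>3 a)))"
      by (rule S.lin_trace_pop_tmap[OF \<tau>3 My])
    \<comment> \<open>The formula indexes \<open>M\<close> by the head of the
      \<open>\<tau>1\<close>-cycle, the contraction by the start of the \<tau>-segment; evaluating
      \<open>M\<close> at \<open>\<tau>3 a\<close> reconciles the two.\<close>
    also have "\<dots> = (\<Sum>u\<in>S.words. \<Prod>a\<in>{1..n}.
        S.V.mat (comp_list (joint y x) (map (\<lambda>q. (\<tau> ^^ q) a) [1..<ret a]) \<circ> joint y x (frt a)) (u a) (u (frt a)))"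
    proof (intro sum.cong prod.cong refl)
      fix u a assume a: "a \<in> {1..n}"
      have "\<tau>3 a \<in> {1..n}" using a permutes_in_image[OF \<tau>3] by blast
      then have "joint y x (\<tau>3 a) = y (\<tau>3 a)" by (simp add: joint_def)
      moreover have "M (\<tau>3 a) = comp_list (joint y x) (map (\<lambda>q. (\<tau> ^^ q) a) [1..<ret a])"
        unfolding M_def path(1)[OF a, symmetric] by (rule wd[OF path(2)[OF a]])
      ultimately show "S.V.mat (M (\<tau>3 a) \<circ> y (\<tau>3 a)) (u a) (u (\<tau>3 a)) =
          S.V.mat (comp_list (joint y x) (map (\<lambda>q. (\<tau> ^^ q) a) [1..<ret a]) \<circ> joint y x (frt a)) (u a) (u (frt a))"
        by (simp only: D(3)[symmetric])
    qed
    also have "c = (\<Prod>C | C \<subseteq> {n + 1..n + k} \<and> (\<exists>b\<in>{n + 1..n + k}. C = orbit \<tau> b).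
        lin_trace sV (comp_list (joint y x) (support \<tau> (Min C))))"
      unfolding c_def B_cycles_def
    proof (intro prod.cong refl)
      fix C assume "C \<in> {C. C \<subseteq> {n + 1..n + k} \<and> (\<exists>b\<in>{n + 1..n + k}. C = orbit \<tau> b)}"
      then obtain b where C: "C \<subseteq> {n + 1..n + k}" "C = orbit \<tau> b" by auto
      have "Min C \<in> C" using C orbit_nonempty[of \<tau> b] finite_subset by (intro Min_in) auto
      then have orb: "orbit \<tau> (Min C) = C" using orbit_eq[of "Min C" b] C(2) by simp
      have "set (support \<tau> (Min C)) \<subseteq> orbit \<tau> (Min C)" using orbit_pow[of _ "Min C"] by auto
      then have "set (support \<tau> (Min C)) \<subseteq> C" by (simp only: orb)
      then have "set (support \<tau> (Min C)) \<subseteq> {n + 1..n + k}" using C(1) by (rule subset_trans)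
      from wd[OF this]
      show "lin_trace sV (word n x (support \<tau> (Min C))) =
          lin_trace sV (comp_list (joint y x) (support \<tau> (Min C)))" by (rule arg_cong)
    qed
    also have "\<dots> * (\<Sum>u\<in>S.words. \<Prod>a\<in>{1..n}.
        S.V.mat (comp_list (joint y x) (map (\<lambda>q. (\<tau> ^^ q) a) [1..<ret a]) \<circ> joint y x (frt a)) (u a) (u (frt a))) =
        (\<Sum>w \<in> ({1..n} \<union> {n + 1..n + k}) \<rightarrow>\<^sub>E Bas. \<Prod>j\<in>{1..n} \<union> {n + 1..n + k}.
          S.V.mat (joint y x (\<tau> j)) (w j) (w (\<tau> j)))"
      by (rule S.V.sum_prod_cycles[OF first_return_axioms, symmetric])
        (rule funcset_mem[OF jl], simp only: atLeastAtMost_split)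
    also have "\<dots> = tr_E (T.pop (inv \<tau>)) (joint y x)"
      unfolding tr_E_def T.lin_trace_pop_tmap[OF \<tau> jl] atLeastAtMost_split[symmetric] by (rule refl)
    finally show ?thesis .
  qed
  then show ?thesis
    unfolding F_def[symmetric]
    by (rule corr_value[OF conjunct2[OF T_map_eqv_corr[OF \<tau>]] conjunct1[OF T_map_eqv_corr[OF \<tau>]] x Fl])
qed

end

theorem theorem2p22:
  fixes sV :: "rat \<Rightarrow> 'v \<Rightarrow> 'v::ab_group_add"
    and sS :: "rat \<Rightarrow> 's \<Rightarrow> 's::ab_group_add"
    and sT :: "rat \<Rightarrow> 't \<Rightarrow> 't::ab_group_add"
    and tensS :: "(nat \<Rightarrow> 'v) \<Rightarrow> 's"
    and tensT :: "(nat \<Rightarrow> 'v) \<Rightarrow> 't"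
    and d n k :: nat
  assumes "finite_dimensional_vector_space sV Bas"
    and "vector_space.dim sV (UNIV :: 'v set) = d"
    and "is_tensor_power sV n sS tensS"
    and "is_tensor_power sV (n + k) sT tensT"
  shows
    "(\<exists>\<Phi>. bij_betw \<Phi> (equivariant_maps sV n k sS tensS) (End_GL sV (n + k) sT tensT) \<and>
        (\<forall>H \<in> equivariant_maps sV n k sS tensS. \<forall>H' \<in> equivariant_maps sV n k sS tensS.
           \<Phi> (H + H') = \<Phi> H + \<Phi> H') \<and>
        (\<forall>c. \<forall>H \<in> equivariant_maps sV n k sS tensS.
           \<Phi> (fun_scale (fun_scale sS) c H) = fun_scale sT c (\<Phi> H)) \<and>
        (\<forall>H \<in> equivariant_maps sV n k sS tensS. \<forall>E \<in> End_GL sV (n + k) sT tensT.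
           corresponds sV n k sS tensS sT tensT H E \<longleftrightarrow> E = \<Phi> H)) \<and>
     (\<forall>\<tau>. \<tau> permutes {1..n + k} \<longrightarrow>
        perm_op (n + k) sT tensT (inv \<tau>) \<in> End_GL sV (n + k) sT tensT \<and>
        T_map sV n k sS tensS sT tensT \<tau> \<in> equivariant_maps sV n k sS tensS \<and>
        corresponds sV n k sS tensS sT tensT
          (T_map sV n k sS tensS sT tensT \<tau>) (perm_op (n + k) sT tensT (inv \<tau>)) \<and>
        (\<exists>!(\<tau>1, \<tau>2, \<tau>3). cycle_splitting n k \<tau> \<tau>1 \<tau>2 \<tau>3) \<and>
        (\<forall>\<tau>1 \<tau>2 \<tau>3. cycle_splitting n k \<tau> \<tau>1 \<tau>2 \<tau>3 \<longrightarrow>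
           (\<forall>x \<in> {1..k} \<rightarrow>\<^sub>E lin_End sV.
              T_map sV n k sS tensS sT tensT \<tau> x = T_formula sV n k sS tensS \<tau> \<tau>1 \<tau>3 x))) \<and>
     module.span (fun_scale (fun_scale sS))
       {T_map sV n k sS tensS sT tensT \<tau> | \<tau>. \<tau> permutes {1..n + k}} =
     equivariant_maps sV n k sS tensS"
proof -
  interpret V: finite_dimensional_vector_space sV Bas by (rule assms(1))
  interpret tensor_pair sV Bas n sS tensS k sT tensT
    by unfold_locales (fact assms)+
  show ?thesis
  proof (intro conjI allI impI ballI)
    show "\<exists>\<Phi>. bij_betw \<Phi> eqv EGL \<and>
        (\<forall>H \<in> eqv. \<forall>H' \<in> eqv. \<Phi> (H + H') = \<Phi> H + \<Phi> H') \<and>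
        (\<forall>c. \<forall>H \<in> eqv. \<Phi> (fun_scale (fun_scale sS) c H) = fun_scale sT c (\<Phi> H)) \<and>
        (\<forall>H \<in> eqv. \<forall>E \<in> EGL. corr H E \<longleftrightarrow> E = \<Phi> H)"
      by (intro exI[of _ corr_map] conjI allI ballI corr_map_properties)
    show "H.span {TM \<tau> | \<tau>. \<tau> permutes {1..n + k}} = eqv" by (rule span_T_maps)
    fix \<tau> assume \<tau>: "\<tau> permutes {1..n + k}"
    show "T.pop (inv \<tau>) \<in> EGL" by (rule T.pop_End_GL[OF permutes_inv[OF \<tau>]])
    show "TM \<tau> \<in> eqv" "corr (TM \<tau>) (T.pop (inv \<tau>))"
      using T_map_eqv_corr[OF \<tau>] by simp_all
    show "\<exists>!(\<tau>1, \<tau>2, \<tau>3). cycle_splitting n k \<tau> \<tau>1 \<tau>2 \<tau>3" by (rule cycle_splitting_unique[OF \<tau>])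
    show "TM \<tau> x = T_formula sV n k sS tensS \<tau> \<tau>1 \<tau>3 x"
      if "cycle_splitting n k \<tau> \<tau>1 \<tau>2 \<tau>3" "x \<in> {1..k} \<rightarrow>\<^sub>E lin" for \<tau>1 \<tau>2 \<tau>3 x
      by (rule T_map_eq_T_formula[OF \<tau> that])
  qed
qed

end
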